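(* Fix $1<q\le\infty$, $a\ge 1$ and $w\in RH_{s'}$ with $1\le s<\infty$. Then there exist constants $C=C(q,n,a,w,s)$ and $K_0=K_0(n,a)\ge 1$ with the following property. Assume that $F,G,H_1,H_2$ are non-negative measurable functions on $\mathbb{R}^n$ such that for every cube $Q$ there exist non-negative functions $G_Q$ and $H_Q$ with $F(x)\le G_Q(x)+H_Q(x)$ for a.e. $x\in Q$ and $$\Big(\frac1{|Q|}\int_Q H_Q^q\Big)^{1/q}\le a\,\big(MF(x)+MH_1(x)+H_2(\bar x)\big)\qquad\text{for all }x,\bar x\in Q,$$ $$\frac1{|Q|}\int_Q G_Q\le G(x)\qquad\text{for all }x\in Q.$$ Then for all $\lambda>0$, $K\ge K_0$ and $0<\gamma<1$, $$w\{MF>K\lambda,\ G+H_2\le\gamma\lambda\}\le C\Big(\frac{a^q}{K^q}+\frac{\gamma}{K}\Big)^{1/s}\,w\{MF+MH_1>\lambda\}.$$ As a consequence, for all $0<p<q/s$ there is a constant $C$ (not depending on $F,G,H_1,H_2$) such that $$\|MF\|_{L^p(w)}\le C\big(\|G\|_{L^p(w)}+\|MH_1\|_{L^p(w)}+\|H_2\|_{L^p(w)}\big)\qquad(1)$$ provided $\|MF\|_{L^p(w)}<\infty$, and $$\|MF\|_{L^{p,\infty}(w)}\le C\big(\|G\|_{L^{p,\infty}(w)}+\|MH_1\|_{L^{p,\infty}(w)}+\|H_2\|_{L^{p,\infty}(w)}\big)\qquad(2)$$ provided $\|MF\|_{L^{p,\infty}(w)}<\infty$. Furthermore, if $p\ge1$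 then (1) and (2) hold provided $F\in L^1(\mathbb{R}^n)$ (whether or not $MF\in L^p(w)$).
   Context: The setting is $\mathbb{R}^n$ with Lebesgue measure $dx$; $|E|$ is Lebesgue measure. A weight $w$ is a non-negative locally integrable function; $w(E)=\int_E w\,dx$, $L^p(w)=L^p(w\,dx)$, and $\|h\|_{L^{p,\infty}(w)}=\sup_{\lambda>0}\lambda\,w\{|h|>\lambda\}^{1/p}$. For $1<t<\infty$, $w\in RH_t$ means there is $C$ with $\big(\frac1{|B|}\int_B w^t\big)^{1/t}\le C\frac1{|B|}\int_B w$ for all balls (equivalently cubes) $B$; $w\in RH_\infty$ means $w(x)\le C\frac1{|B|}\int_B w$ for a.e. $x\in B$ and all $B$. $s'$ is the conjugate exponent of $s$ ($s'=\infty$ if $s=1$). $M$ is the uncentered Hardy--Littlewood maximal operator over cubes, $Mh(x)=\sup_{Q\ni x}\frac1{|Q|}\int_Q|h|$. When $q=\infty$, the $L^q$-average is the essential supremum over $Q$, the term $a^q/K^q$ is read as $0$, and $q/s=\infty$. *)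

theory Defs
  imports "HOL-Analysis.Analysis" "HOL-Probability.Essential_Supremum"
begin

text \<open>
  Non-negative measurable functions are Lebesgue measurable functions with values in
  \<^typ>\<open>ennreal\<close>, i.e. in \<open>[0,\<infinity>]\<close>; weights are real valued. Exponents that may be infinite
  are of type \<^typ>\<open>ennreal\<close>.
\<close>

text \<open>Intended for \<open>r > 0\<close> only.\<close>
definition ennreal_powr :: "ennreal \<Rightarrow> real \<Rightarrow> ennreal" (infixr "epowr" 80) where
  "x epowr r = (if x = \<infinity> then \<infinity> else ennreal (enn2real x powr r))"

definition conj_exponent :: "real \<Rightarrow> ennreal" where
  "conj_exponent s = (if s = 1 then \<infinity> else ennreal (s / (s - 1)))"

definition cubes :: "(real ^ 'n) set set" where
  "cubes = {cbox c (c + vec l) | c l. 0 < l}"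

definition avg :: "(real ^ 'n) set \<Rightarrow> (real ^ 'n \<Rightarrow> ennreal) \<Rightarrow> ennreal" where
  "avg E f = (\<integral>\<^sup>+ x. f x \<partial>lebesgue_on E) / emeasure lebesgue E"

definition avg_Lq :: "ennreal \<Rightarrow> (real ^ 'n) set \<Rightarrow> (real ^ 'n \<Rightarrow> ennreal) \<Rightarrow> ennreal" where
  "avg_Lq q E f =
     (if q = \<infinity> then esssup (lebesgue_on E) f
      else (avg E (\<lambda>x. f x epowr enn2real q)) epowr (1 / enn2real q))"

definition maximal :: "(real ^ 'n \<Rightarrow> ennreal) \<Rightarrow> real ^ 'n \<Rightarrow> ennreal" where
  "maximal h x = (SUP Q \<in> {Q \<in> cubes. x \<in> Q}. avg Q h)"

definition weight :: "(real ^ 'n \<Rightarrow> real) \<Rightarrow> bool" where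
  "weight w \<longleftrightarrow> w \<in> borel_measurable lebesgue \<and> (\<forall>x. 0 \<le> w x)
     \<and> (\<forall>S. compact S \<longrightarrow> w absolutely_integrable_on S)"

definition wmeasure :: "(real ^ 'n \<Rightarrow> real) \<Rightarrow> (real ^ 'n) measure" where
  "wmeasure w = density lebesgue (\<lambda>x. ennreal (w x))"

definition RH :: "ennreal \<Rightarrow> (real ^ 'n \<Rightarrow> real) set" where
  "RH t = {w. weight w \<and> (\<exists>C::real. \<forall>z r. 0 < r \<longrightarrow>
     (if t = \<infinity>
      then AE x in lebesgue_on (ball z r).
             ennreal (w x) \<le> ennreal C * avg (ball z r) (\<lambda>y. ennreal (w y))
      else (avg (ball z r) (\<lambda>y. ennreal (w y) epowr enn2real t)) epowr (1 / enn2real t)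
             \<le> ennreal C * avg (ball z r) (\<lambda>y. ennreal (w y))))}"

definition Lp_norm :: "real \<Rightarrow> (real ^ 'n \<Rightarrow> real) \<Rightarrow> (real ^ 'n \<Rightarrow> ennreal) \<Rightarrow> ennreal" where
  "Lp_norm p w h = (\<integral>\<^sup>+ x. h x epowr p \<partial>wmeasure w) epowr (1 / p)"

definition weak_Lp_norm :: "real \<Rightarrow> (real ^ 'n \<Rightarrow> real) \<Rightarrow> (real ^ 'n \<Rightarrow> ennreal) \<Rightarrow> ennreal" where
  "weak_Lp_norm p w h =
     (SUP t\<in>{0::real<..}. ennreal t * emeasure (wmeasure w) {x. ennreal t < h x} epowr (1 / p))"

definition cube_decomposition ::
  "ennreal \<Rightarrow> real \<Rightarrow> (real ^ 'n \<Rightarrow> ennreal) \<Rightarrow> (real ^ 'n \<Rightarrow> ennreal) \<Rightarrow>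
   (real ^ 'n \<Rightarrow> ennreal) \<Rightarrow> (real ^ 'n \<Rightarrow> ennreal) \<Rightarrow> bool" where
  "cube_decomposition q a F G H1 H2 \<longleftrightarrow>
     (\<forall>Q\<in>cubes. \<exists>GQ HQ.
        GQ \<in> borel_measurable (lebesgue_on Q) \<and> HQ \<in> borel_measurable (lebesgue_on Q) \<and>
        (AE x in lebesgue_on Q. F x \<le> GQ x + HQ x) \<and>
        (\<forall>x\<in>Q. \<forall>x'\<in>Q. avg_Lq q Q HQ \<le> ennreal a * (maximal F x + maximal H1 x + H2 x')) \<and>
        (\<forall>x\<in>Q. avg Q GQ \<le> G x))"

text \<open>The quantity \<open>a\<^sup>q / K\<^sup>q\<close>, read as \<open>0\<close> for \<open>q = \<infinity>\<close>.\<close>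
definition ratio_pow :: "ennreal \<Rightarrow> real \<Rightarrow> real \<Rightarrow> real" where
  "ratio_pow q a K = (if q = \<infinity> then 0 else a powr enn2real q / K powr enn2real q)"

end

theory Submission
  imports Defs
begin

text \<open>
  The good-\<open>\<lambda>\<close> inequality is proved ball by ball. Let \<open>E = {MF + MH1 > \<lambda>}\<close>, an open set, and cover it by
  balls \<open>ball z (5r)\<close> with \<open>10 r\<close> the distance of \<open>z\<close> to the complement of \<open>E\<close> and with disjoint \<open>ball z r\<close> (Vitali).
  For \<open>K \<ge> 16\<^sup>n\<close> only cubes inside the cube \<open>Q\<close> of centre \<open>z\<close> and half side \<open>10 r\<close> contribute to \<open>{MF > K \<lambda>}\<close>
  on such a ball, and \<open>Q\<close> meets the complement of \<open>E\<close>. There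
  \<open>F \<le> K \<lambda> / 2 + G\<^sub>Q + (K \<lambda> / 2)\<^sup>1\<^sup>-\<^sup>q H\<^sub>Q\<^sup>q\<close>, so the weak type (1,1) bound shows that the exceptional
  part of the ball has relative measure at most a constant times \<open>a\<^sup>q/K\<^sup>q + \<gamma>/K\<close>. The reverse Hoelder condition turns this
  into a bound for the weighted measure, which is doubling.

  For the norm inequalities the a priori finiteness of \<open>MF\<close> is replaced, when \<open>F\<close> is integrable and \<open>p \<ge> 1\<close>,
  by \<open>t \<mu>{(MF)\<^sup>p > t} \<le> M\<close> for \<open>t \<le> 1\<close>. This holds when the weight is bounded, and the truncated weights \<open>min w N\<close>
  satisfy the same absolute continuity estimate with constants independent of \<open>N\<close>, so that \<open>N \<rightarrow> \<infinity>\<close> is allowed.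
\<close>


section \<open>Cubes and the maximal function\<close>

text \<open>Cutting at a height, in the form
  \<open>y \<le> \<tau> + \<tau> powr (1 - t) * y epowr t\<close>, takes the place of Hoelder's
  inequality for \<open>H\<^sub>Q\<close> and for the weight alike. Of the weight only the absolute
  continuity estimate \<open>ainf\<close> is kept: it implies doubling with a constant depending on
  its parameters alone, which is what makes the estimates uniform over truncated weights. A covering
  of E by balls measured against its complement fails when E is the whole space; then the mass of
  such a measure, being 0 or infinite, settles the claim. The condition p < q/s reflects a balance.
  Raising the level by 2K costs (2K)^p, while the good-\<lambda> factor gains about K^(-q/s): K is
  taken large first, and \<gamma> small afterwards. The remaining obstacle is the absorption of the
  term with MF, which needs a finite quantity. The distribution function f is therefore cut off near
  0 and infinity. The cut at height e near 0 costs e f(e), which is bounded by M; the resulting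
  bound with the extra M shows finiteness, and absorption without a cut then gives a bound free of
  M. Strong and weak norms are treated at once by an abstract functional of f.\<close>

definition qcube :: "real ^ 'n \<Rightarrow> real \<Rightarrow> (real ^ 'n) set" where
  "qcube m h = cbox (m - vec h) (m + vec h)"

lemma mem_qcube: "x \<in> qcube m h \<longleftrightarrow> (\<forall>i. \<bar>x $ i - m $ i\<bar> \<le> h)"
  by (auto simp: qcube_def mem_box_cart abs_le_iff algebra_simps)

text \<open>Centre and half side present cubes as closed balls of the maximum norm, so that dilation
  and inclusion become coordinatewise inequalities.\<close>

lemma cubes_eq_qcube: "(cubes :: (real ^ 'n) set set) = {qcube m h | m h. 0 < h}"
proof (intro set_eqI iffI)
  fix Q :: "(real ^ 'n) set" assume "Q \<in> cubes"
  then obtain c l where Q: "Q = cbox c (c + vec l)" "0 < l" by (auto simp: cubes_def)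
  have "Q = qcube (c + vec (l/2)) (l/2)"
    unfolding qcube_def Q by (rule arg_cong2[where f = cbox]) (simp_all add: vec_eq_iff)
  with Q show "Q \<in> {qcube m h | m h. 0 < h}" by (auto intro!: exI[of _ "l/2"])
next
  fix Q :: "(real ^ 'n) set" assume "Q \<in> {qcube m h | m h. 0 < h}"
  then obtain m h where Q: "Q = qcube m h" "0 < h" by auto
  have "Q = cbox (m - vec h) ((m - vec h) + vec (2*h))"
    unfolding qcube_def Q by (rule arg_cong2[where f = cbox]) (simp_all add: vec_eq_iff)
  with Q show "Q \<in> cubes" unfolding cubes_def by (auto intro!: exI[of _ "m - vec h"] exI[of _ "2*h"])
qed

lemma qcube_in_cubes [simp]: "0 < h \<Longrightarrow> qcube m h \<in> cubes"
  by (auto simp: cubes_eq_qcube)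

lemma cubesE:
  assumes "Q \<in> cubes" obtains m h where "Q = qcube m h" "0 < h"
  using assms by (auto simp: cubes_eq_qcube)

lemma sets_qcube [measurable, simp]: "qcube m h \<in> sets lebesgue"
  by (simp add: qcube_def)

lemma borel_qcube [simp]: "qcube m h \<in> sets borel"
  by (simp add: qcube_def)

lemma emeasure_qcube:
  fixes m :: "real ^ 'n"
  assumes "0 \<le> h"
  shows "emeasure lebesgue (qcube m h) = ennreal ((2 * h) ^ CARD('n))"
proof -
  have *: "((m + vec h) - (m - vec h)) \<bullet> b = 2 * h" "(m - vec h) \<bullet> b \<le> (m + vec h) \<bullet> b" 
    if "b \<in> Basis" for b :: "real ^ 'n"
    using that assms by (auto simp: Basis_vec_def inner_axis)
  have "emeasure lebesgue (qcube m h) = emeasure lborel (qcube m h)" by simp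
  also have "\<dots> = ennreal (\<Prod>b\<in>(Basis :: (real ^ 'n) set). 2 * h)"
    unfolding qcube_def using * by (simp add: emeasure_lborel_cbox)
  finally show ?thesis by simp
qed

lemma emeasure_ball_pow:
  fixes z :: "real ^ 'n"
  assumes "0 \<le> r"
  shows "emeasure lebesgue (ball z r) = ennreal (unit_ball_vol CARD('n) * r ^ CARD('n))"
  using emeasure_ball[OF assms, of z] by simp

lemma qcube_subset_ball:
  fixes m :: "real ^ 'n" and h :: real
  assumes "0 < h"
  shows "qcube m h \<subseteq> ball m (2 * CARD('n) * h)"
proof
  fix x assume "x \<in> qcube m h"
  then have *: "\<bar>(x - m) $ i\<bar> \<le> h" for i by (simp add: mem_qcube)
  have "norm (x - m) \<le> (\<Sum>i\<in>UNIV. \<bar>(x - m) $ i\<bar>)" by (rule norm_le_l1_cart)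
  also have "\<dots> \<le> (\<Sum>i\<in>(UNIV :: 'n set). h)" by (intro sum_mono *)
  also have "\<dots> < 2 * CARD('n) * h" using assms by simp
  finally show "x \<in> ball m (2 * CARD('n) * h)" by (simp add: dist_norm norm_minus_commute)
qed

lemma ball_subset_qcube: "ball m h \<subseteq> qcube m h"
proof
  fix x assume "x \<in> ball m h"
  then have "norm (x - m) < h" by (simp add: dist_norm norm_minus_commute)
  then show "x \<in> qcube m h" 
    using component_le_norm_cart[of "x - m"] by (auto simp: mem_qcube intro: order_trans less_imp_le)
qed

lemma ennreal_divide_le_iff:
  fixes x c :: ennreal
  assumes "0 < b"
  shows "x / ennreal b \<le> c \<longleftrightarrow> x \<le> c * ennreal b"
proof -
  have b: "ennreal b \<noteq> 0" "ennreal b \<noteq> top" "ennreal b < top" using assms by auto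
  show ?thesis
  proof
    assume "x / ennreal b \<le> c"
    then have "x / ennreal b * ennreal b \<le> c * ennreal b" by (rule mult_right_mono) simp
    then show "x \<le> c * ennreal b" using b by (simp add: ennreal_divide_times)
  next
    assume "x \<le> c * ennreal b"
    then have "x / ennreal b \<le> c * ennreal b / ennreal b" by (rule divide_right_mono_ennreal)
    then show "x / ennreal b \<le> c" using b by (simp add: ennreal_mult_divide_eq)
  qed
qed

lemma avg_cube_le_iff:
  assumes "Q \<in> cubes"
  shows "avg Q f \<le> c \<longleftrightarrow> (\<integral>\<^sup>+ x. f x \<partial>lebesgue_on Q) \<le> c * emeasure lebesgue Q"
proof -
  from assms obtain m h where Q: "Q = qcube m h" "0 < h" by (rule cubesE)
  then show ?thesis unfolding avg_def Q(1) emeasure_qcube[OF less_imp_le[OF Q(2)]]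
    by (intro ennreal_divide_le_iff) simp
qed

lemma less_avg_cube_iff:
  assumes "Q \<in> cubes"
  shows "c < avg Q f \<longleftrightarrow> c * emeasure lebesgue Q < (\<integral>\<^sup>+ x. f x \<partial>lebesgue_on Q)"
  using avg_cube_le_iff[OF assms, of f c] by (simp add: not_le[symmetric])

lemma avg_le_maximal:
  assumes "Q \<in> cubes" "x \<in> Q"
  shows "avg Q f \<le> maximal f x"
  unfolding maximal_def using assms by (intro SUP_upper) auto

lemma less_maximalE:
  assumes "c < maximal f x"
  obtains m h where "0 < h" "x \<in> qcube m h" "c < avg (qcube m h) f"
  using assms unfolding maximal_def less_SUP_iff by (auto elim!: cubesE)

lemma qcube_mono: "(\<And>i. \<bar>m $ i - m' $ i\<bar> + h \<le> h') \<Longrightarrow> qcube m h \<subseteq> qcube m' h'"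
proof 
  fix x assume *: "\<And>i. \<bar>m $ i - m' $ i\<bar> + h \<le> h'" and x: "x \<in> qcube m h"
  show "x \<in> qcube m' h'" unfolding mem_qcube
  proof
    fix i
    have "\<bar>x $ i - m $ i\<bar> \<le> h" using x by (simp add: mem_qcube)
    then show "\<bar>x $ i - m' $ i\<bar> \<le> h'" using *[of i] by linarith
  qed
qed

lemma nn_integral_lebesgue_on_mono:
  assumes "A \<in> sets lebesgue" "B \<in> sets lebesgue" "A \<subseteq> B"
  shows "(\<integral>\<^sup>+ x. f x \<partial>lebesgue_on A) \<le> (\<integral>\<^sup>+ x. f x \<partial>lebesgue_on B)"
  using assms by (auto simp: nn_integral_restrict_space indicator_def intro!: nn_integral_mono)

text \<open>The strict inequality for the average over a cube survives a slight enlargement of the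
  cube, and the enlarged cube contains a neighbourhood of \<open>x\<close>.\<close>

lemma open_maximal_greater:
  fixes f :: "real ^ 'n \<Rightarrow> ennreal"
  shows "open {x. c < maximal f x}"
proof (subst open_subopen, clarify)
  fix x :: "real ^ 'n" assume "c < maximal f x"
  then obtain m h where Q: "0 < h" "x \<in> qcube m h" "c < avg (qcube m h) f" by (rule less_maximalE)
  let ?n = "CARD('n)" and ?I = "\<integral>\<^sup>+ y. f y \<partial>lebesgue_on (qcube m h)"
  have less: "c * ennreal ((2 * h) ^ ?n) < ?I"
    using Q(3) Q(1) by (subst (asm) less_avg_cube_iff) (simp_all only: qcube_in_cubes emeasure_qcube less_imp_le)
  \<comment> \<open>The volume is continuous in the half side, which provides the enlarged
    \<open>k\<close>. For \<open>c = top\<close> the inequality \<open>less\<close> is already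
    contradictory.\<close>
  have "((\<lambda>k. c * ennreal ((2 * k) ^ ?n)) \<longlongrightarrow> c * ennreal ((2 * h) ^ ?n)) (at_right h)"
  proof (cases "c = top")
    case True
    moreover have "ennreal ((2 * h) ^ ?n) \<noteq> 0" using Q(1) by (simp add: ennreal_eq_0_iff not_le)
    ultimately show ?thesis using less by (simp only: ennreal_top_mult if_False not_top_less)
  next
    case False
    then show ?thesis by (intro tendsto_intros ennreal_tendsto_cmult) (auto simp: top.not_eq_extremum)
  qed
  then have "\<forall>\<^sub>F k in at_right h. c * ennreal ((2 * k) ^ ?n) < ?I"
    using less by (rule order_tendstoD)
  moreover have "\<forall>\<^sub>F k in at_right h. h < k" by (simp add: eventually_at_right_less)
  ultimately obtain k where k: "h < k" "c * ennreal ((2 * k) ^ ?n) < ?I"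
    by (metis (mono_tags, lifting) eventually_conj eventually_happens' trivial_limit_at_right_real)
  have kpos: "0 < k" using k Q by simp
  have "?I \<le> (\<integral>\<^sup>+ y. f y \<partial>lebesgue_on (qcube m k))"
    using k by (intro nn_integral_lebesgue_on_mono qcube_mono) auto
  then have avg: "c < avg (qcube m k) f"
    using k(2) kpos by (subst less_avg_cube_iff) (simp_all only: qcube_in_cubes emeasure_qcube less_imp_le)
  show "\<exists>T. open T \<and> x \<in> T \<and> T \<subseteq> {x. c < maximal f x}"
  proof (intro exI[of _ "ball x (k - h)"] conjI subsetI CollectI)
    fix y assume "y \<in> ball x (k - h)"
    then have "y \<in> qcube x (k - h)" using ball_subset_qcube by blast
    moreover have "qcube x (k - h) \<subseteq> qcube m k"
      using Q(2) by (intro qcube_mono) (auto simp: mem_qcube)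
    ultimately show "c < maximal f y"
      using avg avg_le_maximal[of "qcube m k" y f] kpos by (auto intro: less_le_trans)
  qed (use k in auto)
qed

lemma borel_measurable_maximal [measurable]: "maximal f \<in> borel_measurable borel"
  by (rule borel_measurableI_greater) (simp add: open_maximal_greater)

text \<open>A sum above \<open>c\<close> splits into thresholds \<open>u\<close>, \<open>v\<close>
  strictly below the two summands with \<open>c \<le> u + v\<close>. No threshold lies strictly
  below 0, so a vanishing summand is treated apart.\<close>

lemma open_maximal_add_greater:
  fixes f :: "real ^ 'n \<Rightarrow> ennreal"
  shows "open {x. ennreal c < maximal f x + maximal g x}"
proof (subst open_subopen, clarify)
  fix x :: "real ^ 'n" assume *: "ennreal c < maximal f x + maximal g x"
  consider "maximal f x = 0" | "maximal g x = 0" | "maximal f x \<noteq> 0" "maximal g x \<noteq> 0" by blast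
  then show "\<exists>T. open T \<and> x \<in> T \<and> T \<subseteq> {x. ennreal c < maximal f x + maximal g x}"
  proof cases
    case 1
    then show ?thesis using *
      by (intro exI[of _ "{x. ennreal c < maximal g x}"])
        (auto simp: open_maximal_greater intro: less_le_trans)
  next
    case 2
    then show ?thesis using *
      by (intro exI[of _ "{x. ennreal c < maximal f x}"])
        (auto simp: open_maximal_greater intro: less_le_trans)
  next
    case 3
    then have pos: "0 < maximal f x" "0 < maximal g x" by (simp_all add: zero_less_iff_neq_zero)
    obtain u v where uv: "u < maximal f x" "v < maximal g x" "ennreal c \<le> u + v"
    proof -
      consider "maximal f x = top" | "maximal g x = top" | "maximal f x < top" "maximal g x < top"
        using less_top by blast
      then show ?thesis
      proof cases
        case 1 then show ?thesis using pos that[of "ennreal c" 0] by simp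
      next
        case 2 then show ?thesis using pos that[of 0 "ennreal c"] by simp
      next
        case 3
        define r s where "r = enn2real (maximal f x)" and "s = enn2real (maximal g x)"
        have rs: "maximal f x = ennreal r" "maximal g x = ennreal s" "0 < r" "0 < s"
          using 3 pos by (auto simp: r_def s_def enn2real_positive_iff)
        have lt: "c < r + s" using * rs by (simp add: ennreal_plus[symmetric] ennreal_less_iff del: ennreal_plus)
          (metis ennreal_less_iff ennreal_lessI less_eq_real_def linorder_not_less add_pos_pos ennreal_leI)
        \<comment> \<open>Half of the slack \<open>r + s - c\<close>, capped so that
          \<open>r - d\<close> and \<open>s - d\<close> stay positive.\<close>
        define d where "d = min (min (r/2) (s/2)) ((r + s - c) / 2)"
        have d: "d \<le> r/2" "d \<le> s/2" "d \<le> (r + s - c) / 2"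
          unfolding d_def by (simp, simp, rule min.cobounded2)
        have "d < r" "d < s" using d(1,2) rs(3,4) by linarith+
        moreover have "c \<le> (r - d) + (s - d)" using d(3) by (simp add: field_simps)
        moreover have "0 < d" using lt rs by (auto simp: d_def)
        ultimately show ?thesis using rs
          by (intro that[of "ennreal (r - d)" "ennreal (s - d)"])
            (auto simp: ennreal_less_iff ennreal_plus[symmetric] intro!: ennreal_leI simp del: ennreal_plus)
      qed
    qed
    show ?thesis
      using uv by (intro exI[of _ "{x. u < maximal f x} \<inter> {x. v < maximal g x}"])
        (auto simp: open_maximal_greater intro: le_less_trans add_strict_mono)
  qed
qed


section \<open>Covering and weak type estimates\<close>

text \<open>The summation step of both Vitali arguments: \<open>A i\<close> are the selected
  disjoint sets, \<open>B i\<close> the enlarged pieces that cover. Two measures are allowed because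
  the weak type estimate compares Lebesgue measure with a measure given by a density.\<close>

lemma emeasure_UN_le_disjoint:
  assumes C: "countable C" and disj: "disjoint_family_on A C"
    and A: "\<And>i. i \<in> C \<Longrightarrow> A i \<in> sets N" "\<And>i. i \<in> C \<Longrightarrow> A i \<subseteq> W" and W: "W \<in> sets N"
    and B: "\<And>i. i \<in> C \<Longrightarrow> B i \<in> sets M"
    and le: "\<And>i. i \<in> C \<Longrightarrow> emeasure M (B i) \<le> k * emeasure N (A i)"
  shows "emeasure M (\<Union>i\<in>C. B i) \<le> k * emeasure N W"
proof -
  define g where "g = from_nat_into C"
  define J where "J = to_nat_on C ` C"
  have g: "g n \<in> C" if "n \<in> J" for n
    using that C by (auto simp: g_def J_def)
  have inj: "n = m" if "n \<in> J" "m \<in> J" "g n = g m" for n m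
    using that C by (auto simp: g_def J_def)
  define A' B' where "A' n = (if n \<in> J then A (g n) else {})" 
    and "B' n = (if n \<in> J then B (g n) else {})" for n
  have U: "(\<Union>i\<in>C. B i) = (\<Union>n. B' n)"
    using C g by (fastforce simp: B'_def g_def J_def split: if_splits)
  have dA: "disjoint_family A'"
    using disj g inj unfolding disjoint_family_on_def A'_def by (auto; metis disjoint_iff)
  have "emeasure M (\<Union>n. B' n) \<le> (\<Sum>n. emeasure M (B' n))"
    using B g by (intro emeasure_subadditive_countably) (auto simp: B'_def)
  also have "\<dots> \<le> (\<Sum>n. k * emeasure N (A' n))"
    using le g by (intro suminf_le) (auto simp: A'_def B'_def)
  also have "\<dots> = k * (\<Sum>n. emeasure N (A' n))" by simp
  also have "(\<Sum>n. emeasure N (A' n)) = emeasure N (\<Union>n. A' n)"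
    using A g by (intro suminf_emeasure dA) (auto simp: A'_def)
  also have "\<dots> \<le> emeasure N W"
    using A g W by (intro emeasure_mono) (auto simp: A'_def split: if_splits)
  finally show ?thesis unfolding U by (simp add: mult_left_mono)
qed

text \<open>A cube of half side h lies in the ball of radius 2nh about its centre, and five times
  that ball lies in the cube of half side 10nh. Vitali's lemma for balls thus transfers to cubes,
  and the volume ratio is the constant (10n)^n. A measurable superset \<open>T\<close> stands in for
  the uncountable union of cubes.\<close>

lemma vitali_cubes:
  fixes m :: "'i \<Rightarrow> real ^ 'n"
  assumes h: "\<And>i. i \<in> I \<Longrightarrow> 0 < h i \<and> h i \<le> B"
    and N: "sets N = sets lebesgue" and W: "W \<in> sets lebesgue" "\<And>i. i \<in> I \<Longrightarrow> qcube (m i) (h i) \<subseteq> W"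
    and le: "\<And>i. i \<in> I \<Longrightarrow> ennreal \<tau> * emeasure lebesgue (qcube (m i) (h i)) \<le> emeasure N (qcube (m i) (h i))"
    and \<tau>: "0 < \<tau>"
  shows "\<exists>T\<in>sets lebesgue. (\<Union>i\<in>I. qcube (m i) (h i)) \<subseteq> T \<and> 
    emeasure lebesgue T \<le> ennreal ((10 * real CARD('n)) ^ CARD('n) / \<tau>) * emeasure N W"
proof -
  let ?n = "real CARD('n)"
  have n: "?n > 0" by simp
  obtain C where C: "countable C" "C \<subseteq> I"
    "pairwise (\<lambda>i j. disjnt (ball (m i) (2 * ?n * h i)) (ball (m j) (2 * ?n * h j))) C"
    "(\<Union>i\<in>I. ball (m i) (2 * ?n * h i)) \<subseteq> (\<Union>i\<in>C. ball (m i) (5 * (2 * ?n * h i)))"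
    by (rule Vitali_covering_lemma_balls[where S = "\<Union>i\<in>I. ball (m i) (2 * ?n * h i)" and K = I and a = m 
      and r = "\<lambda>i. 2 * ?n * h i" and B = "2 * ?n * B", OF order_refl]) (use h in auto)
  have sub: "qcube (m i) (h i) \<subseteq> ball (m i) (2 * ?n * h i)" if "i \<in> I" for i
    using qcube_subset_ball[of "h i" "m i"] h[OF that] by simp
  define T where "T = (\<Union>i\<in>C. qcube (m i) (10 * ?n * h i))"
  have "disjoint_family_on (\<lambda>i. qcube (m i) (h i)) C"
    unfolding disjoint_family_on_def
  proof (intro ballI impI)
    fix i j assume "i \<in> C" "j \<in> C" "i \<noteq> j"
    with C(3) have "ball (m i) (2 * ?n * h i) \<inter> ball (m j) (2 * ?n * h j) = {}"
      by (simp add: pairwise_def disjnt_def)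
    moreover have "qcube (m i) (h i) \<subseteq> ball (m i) (2 * ?n * h i)" "qcube (m j) (h j) \<subseteq> ball (m j) (2 * ?n * h j)"
      using \<open>i \<in> C\<close> \<open>j \<in> C\<close> C(2) sub by blast+
    ultimately show "qcube (m i) (h i) \<inter> qcube (m j) (h j) = {}" by blast
  qed
  moreover have "emeasure lebesgue (qcube (m i) (10 * ?n * h i)) 
    \<le> ennreal ((10 * ?n) ^ CARD('n) / \<tau>) * emeasure N (qcube (m i) (h i))" if "i \<in> C" for i
  proof -
    have hi: "0 < h i" using that C h by auto
    have "emeasure lebesgue (qcube (m i) (10 * ?n * h i)) 
        = ennreal ((10 * ?n) ^ CARD('n) / \<tau> * (\<tau> * (2 * h i) ^ CARD('n)))"
      using hi \<tau> by (subst emeasure_qcube) (auto intro!: arg_cong[where f = ennreal] simp: power_mult_distrib simp flip: power_mult_distrib[of 10 "2 :: real"])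
    also have "\<dots> = ennreal ((10 * ?n) ^ CARD('n) / \<tau>) * (ennreal \<tau> * emeasure lebesgue (qcube (m i) (h i)))"
    proof -
      have *: "ennreal (x * (\<tau> * y)) = ennreal x * (ennreal \<tau> * ennreal y)" if "0 \<le> x" "0 \<le> y" for x y
        using that \<tau> by (simp add: ennreal_mult)
      show ?thesis unfolding emeasure_qcube[OF less_imp_le[OF hi]] by (rule *) (use hi \<tau> in auto)
    qed
    also have "\<dots> \<le> ennreal ((10 * ?n) ^ CARD('n) / \<tau>) * emeasure N (qcube (m i) (h i))"
      using le[of i] C(2) that by (intro mult_left_mono) auto
    finally show ?thesis .
  qed
  ultimately have "emeasure lebesgue T \<le> ennreal ((10 * ?n) ^ CARD('n) / \<tau>) * emeasure N W"
    unfolding T_def using C(2) W N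
    by (intro emeasure_UN_le_disjoint[OF C(1), where A = "\<lambda>i. qcube (m i) (h i)"]) auto
  moreover have "T \<in> sets lebesgue" unfolding T_def using C(1) by auto
  moreover have "(\<Union>i\<in>I. qcube (m i) (h i)) \<subseteq> T"
  proof -
    have "(\<Union>i\<in>I. qcube (m i) (h i)) \<subseteq> (\<Union>i\<in>C. ball (m i) (5 * (2 * ?n * h i)))"
      using sub C(4) by blast
    also have "\<dots> \<subseteq> T" unfolding T_def using ball_subset_qcube by (fastforce simp: mult_ac)
    finally show ?thesis .
  qed
  ultimately show ?thesis by auto
qed

lemma nn_integral_lebesgue_on:
  "A \<in> sets lebesgue \<Longrightarrow> (\<integral>\<^sup>+ x. f x \<partial>lebesgue_on A) = (\<integral>\<^sup>+ x. f x * indicator A x \<partial>lebesgue)"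
  by (simp add: nn_integral_restrict_space)

text \<open>Vitali selection with respect to the measure of density \<open>\<Phi>\<close> on
  \<open>W\<close>. The predicate \<open>P\<close> selects the cubes, so that the local and the
  global weak type estimate are both instances.\<close>

lemma weak_type_cubes:
  fixes P :: "real ^ 'n \<Rightarrow> real \<Rightarrow> bool"
  assumes W: "W \<in> sets lebesgue" and \<tau>: "0 < \<tau>" and B: "\<And>m h. 0 < h \<Longrightarrow> P m h \<Longrightarrow> h \<le> B"
    and \<Phi>: "\<Phi> \<in> borel_measurable (lebesgue_on W)"
    and P: "\<And>m h. 0 < h \<Longrightarrow> P m h \<Longrightarrow> qcube m h \<subseteq> W \<and> 
      ennreal \<tau> * emeasure lebesgue (qcube m h) \<le> (\<integral>\<^sup>+ x. \<Phi> x \<partial>lebesgue_on (qcube m h))"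
  shows "\<exists>T\<in>sets lebesgue. (\<forall>m h. 0 < h \<longrightarrow> P m h \<longrightarrow> qcube m h \<subseteq> T) \<and> 
    emeasure lebesgue T \<le> ennreal ((10 * real CARD('n)) ^ CARD('n) / \<tau>) * (\<integral>\<^sup>+ x. \<Phi> x \<partial>lebesgue_on W)"
proof -
  define N where "N = density lebesgue (\<lambda>x. \<Phi> x * indicator W x)"
  have meas: "(\<lambda>x. \<Phi> x * indicator W x) \<in> borel_measurable lebesgue"
    using \<Phi> W by (subst (asm) borel_measurable_restrict_space_iff_ennreal) auto
  have N: "emeasure N A = (\<integral>\<^sup>+ x. \<Phi> x \<partial>lebesgue_on A)" if "A \<in> sets lebesgue" "A \<subseteq> W" for A
    using that meas unfolding N_def
    by (subst emeasure_density) (auto simp: nn_integral_lebesgue_on indicator_def intro!: nn_integral_cong)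
  define I where "I = {(m :: real ^ 'n, h). 0 < h \<and> P m h}"
  have "\<exists>T\<in>sets lebesgue. (\<Union>i\<in>I. qcube (fst i) (snd i)) \<subseteq> T \<and> 
    emeasure lebesgue T \<le> ennreal ((10 * real CARD('n)) ^ CARD('n) / \<tau>) * emeasure N W"
  proof (rule vitali_cubes[where B = B])
    fix i assume i: "i \<in> I"
    then have P_i: "0 < snd i" "P (fst i) (snd i)" by (auto simp: I_def)
    then show "0 < snd i \<and> snd i \<le> B" "qcube (fst i) (snd i) \<subseteq> W" using B P by blast+
    then show "ennreal \<tau> * emeasure lebesgue (qcube (fst i) (snd i)) \<le> emeasure N (qcube (fst i) (snd i))"
      using P[OF P_i] by (simp only: N sets_qcube)
  qed (use \<tau> W in \<open>auto simp: N_def\<close>)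
  then obtain T where "T \<in> sets lebesgue" "(\<Union>i\<in>I. qcube (fst i) (snd i)) \<subseteq> T" 
    "emeasure lebesgue T \<le> ennreal ((10 * real CARD('n)) ^ CARD('n) / \<tau>) * emeasure N W" by blast
  then show ?thesis unfolding N[OF W order_refl]
    by (intro bexI[of _ T] conjI allI impI) (fastforce simp: I_def)+
qed

lemma qcube_subset_imp_le:
  fixes m :: "real ^ 'n"
  assumes "qcube m h \<subseteq> qcube z \<rho>" "0 < h"
  shows "h \<le> \<rho>"
proof -
  have "m + vec h \<in> qcube m h" "m - vec h \<in> qcube m h" using assms(2) by (auto simp: mem_qcube)
  then have "m + vec h \<in> qcube z \<rho>" "m - vec h \<in> qcube z \<rho>" using assms(1) by auto
  then have "\<bar>m $ i + h - z $ i\<bar> \<le> \<rho>" "\<bar>m $ i - h - z $ i\<bar> \<le> \<rho>" for i by (auto simp: mem_qcube)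
  \<comment> \<open>One coordinate is enough; \<open>undefined\<close> just names an index.\<close>
  from this[of undefined] show ?thesis by linarith
qed

text \<open>If the average of \<open>F\<close> exceeds twice \<open>\<tau>\<close>, the constant
  part accounts for at most half of it, so the average of \<open>\<Phi>\<close> is at least
  \<open>\<tau>\<close>. Hence the weak type bound may be applied to \<open>\<Phi>\<close>
  alone.\<close>

lemma weak_type_above:
  fixes F :: "real ^ 'n \<Rightarrow> ennreal"
  assumes \<tau>: "0 < \<tau>" and \<Phi>: "\<Phi> \<in> borel_measurable (lebesgue_on (qcube z \<rho>))"
    and F: "AE x in lebesgue_on (qcube z \<rho>). F x \<le> ennreal \<tau> + \<Phi> x"
  shows "\<exists>T\<in>sets lebesgue. 
    (\<forall>m h. 0 < h \<longrightarrow> qcube m h \<subseteq> qcube z \<rho> \<longrightarrow> ennreal (2 * \<tau>) < avg (qcube m h) F \<longrightarrow> qcube m h \<subseteq> T) \<and> 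
    emeasure lebesgue T \<le> ennreal ((10 * real CARD('n)) ^ CARD('n) / \<tau>) * (\<integral>\<^sup>+ x. \<Phi> x \<partial>lebesgue_on (qcube z \<rho>))"
proof -
  have "ennreal \<tau> * emeasure lebesgue (qcube m h) \<le> (\<integral>\<^sup>+ x. \<Phi> x \<partial>lebesgue_on (qcube m h))"
    if h: "0 < h" and sub: "qcube m h \<subseteq> qcube z \<rho>" and less: "ennreal (2 * \<tau>) < avg (qcube m h) F" for m h
  proof -
    let ?Q = "qcube m h" and ?c = "ennreal \<tau> * emeasure lebesgue (qcube m h)"
    have meas: "(\<lambda>x. \<Phi> x * indicator ?Q x) \<in> borel_measurable lebesgue"
    proof -
      have "(\<lambda>x. \<Phi> x * indicator (qcube z \<rho>) x * indicator ?Q x) \<in> borel_measurable lebesgue"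
        using \<Phi> by (subst (asm) borel_measurable_restrict_space_iff_ennreal) auto
      also have "(\<lambda>x. \<Phi> x * indicator (qcube z \<rho>) x * indicator ?Q x) = (\<lambda>x. \<Phi> x * indicator ?Q x)"
        using sub by (auto simp: indicator_def fun_eq_iff)
      finally show ?thesis .
    qed
    have "?c + ?c = ennreal (2 * \<tau>) * emeasure lebesgue ?Q"
      using \<tau> by (simp only: mult_2[of \<tau>] ennreal_plus less_imp_le distrib_right)
    also have "\<dots> \<le> (\<integral>\<^sup>+ x. F x * indicator ?Q x \<partial>lebesgue)"
      using less less_avg_cube_iff[OF qcube_in_cubes[OF h]] nn_integral_lebesgue_on[OF sets_qcube]
      by (metis less_imp_le)
    also have "\<dots> \<le> (\<integral>\<^sup>+ x. ennreal \<tau> * indicator ?Q x + \<Phi> x * indicator ?Q x \<partial>lebesgue)"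
    proof (rule nn_integral_mono_AE)
      have "AE x in lebesgue. x \<in> qcube z \<rho> \<longrightarrow> F x \<le> ennreal \<tau> + \<Phi> x"
        using F by (subst (asm) AE_restrict_space_iff) auto
      then show "AE x in lebesgue. F x * indicator ?Q x \<le> ennreal \<tau> * indicator ?Q x + \<Phi> x * indicator ?Q x"
        by eventually_elim (use sub in \<open>auto simp: indicator_def\<close>)
    qed
    also have "\<dots> = ?c + (\<integral>\<^sup>+ x. \<Phi> x \<partial>lebesgue_on ?Q)"
      using meas by (subst nn_integral_add) (auto simp: nn_integral_lebesgue_on nn_integral_cmult_indicator)
    finally have "?c + ?c \<le> ?c + (\<integral>\<^sup>+ x. \<Phi> x \<partial>lebesgue_on ?Q)" .
    moreover have "?c \<noteq> top"
      unfolding emeasure_qcube[OF less_imp_le[OF h]] by (simp add: ennreal_mult_eq_top_iff)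
    ultimately show ?thesis unfolding ennreal_add_left_cancel_le by simp
  qed
  then have "\<exists>T\<in>sets lebesgue. (\<forall>m h. 0 < h \<longrightarrow> (qcube m h \<subseteq> qcube z \<rho> \<and> ennreal (2 * \<tau>) < avg (qcube m h) F) \<longrightarrow> qcube m h \<subseteq> T) \<and> 
    emeasure lebesgue T \<le> ennreal ((10 * real CARD('n)) ^ CARD('n) / \<tau>) * (\<integral>\<^sup>+ x. \<Phi> x \<partial>lebesgue_on (qcube z \<rho>))"
    using \<tau> \<Phi> qcube_subset_imp_le by (intro weak_type_cubes[where B = \<rho>]) auto
  then show ?thesis by blast
qed

text \<open>A finite integral bounds the size of the cubes with average above \<open>t\<close>,
  which is what the covering lemma requires; for an infinite integral the right-hand side is
  infinite.\<close>

lemma weak_type_maximal: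
  fixes F :: "real ^ 'n \<Rightarrow> ennreal"
  assumes t: "0 < t" and F: "F \<in> borel_measurable lebesgue"
  shows "emeasure lebesgue {x. ennreal t < maximal F x} 
    \<le> ennreal ((10 * real CARD('n)) ^ CARD('n) / t) * (\<integral>\<^sup>+ x. F x \<partial>lebesgue)"
proof (cases "(\<integral>\<^sup>+ x. F x \<partial>lebesgue) = top")
  case True
  moreover have "0 < (10 * real CARD('n)) ^ CARD('n) / t" using t by simp
  ultimately show ?thesis by (simp only: ennreal_mult_top ennreal_eq_0_iff not_le if_False not_less[symmetric] top_greatest)
    (simp add: not_less)
next
  case False
  then obtain J where J: "(\<integral>\<^sup>+ x. F x \<partial>lebesgue) = ennreal J" "0 \<le> J"
    by (metis ennreal_enn2real enn2real_nonneg top.not_eq_extremum)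
  let ?P = "\<lambda>m h. ennreal t < avg (qcube m h) F"
  have P: "ennreal t * emeasure lebesgue (qcube m h) \<le> (\<integral>\<^sup>+ x. F x \<partial>lebesgue_on (qcube m h))"
    if "0 < h" "?P m h" for m h
    using that by (simp add: less_avg_cube_iff less_imp_le del: emeasure_completion)
  \<comment> \<open>From \<open>t * (2 * h) ^ n \<le> J\<close>; for \<open>h > 1\<close> the power
    dominates \<open>2 * h\<close>, so \<open>h \<le> J / t\<close>.\<close>
  have bound: "h \<le> max 1 (J / t)" if h: "0 < h" "?P m h" for m h
  proof (cases "h \<le> 1")
    case False
    have "ennreal (t * (2 * h) ^ CARD('n)) \<le> (\<integral>\<^sup>+ x. F x \<partial>lebesgue_on (qcube m h))"
      using P[OF h] h t by (simp add: emeasure_qcube ennreal_mult del: emeasure_completion)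
    also have "\<dots> \<le> (\<integral>\<^sup>+ x. F x \<partial>lebesgue)"
      by (auto simp: nn_integral_lebesgue_on indicator_def intro!: nn_integral_mono)
    finally have "t * (2 * h) ^ CARD('n) \<le> J" using J by simp
    moreover have "(2 * h) ^ 1 \<le> (2 * h) ^ CARD('n)" using False 
      by (intro power_increasing) (auto simp: Suc_le_eq)
    then have "t * (2 * h) ^ 1 \<le> t * (2 * h) ^ CARD('n)" using t by (intro mult_left_mono) auto
    ultimately have "t * (2 * h) \<le> J" by simp
    then have "2 * h \<le> J / t" using t by (simp add: field_simps)
    then show ?thesis using h by simp
  qed simp
  have UNIV: "lebesgue_on UNIV = (lebesgue :: (real ^ 'n) measure)" by (rule lebesgue_on_UNIV_eq)
  have "\<exists>T\<in>sets lebesgue. (\<forall>m h. 0 < h \<longrightarrow> ?P m h \<longrightarrow> qcube m h \<subseteq> T) \<and> 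
    emeasure lebesgue T \<le> ennreal ((10 * real CARD('n)) ^ CARD('n) / t) * (\<integral>\<^sup>+ x. F x \<partial>lebesgue_on UNIV)"
    using t F P bound by (intro weak_type_cubes[where B = "max 1 (J / t)"]) (simp_all add: UNIV del: emeasure_completion)
  then obtain T where T: "T \<in> sets lebesgue" "\<And>m h. 0 < h \<Longrightarrow> ?P m h \<Longrightarrow> qcube m h \<subseteq> T"
    "emeasure lebesgue T \<le> ennreal ((10 * real CARD('n)) ^ CARD('n) / t) * (\<integral>\<^sup>+ x. F x \<partial>lebesgue)"
    by (auto simp: UNIV)
  have "{x. ennreal t < maximal F x} \<subseteq> T"
    using T(2) by (auto elim!: less_maximalE)
  with T(1) have "emeasure lebesgue {x. ennreal t < maximal F x} \<le> emeasure lebesgue T"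
    by (intro emeasure_mono) auto
  also note T(3)
  finally show ?thesis .
qed


section \<open>Powers of extended non-negative reals\<close>

lemma epowr_ennreal: "0 \<le> x \<Longrightarrow> ennreal x epowr r = ennreal (x powr r)"
  by (simp add: ennreal_powr_def)

lemma top_epowr [simp]: "top epowr r = top"
  by (simp add: ennreal_powr_def)

lemma zero_epowr [simp]: "0 epowr r = 0"
  by (simp add: ennreal_powr_def)

lemma epowr_one [simp]: "x epowr 1 = x"
  by (cases x) (simp_all add: epowr_ennreal)

lemma epowr_mono: "0 \<le> r \<Longrightarrow> x \<le> y \<Longrightarrow> x epowr r \<le> y epowr r"
  by (cases x; cases y) (auto simp: epowr_ennreal powr_mono2 top_unique intro!: ennreal_leI)

lemma epowr_epowr: "(x epowr r) epowr s = x epowr (r * s)"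
  by (cases x) (simp_all add: epowr_ennreal powr_powr)

lemma epowr_mult: "0 < r \<Longrightarrow> (x * y) epowr r = x epowr r * y epowr r"
proof (cases x; cases y)
  fix u v assume "x = ennreal u" "0 \<le> u" "y = ennreal v" "0 \<le> v"
  then show "(x * y) epowr r = x epowr r * y epowr r"
    by (simp add: epowr_ennreal ennreal_mult[symmetric] powr_mult)
qed (auto simp: epowr_ennreal ennreal_top_mult ennreal_mult_top ennreal_eq_0_iff)

lemma epowr_le_iff: "0 < r \<Longrightarrow> x epowr r \<le> y epowr r \<longleftrightarrow> x \<le> y"
  using epowr_mono[of r x y] epowr_mono[of "1 / r" "x epowr r" "y epowr r"] by (auto simp: epowr_epowr)

lemma epowr_inverse_le_iff: "0 < r \<Longrightarrow> x epowr (1 / r) \<le> y \<longleftrightarrow> x \<le> y epowr r"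
  using epowr_le_iff[of r "x epowr (1 / r)" y] by (simp add: epowr_epowr)

lemma borel_measurable_epowr [measurable]:
  assumes [measurable]: "f \<in> borel_measurable M"
  shows "(\<lambda>x. f x epowr r) \<in> borel_measurable M"
  unfolding ennreal_powr_def by measurable

text \<open>Where \<open>y\<close> exceeds \<open>\<tau>\<close>, the factor
  \<open>(y / \<tau>) powr (t - 1)\<close> is at least 1. Applied both to the function
  \<open>HQ\<close> and to reverse Hoelder weights.\<close>

lemma ennreal_le_add_epowr:
  fixes y :: ennreal
  assumes "0 < \<tau>" "1 < t"
  shows "y \<le> ennreal \<tau> + ennreal (\<tau> powr (1 - t)) * y epowr t"
proof (cases y)
  case (real u)
  show ?thesis
  proof (cases "u \<le> \<tau>")
    case True
    then show ?thesis using real by (auto intro: order_trans[OF ennreal_leI[OF True]])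
  next
    case False
    have "u = \<tau> powr (1 - t) * (u powr 1 * \<tau> powr (t - 1))"
      using assms False by (simp add: powr_diff)
    also have "\<dots> \<le> \<tau> powr (1 - t) * (u powr 1 * u powr (t - 1))"
      using assms False by (intro mult_left_mono powr_mono2) auto
    also have "\<dots> = \<tau> powr (1 - t) * u powr t" by (subst powr_add[symmetric]) simp
    finally have "y \<le> ennreal (\<tau> powr (1 - t)) * y epowr t"
      using real by (simp add: epowr_ennreal ennreal_mult[symmetric] ennreal_leI)
    then show ?thesis by (rule order_trans) simp
  qed
next
  case top
  then show ?thesis using assms by (simp add: ennreal_mult_top)
qed

text \<open>Two points of the cube enter: \<open>x\<close>, where the maximal functions are at most
  \<open>lam\<close>, and \<open>y\<close>, where \<open>G + H2\<close> is small. The decomposition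
  allows different points for the two kinds of terms and so bounds the average of \<open>HQ\<close>
  by \<open>2 * a * lam\<close>. Measured against \<tau> = K lam / 2 this is
  \<open>4 * a / K\<close>, the source of \<open>4 powr enn2real q\<close>.\<close>

lemma cube_estimate:
  fixes F :: "real ^ 'n \<Rightarrow> ennreal"
  assumes dec: "cube_decomposition q a F G H1 H2" and a: "1 \<le> a" and q: "1 < q"
    and lam: "0 < lam" and \<gamma>: "0 < \<gamma>" "\<gamma> < 1" and K: "4 * a \<le> K" and \<rho>: "0 < \<rho>"
    and x: "x \<in> qcube z \<rho>" "maximal F x + maximal H1 x \<le> ennreal lam"
    and y: "y \<in> qcube z \<rho>" "G y + H2 y \<le> ennreal (\<gamma> * lam)"
  shows "\<exists>T\<in>sets lebesgue. 
    (\<forall>m h. 0 < h \<longrightarrow> qcube m h \<subseteq> qcube z \<rho> \<longrightarrow> ennreal (K * lam) < avg (qcube m h) F \<longrightarrow> qcube m h \<subseteq> T) \<and> 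
    emeasure lebesgue T \<le> ennreal ((10 * real CARD('n)) ^ CARD('n) * (2 * 4 powr enn2real q) * (ratio_pow q a K + \<gamma> / K))
      * emeasure lebesgue (qcube z \<rho>)"
proof -
  let ?Q = "qcube z \<rho>" and ?c = "(10 * real CARD('n)) ^ CARD('n)"
  \<comment> \<open>For infinite \<open>q\<close> this is 0, so that \<open>4 powr t = 1\<close> and
    the same constant serves both cases.\<close>
  define t where "t = enn2real q"
  \<comment> \<open>Half of the level \<open>K * lam\<close>; the other half has to come from the
    majorant \<open>\<Phi>\<close>.\<close>
  define \<tau> where "\<tau> = K * lam / 2"
  have K0: "0 < K" "0 < a" using K a by auto
  have \<tau>: "0 < \<tau>" using K0 lam by (simp add: \<tau>_def)
  have Q: "?Q \<in> cubes" using \<rho> by simp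
  from bspec[OF dec[unfolded cube_decomposition_def] Q]
  obtain GQ HQ where GH [measurable]: "GQ \<in> borel_measurable (lebesgue_on ?Q)" "HQ \<in> borel_measurable (lebesgue_on ?Q)"
    and FGH: "AE x in lebesgue_on ?Q. F x \<le> GQ x + HQ x"
    and H: "\<forall>x\<in>?Q. \<forall>x'\<in>?Q. avg_Lq q ?Q HQ \<le> ennreal a * (maximal F x + maximal H1 x + H2 x')"
    and GG: "\<forall>x\<in>?Q. avg ?Q GQ \<le> G x"
    by (elim exE conjE)
  have "avg ?Q GQ \<le> ennreal (\<gamma> * lam)"
    using bspec[OF GG y(1)] y(2) by (meson add_increasing2 order_trans zero_le)
  then have intG: "(\<integral>\<^sup>+ x. GQ x \<partial>lebesgue_on ?Q) \<le> ennreal (\<gamma> * lam) * emeasure lebesgue ?Q"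
    unfolding avg_cube_le_iff[OF Q] .
  have "avg_Lq q ?Q HQ \<le> ennreal a * (maximal F x + maximal H1 x + H2 y)"
    using bspec[OF bspec[OF H x(1)] y(1)] .
  also have "\<dots> \<le> ennreal a * (ennreal lam + ennreal (\<gamma> * lam))"
    using x(2) y(2) by (intro mult_left_mono add_mono) (auto intro: order_trans[rotated])
  also have "\<dots> \<le> ennreal (2 * a * lam)"
    using a lam \<gamma> by (auto simp: ennreal_mult[symmetric] ennreal_plus[symmetric] simp del: ennreal_plus intro!: ennreal_leI)
  finally have avgH: "avg_Lq q ?Q HQ \<le> ennreal (2 * a * lam)" .
  have one: "1 \<le> 4 powr t" "0 \<le> ratio_pow q a K" using q 
    by (auto simp: t_def ratio_pow_def intro!: ge_one_powr_ge_zero)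
  \<comment> \<open>Common end of the finite and the infinite case: it remains to find a majorant
    with a small integral.\<close>
  have *: "?thesis" 
    if \<Phi>: "\<Phi> \<in> borel_measurable (lebesgue_on ?Q)" "AE x in lebesgue_on ?Q. F x \<le> ennreal \<tau> + \<Phi> x"
    and int: "(\<integral>\<^sup>+ x. \<Phi> x \<partial>lebesgue_on ?Q) \<le> ennreal (\<tau> * (2 * 4 powr t) * (ratio_pow q a K + \<gamma> / K)) * emeasure lebesgue ?Q"
  for \<Phi>
  proof -
    from weak_type_above[OF \<tau> \<Phi>] obtain T where T: "T \<in> sets lebesgue" 
      "\<forall>m h. 0 < h \<longrightarrow> qcube m h \<subseteq> ?Q \<longrightarrow> ennreal (2 * \<tau>) < avg (qcube m h) F \<longrightarrow> qcube m h \<subseteq> T"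
      "emeasure lebesgue T \<le> ennreal (?c / \<tau>) * (\<integral>\<^sup>+ x. \<Phi> x \<partial>lebesgue_on ?Q)" by blast
    note T(3)
    also have "ennreal (?c / \<tau>) * (\<integral>\<^sup>+ x. \<Phi> x \<partial>lebesgue_on ?Q) \<le> 
       ennreal (?c / \<tau>) * (ennreal (\<tau> * (2 * 4 powr t) * (ratio_pow q a K + \<gamma> / K)) * emeasure lebesgue ?Q)"
      by (intro mult_left_mono int) simp
    also have "\<dots> = ennreal (?c / \<tau> * (\<tau> * (2 * 4 powr t) * (ratio_pow q a K + \<gamma> / K))) * emeasure lebesgue ?Q"
      using \<tau> one \<gamma> K0 by (subst ennreal_mult) (auto simp only: mult.assoc, auto intro!: mult_nonneg_nonneg)
    also have "?c / \<tau> * (\<tau> * (2 * 4 powr t) * (ratio_pow q a K + \<gamma> / K)) = ?c * (2 * 4 powr t) * (ratio_pow q a K + \<gamma> / K)"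
      using \<tau> by simp
    finally show ?thesis using T(1,2) unfolding t_def \<tau>_def by (intro bexI[of _ T]) auto
  qed
  show ?thesis
  proof (cases "q = top")
    case True
    \<comment> \<open>Here \<open>4 * a \<le> K\<close> is used: \<open>HQ\<close> stays below
      \<open>\<tau>\<close> almost everywhere, and \<open>GQ\<close> alone is the majorant.\<close>
    have "AE x in lebesgue_on ?Q. HQ x \<le> esssup (lebesgue_on ?Q) HQ" by (rule esssup_AE)
    then have "AE x in lebesgue_on ?Q. HQ x \<le> ennreal \<tau>"
    proof eventually_elim
      case (elim x)
      also have "esssup (lebesgue_on ?Q) HQ \<le> ennreal (2 * a * lam)" using avgH True by (simp add: avg_Lq_def)
      also have "\<dots> \<le> ennreal \<tau>" using K lam by (intro ennreal_leI) (simp add: \<tau>_def)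
      finally show ?case .
    qed
    with FGH have "AE x in lebesgue_on ?Q. F x \<le> ennreal \<tau> + GQ x"
      by eventually_elim (metis add.commute add_left_mono order_trans)
    moreover have "\<gamma> * lam \<le> \<tau> * (2 * 4 powr t) * (ratio_pow q a K + \<gamma> / K)"
      using True lam \<gamma> K0 by (simp add: \<tau>_def t_def ratio_pow_def)
    then have "(\<integral>\<^sup>+ x. GQ x \<partial>lebesgue_on ?Q) \<le> ennreal (\<tau> * (2 * 4 powr t) * (ratio_pow q a K + \<gamma> / K)) * emeasure lebesgue ?Q"
      using intG by (meson ennreal_leI mult_right_mono order_trans zero_le)
    ultimately show ?thesis by (intro *) auto
  next
    case False
    have qt: "q = ennreal t" using False by (simp add: t_def less_top)
    have t: "1 < t" using q unfolding qt by (simp add: ennreal_1[symmetric] ennreal_less_iff del: ennreal_1)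
    define \<Phi> where "\<Phi> x = GQ x + ennreal (\<tau> powr (1 - t)) * HQ x epowr t" for x
    have \<Phi>m: "\<Phi> \<in> borel_measurable (lebesgue_on ?Q)" unfolding \<Phi>_def by measurable
    from FGH have F\<Phi>: "AE x in lebesgue_on ?Q. F x \<le> ennreal \<tau> + \<Phi> x"
    proof eventually_elim
      case (elim x)
      also have "GQ x + HQ x \<le> GQ x + (ennreal \<tau> + ennreal (\<tau> powr (1 - t)) * HQ x epowr t)"
        using ennreal_le_add_epowr[OF \<tau> t] by (intro add_left_mono)
      finally show ?case by (simp add: \<Phi>_def add_ac)
    qed
    have "avg ?Q (\<lambda>x. HQ x epowr t) epowr (1 / t) \<le> ennreal (2 * a * lam)"
      using avgH False by (simp add: avg_Lq_def t_def)
    then have "avg ?Q (\<lambda>x. HQ x epowr t) \<le> ennreal ((2 * a * lam) powr t)"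
      using t a lam by (simp add: epowr_inverse_le_iff epowr_ennreal)
    then have intH: "(\<integral>\<^sup>+ x. HQ x epowr t \<partial>lebesgue_on ?Q) \<le> ennreal ((2 * a * lam) powr t) * emeasure lebesgue ?Q"
      unfolding avg_cube_le_iff[OF Q] .
    have "(\<integral>\<^sup>+ x. \<Phi> x \<partial>lebesgue_on ?Q) = 
        (\<integral>\<^sup>+ x. GQ x \<partial>lebesgue_on ?Q) + ennreal (\<tau> powr (1 - t)) * (\<integral>\<^sup>+ x. HQ x epowr t \<partial>lebesgue_on ?Q)"
      unfolding \<Phi>_def by (subst nn_integral_add) (auto simp: nn_integral_cmult)
    also have "\<dots> \<le> ennreal (\<gamma> * lam) * emeasure lebesgue ?Q 
        + ennreal (\<tau> powr (1 - t)) * (ennreal ((2 * a * lam) powr t) * emeasure lebesgue ?Q)"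
      by (intro add_mono mult_left_mono intG intH) auto
    also have "\<dots> = ennreal (\<gamma> * lam + \<tau> powr (1 - t) * (2 * a * lam) powr t) * emeasure lebesgue ?Q"
      using \<gamma> lam a by (simp add: ennreal_plus ennreal_mult distrib_right mult.assoc)
    also have "\<dots> \<le> ennreal (\<tau> * (2 * 4 powr t) * (ratio_pow q a K + \<gamma> / K)) * emeasure lebesgue ?Q"
    proof (intro mult_right_mono ennreal_leI)
      have "\<tau> powr (1 - t) * (2 * a * lam) powr t = \<tau> * ((2 * a * lam) / \<tau>) powr t"
        using \<tau> a lam by (simp add: powr_diff powr_divide)
      also have "(2 * a * lam) / \<tau> = 4 * (a / K)" using lam K0 by (simp add: \<tau>_def field_simps)
      also have "(4 * (a / K)) powr t = 4 powr t * ratio_pow q a K"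
        using False K0 by (simp add: ratio_pow_def t_def powr_mult powr_divide)
      finally have "\<tau> powr (1 - t) * (2 * a * lam) powr t = \<tau> * (1 * 4 powr t) * ratio_pow q a K" by simp
      also have "\<dots> \<le> \<tau> * (2 * 4 powr t) * ratio_pow q a K"
        using \<tau> one by (intro mult_right_mono mult_left_mono) auto
      finally have 1: "\<tau> powr (1 - t) * (2 * a * lam) powr t \<le> \<tau> * (2 * 4 powr t) * ratio_pow q a K" .
      have "\<gamma> * lam = \<tau> * (2 * 1) * (\<gamma> / K)" using K0 by (simp add: \<tau>_def)
      also have "\<dots> \<le> \<tau> * (2 * 4 powr t) * (\<gamma> / K)"
        using \<tau> one \<gamma> K0 by (intro mult_right_mono mult_left_mono) auto
      finally show "\<gamma> * lam + \<tau> powr (1 - t) * (2 * a * lam) powr t \<le> \<tau> * (2 * 4 powr t) * (ratio_pow q a K + \<gamma> / K)"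
        using 1 by (simp add: distrib_left)
    qed simp
    finally show ?thesis by (intro *[OF \<Phi>m F\<Phi>])
  qed
qed


section \<open>The good-\<open>\<lambda>\<close> inequality\<close>

text \<open>A quantitative \<open>A\<^sub>\<infinity>\<close> condition, in which \<open>1 / s\<close> is the exponent that a weight in
  \<open>RH\<^sub>s\<^sub>'\<close> satisfies.\<close>

definition ainf :: "(real ^ 'n) measure \<Rightarrow> real \<Rightarrow> real \<Rightarrow> bool" where
  "ainf \<mu> C s \<longleftrightarrow> sets \<mu> = sets lebesgue \<and> 0 < C \<and> 0 < s \<and>
    (\<forall>z r. emeasure \<mu> (ball z r) < top) \<and>
    (\<forall>z r E \<epsilon>. 0 < r \<longrightarrow> 0 < \<epsilon> \<longrightarrow> E \<in> sets lebesgue \<longrightarrow> E \<subseteq> ball z r \<longrightarrow> 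
      emeasure lebesgue E \<le> ennreal \<epsilon> * emeasure lebesgue (ball z r) \<longrightarrow>
      emeasure \<mu> E \<le> ennreal (C * \<epsilon> powr (1 / s)) * emeasure \<mu> (ball z r))"

lemma ainfD:
  assumes "ainf \<mu> C s" "0 < r" "0 < \<epsilon>" "E \<in> sets lebesgue" "E \<subseteq> ball z r"
    "emeasure lebesgue E \<le> ennreal \<epsilon> * emeasure lebesgue (ball z r)"
  shows "emeasure \<mu> E \<le> ennreal (C * \<epsilon> powr (1 / s)) * emeasure \<mu> (ball z r)"
  using assms unfolding ainf_def by blast

text \<open>The factor 5 is the enlargement of balls in Vitali's lemma.\<close>

definition doubling :: "(real ^ 'n) measure \<Rightarrow> real \<Rightarrow> bool" where
  "doubling \<mu> D \<longleftrightarrow> 0 < D \<and> 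
    (\<forall>z r. 0 < r \<longrightarrow> emeasure \<mu> (ball z (5 * r)) \<le> ennreal D * emeasure \<mu> (ball z r))"

text \<open>Composed of the absolute continuity constant \<open>C\<close>, the constant of
  \<open>cube_estimate\<close>, the volume ratio of \<open>qcube z (10 * r)\<close> to
  \<open>ball z (5 * r)\<close>, and the doubling constant \<open>D\<close> for passing to
  \<open>ball z r\<close>. The type argument carries the dimension.\<close>

definition good_lambda_const :: "'n itself \<Rightarrow> ennreal \<Rightarrow> real \<Rightarrow> real \<Rightarrow> real \<Rightarrow> real" where
  "good_lambda_const _ q C D s = C * ((10 * real CARD('n)) ^ CARD('n) * (2 * 4 powr enn2real q) 
     * (4 ^ CARD('n) / unit_ball_vol CARD('n))) powr (1 / s) * D"

section \<open>Localization to one Whitney ball\<close>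

lemma borel_measurable_lebesgue_maximal [measurable]: "maximal f \<in> borel_measurable lebesgue"
  by (intro measurable_completion) simp

lemma avg_qcube_dilate:
  fixes F :: "real ^ 'n \<Rightarrow> ennreal"
  assumes "0 < h"
  shows "avg (qcube m h) F \<le> 16 ^ CARD('n) * avg (qcube m (16 * h)) F"
proof -
  have "(\<integral>\<^sup>+ x. F x \<partial>lebesgue_on (qcube m h)) \<le> (\<integral>\<^sup>+ x. F x \<partial>lebesgue_on (qcube m (16 * h)))"
    using assms by (intro nn_integral_lebesgue_on_mono qcube_mono) auto
  also have "\<dots> \<le> avg (qcube m (16 * h)) F * emeasure lebesgue (qcube m (16 * h))"
    using assms avg_cube_le_iff[of "qcube m (16 * h)" F "avg (qcube m (16 * h)) F"] by simp
  also have "emeasure lebesgue (qcube m (16 * h)) = ennreal (16 ^ CARD('n)) * emeasure lebesgue (qcube m h)"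
    using assms by (simp only: emeasure_qcube less_imp_le mult_pos_pos zero_less_numeral ennreal_mult[symmetric] 
      zero_le_power zero_le_numeral mult_nonneg_nonneg power_mult_distrib[symmetric] mult.left_commute)
  also have "ennreal (16 ^ CARD('n)) = 16 ^ CARD('n)" by (simp add: ennreal_power[symmetric])
  finally show ?thesis
    unfolding avg_cube_le_iff[OF qcube_in_cubes[OF assms]] by (simp only: mult_ac)
qed

text \<open>If \<open>h \<ge> r\<close>, then \<open>y\<close> is within 10r + 5r + h \<le> 16h of
  the centre in each coordinate, so the cube dilated by 16 contains \<open>y\<close> and has average
  at most \<open>lam\<close>. The original average is then at most \<open>16 ^ n * lam\<close>,
  below the assumed level. If \<open>h < r\<close>, all coordinates stay within 7r of
  \<open>z\<close>.\<close>

lemma small_cube: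
  fixes x y z :: "real ^ 'n"
  assumes x: "x \<in> ball z (5 * r)" and y: "dist z y = 10 * r" and My: "maximal F y \<le> ennreal lam"
    and h: "0 < h" and xQ: "x \<in> qcube m h" and big: "ennreal (K * lam) < avg (qcube m h) F"
    and K: "16 ^ CARD('n) \<le> K" and lam: "0 < lam"
  shows "qcube m h \<subseteq> qcube z (10 * r)"
proof -
  have xi: "\<bar>x $ i - m $ i\<bar> \<le> h" for i using xQ by (simp add: mem_qcube)
  have xz: "\<bar>x $ i - z $ i\<bar> < 5 * r" for i
    using x component_le_norm_cart[of "x - z" i] by (simp add: dist_norm norm_minus_commute)
  have yz: "\<bar>y $ i - z $ i\<bar> \<le> 10 * r" for i
    using y component_le_norm_cart[of "y - z" i] by (simp add: dist_norm norm_minus_commute)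
  have "h < r"
  proof (rule ccontr)
    assume "\<not> h < r"
    have "\<bar>y $ i - m $ i\<bar> \<le> 16 * h" for i
      using xi[of i] xz[of i] yz[of i] \<open>\<not> h < r\<close> by linarith
    then have "y \<in> qcube m (16 * h)" by (simp add: mem_qcube)
    then have "avg (qcube m (16 * h)) F \<le> ennreal lam"
      using avg_le_maximal[of "qcube m (16 * h)" y F] h My by simp
    then have "16 ^ CARD('n) * avg (qcube m (16 * h)) F \<le> 16 ^ CARD('n) * ennreal lam"
      by (intro mult_left_mono) auto
    also have "\<dots> = ennreal (16 ^ CARD('n) * lam)" using lam by (simp add: ennreal_mult ennreal_power[symmetric])
    also have "\<dots> \<le> ennreal (K * lam)" using K lam by (intro ennreal_leI) simp
    also note big
    also note avg_qcube_dilate[OF h]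
    finally show False by simp
  qed
  have "\<bar>m $ i - z $ i\<bar> + h \<le> 10 * r" for i
    using xi[of i] xz[of i] \<open>h < r\<close> by linarith
  then show ?thesis by (rule qcube_mono)
qed

text \<open>The nearest point \<open>y\<close> outside the level set and any point \<open>y'\<close>
  of the exceptional set are the two witnesses for \<open>cube_estimate\<close> on
  \<open>qcube z (10 * r)\<close>. Without a \<open>y'\<close> there is nothing to estimate.
  Absolute continuity turns the Lebesgue bound into a weighted one on \<open>ball z (5 * r)\<close>,
  and doubling returns to the disjoint balls.\<close>

lemma good_lambda_ball:
  fixes F :: "real ^ 'n \<Rightarrow> ennreal"
  assumes dec: "cube_decomposition q a F G H1 H2" and a: "1 \<le> a" and q: "1 < q"
    and [measurable]: "G \<in> borel_measurable lebesgue" "H2 \<in> borel_measurable lebesgue"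
    and lam: "0 < lam" and \<gamma>: "0 < \<gamma>" "\<gamma> < 1" and K: "4 * a \<le> K" "16 ^ CARD('n) \<le> K"
    and \<mu>: "ainf \<mu> C s" "doubling \<mu> D" and r: "0 < r"
    and y: "dist z y = 10 * r" "maximal F y + maximal H1 y \<le> ennreal lam"
  shows "emeasure \<mu> ({x. ennreal (K * lam) < maximal F x \<and> G x + H2 x \<le> ennreal (\<gamma> * lam)} \<inter> ball z (5 * r))
    \<le> ennreal (good_lambda_const TYPE('n) q C D s * (ratio_pow q a K + \<gamma> / K) powr (1 / s)) * emeasure \<mu> (ball z r)"
    (is "emeasure \<mu> ?X \<le> _")
proof (cases "?X = {}")
  case False
  then obtain y' where y': "y' \<in> ball z (5 * r)" "G y' + H2 y' \<le> ennreal (\<gamma> * lam)" by auto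
  have "ball z (10 * r) \<subseteq> qcube z (10 * r)" by (rule ball_subset_qcube)
  then have y'Q: "y' \<in> qcube z (10 * r)" using y' r by auto
  have yQ: "y \<in> qcube z (10 * r)"
    using y(1) component_le_norm_cart[of "y - z"] by (auto simp: mem_qcube dist_norm norm_minus_commute)
  let ?e = "(10 * real CARD('n)) ^ CARD('n) * (2 * 4 powr enn2real q) * (ratio_pow q a K + \<gamma> / K)"
  let ?v = "4 ^ CARD('n) / unit_ball_vol CARD('n)"
  have rp: "0 < ratio_pow q a K + \<gamma> / K" using \<gamma> K a by (auto simp: ratio_pow_def intro!: add_nonneg_pos)
  have pos: "0 < ?e" "0 < ?v" using rp by auto
  obtain T where T: "T \<in> sets lebesgue" "emeasure lebesgue T \<le> ennreal ?e * emeasure lebesgue (qcube z (10 * r))"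
    "\<And>m h. 0 < h \<Longrightarrow> qcube m h \<subseteq> qcube z (10 * r) \<Longrightarrow> ennreal (K * lam) < avg (qcube m h) F \<Longrightarrow> qcube m h \<subseteq> T"
    using cube_estimate[OF dec a q lam \<gamma> K(1), of "10 * r", OF _ yQ y(2) y'Q y'(2)] r by auto
  have My: "maximal F y \<le> ennreal lam" using y(2) by (meson add_increasing2 order_refl order_trans zero_le)
  have "?X \<subseteq> T"
  proof clarify
    fix x assume x: "ennreal (K * lam) < maximal F x" "x \<in> ball z (5 * r)"
    from x(1) obtain m h where mh: "0 < h" "x \<in> qcube m h" "ennreal (K * lam) < avg (qcube m h) F"
      by (rule less_maximalE)
    show "x \<in> T"
      using T(3)[OF mh(1) small_cube[OF x(2) y(1) My mh K(2) lam] mh(3)] mh(2) by blast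
  qed
  then have "emeasure lebesgue ?X \<le> emeasure lebesgue T" using T(1) by (rule emeasure_mono)
  also note T(2)
  also have "emeasure lebesgue (qcube z (10 * r)) = ennreal ?v * emeasure lebesgue (ball z (5 * r))"
  proof -
    have "(2 * (10 * r)) ^ CARD('n) = ?v * (unit_ball_vol (real CARD('n)) * (5 * r) ^ CARD('n))"
    proof -
      have v: "unit_ball_vol (real CARD('n)) \<noteq> 0" by (metis less_irrefl unit_ball_vol_pos of_nat_0_le_iff)
      have "(2 * (10 * r)) ^ CARD('n) = (4 * (5 * r)) ^ CARD('n)" by simp
      also have "\<dots> = 4 ^ CARD('n) * (5 * r) ^ CARD('n)" by (rule power_mult_distrib)
      finally have e: "(2 * (10 * r)) ^ CARD('n) = 4 ^ CARD('n) * (5 * r) ^ CARD('n)" .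
      show ?thesis unfolding e using v by simp
    qed
    then show ?thesis using r by (simp only: emeasure_qcube emeasure_ball_pow less_imp_le mult_pos_pos zero_less_numeral) 
      (subst ennreal_mult, use r in auto)
  qed
  also have "ennreal ?e * (ennreal ?v * emeasure lebesgue (ball z (5 * r))) = ennreal (?e * ?v) * emeasure lebesgue (ball z (5 * r))"
    by (subst ennreal_mult[OF less_imp_le[OF pos(1)] less_imp_le[OF pos(2)]]) (rule mult.assoc[symmetric])
  finally have le: "emeasure lebesgue ?X \<le> ennreal (?e * ?v) * emeasure lebesgue (ball z (5 * r))" .
  have "{x \<in> space lebesgue. ennreal (K * lam) < maximal F x \<and> G x + H2 x \<le> ennreal (\<gamma> * lam)} \<in> sets lebesgue"
    by measurable
  then have "{x. ennreal (K * lam) < maximal F x \<and> G x + H2 x \<le> ennreal (\<gamma> * lam)} \<in> sets lebesgue" by simp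
  then have X: "?X \<in> sets lebesgue" by (rule sets.Int) simp
  have C: "0 < C" "0 < D" "0 < s" and db: "emeasure \<mu> (ball z (5 * r)) \<le> ennreal D * emeasure \<mu> (ball z r)"
    using \<mu> r by (auto simp: ainf_def doubling_def)
  have "emeasure \<mu> ?X \<le> ennreal (C * (?e * ?v) powr (1 / s)) * emeasure \<mu> (ball z (5 * r))"
    using r by (intro ainfD[OF \<mu>(1) _ mult_pos_pos[OF pos] X _ le]) auto
  also have "\<dots> \<le> ennreal (C * (?e * ?v) powr (1 / s)) * (ennreal D * emeasure \<mu> (ball z r))"
    by (intro mult_left_mono db) simp
  also have "\<dots> = ennreal (C * (?e * ?v) powr (1 / s) * D) * emeasure \<mu> (ball z r)"
    using C by (simp add: ennreal_mult mult.assoc)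
  also have "C * (?e * ?v) powr (1 / s) * D = good_lambda_const TYPE('n) q C D s * (ratio_pow q a K + \<gamma> / K) powr (1 / s)"
    using rp by (simp add: good_lambda_const_def powr_mult powr_divide)
  finally show ?thesis .
qed simp

text \<open>A Whitney-type covering of the level set, which is why its complement has to be
  non-empty here. The disjoint balls stay inside the level set, so their masses add up to at most
  its mass.\<close>

lemma good_lambda:
  fixes F :: "real ^ 'n \<Rightarrow> ennreal"
  assumes dec: "cube_decomposition q a F G H1 H2" and a: "1 \<le> a" and q: "1 < q"
    and meas [measurable]: "G \<in> borel_measurable lebesgue" "H2 \<in> borel_measurable lebesgue"
    and lam: "0 < lam" and \<gamma>: "0 < \<gamma>" "\<gamma> < 1" and K: "4 * a \<le> K" "16 ^ CARD('n) \<le> K"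
    and \<mu>: "ainf \<mu> C s" "doubling \<mu> D"
    and ne: "{x. ennreal lam < maximal F x + maximal H1 x} \<noteq> UNIV"
  shows "emeasure \<mu> {x. ennreal (K * lam) < maximal F x \<and> G x + H2 x \<le> ennreal (\<gamma> * lam)}
    \<le> ennreal (good_lambda_const TYPE('n) q C D s * (ratio_pow q a K + \<gamma> / K) powr (1 / s)) 
      * emeasure \<mu> {x. ennreal lam < maximal F x + maximal H1 x}"
    (is "emeasure \<mu> ?X \<le> ?c * emeasure \<mu> ?E")
proof -
  have sets\<mu>: "sets \<mu> = sets lebesgue" using \<mu> by (simp add: ainf_def)
  have "{x \<in> space lebesgue. ennreal (K * lam) < maximal F x \<and> G x + H2 x \<le> ennreal (\<gamma> * lam)} \<in> sets lebesgue"
    by measurable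
  then have X: "?X \<in> sets lebesgue" by simp
  have opn: "open ?E" by (rule open_maximal_add_greater)
  then have E: "?E \<in> sets lebesgue" by simp
  from ne obtain x0 where x0: "x0 \<in> - ?E" by auto
  have cl: "closed (- ?E)" by (rule closed_Compl[OF opn])
  have one: "1 \<le> K" using a K by simp
  have XE: "?X \<subseteq> ?E"
  proof clarify
    fix x assume "ennreal (K * lam) < maximal F x"
    moreover have "ennreal lam \<le> ennreal (K * lam)" using one lam by (intro ennreal_leI) simp
    ultimately have "ennreal lam < maximal F x" by simp
    also have "\<dots> \<le> maximal F x + maximal H1 x" by simp
    finally show "ennreal lam < maximal F x + maximal H1 x" .
  qed
  \<comment> \<open>With a tenth of the distance, \<open>10 * \<rho> x\<close> reaches exactly the
    complement, as \<open>good_lambda_ball\<close> asks.\<close>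
  define \<rho> where "\<rho> x = infdist x (- ?E) / 10" for x
  have \<rho>pos: "0 < \<rho> x" if "x \<in> ?E" for x
    using that cl x0 in_closed_iff_infdist_zero[of "- ?E" x] infdist_nonneg[of x "- ?E"] unfolding \<rho>_def by force
  \<comment> \<open>Restriction to a bounded part keeps the radii bounded for Vitali's lemma;
    \<open>R\<close> tends to infinity at the end.\<close>
  have le: "emeasure \<mu> (?X \<inter> ball 0 (real R)) \<le> ?c * emeasure \<mu> ?E" for R :: nat
  proof -
    let ?S = "?X \<inter> ball 0 (real R)"
    have bd: "0 < \<rho> x \<and> \<rho> x \<le> real R + norm x0" if "x \<in> ?S" for x
    proof -
      have "infdist x (- ?E) \<le> dist x x0" using x0 by (rule infdist_le)
      also have "\<dots> \<le> norm x + norm x0" by (simp add: dist_norm norm_triangle_ineq4)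
      also have "\<dots> \<le> real R + norm x0" using that by simp
      finally have "infdist x (- ?E) \<le> real R + norm x0" .
      moreover have "0 \<le> norm x0" by simp
      moreover have "0 < \<rho> x" using that XE \<rho>pos by blast
      ultimately show ?thesis by (simp add: \<rho>_def)
    qed
    have sub: "?S \<subseteq> (\<Union>x\<in>?S. ball x (\<rho> x))" using bd by fastforce
    obtain J where J: "countable J" "J \<subseteq> ?S"
      "pairwise (\<lambda>i j. disjnt (ball i (\<rho> i)) (ball j (\<rho> j))) J"
      "?S \<subseteq> (\<Union>i\<in>J. ball i (5 * \<rho> i))"
      by (rule Vitali_covering_lemma_balls[where a = "\<lambda>x. x" and r = \<rho> and K = ?S and B = "real R + norm x0", OF sub bd])
    have disj: "disjoint_family_on (\<lambda>i. ball i (\<rho> i)) J"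
      using J(3) by (simp add: disjoint_family_on_def pairwise_def disjnt_def)
    have "emeasure \<mu> ?S \<le> emeasure \<mu> (\<Union>i\<in>J. ?X \<inter> ball i (5 * \<rho> i))"
    proof (rule emeasure_mono)
      show "?S \<subseteq> (\<Union>i\<in>J. ?X \<inter> ball i (5 * \<rho> i))" using J(4) by blast
      show "(\<Union>i\<in>J. ?X \<inter> ball i (5 * \<rho> i)) \<in> sets \<mu>"
        unfolding sets\<mu> by (intro sets.countable_UN'[OF J(1)] image_subsetI sets.Int X) simp
    qed
    also have "\<dots> \<le> ?c * emeasure \<mu> ?E"
    proof (rule emeasure_UN_le_disjoint[OF J(1) disj])
      fix i assume "i \<in> J"
      then have iE: "i \<in> ?E" using J(2) XE by blast
      show "ball i (\<rho> i) \<subseteq> ?E"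
      proof
        fix y assume y: "y \<in> ball i (\<rho> i)"
        show "y \<in> ?E"
        proof (rule ccontr)
          assume "y \<notin> ?E"
          then have "infdist i (- ?E) \<le> dist i y" by (intro infdist_le) simp
          then show False using y \<rho>pos[OF iE] by (simp add: \<rho>_def)
        qed
      qed
      \<comment> \<open>The complement is closed, so the distance is attained.\<close>
      obtain y where y: "y \<in> - ?E" "infdist i (- ?E) = dist i y"
        using infdist_attains_inf[OF cl, of i] x0 by blast
      show "emeasure \<mu> (?X \<inter> ball i (5 * \<rho> i)) \<le> ?c * emeasure \<mu> (ball i (\<rho> i))"
        using y by (intro good_lambda_ball[OF dec a q meas lam \<gamma> K \<mu> \<rho>pos[OF iE], where z = i and y = y]) (auto simp: \<rho>_def not_less)
      show "?X \<inter> ball i (5 * \<rho> i) \<in> sets \<mu>" unfolding sets\<mu> by (intro sets.Int X) simp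
    qed (use E sets\<mu> in simp_all)
    finally show ?thesis .
  qed
  have "(SUP R::nat. emeasure \<mu> (?X \<inter> ball 0 (real R))) = emeasure \<mu> (\<Union>R::nat. ?X \<inter> ball 0 (real R))"
  proof (rule SUP_emeasure_incseq)
    show "range (\<lambda>R. ?X \<inter> ball 0 (real R)) \<subseteq> sets \<mu>"
      unfolding sets\<mu> by (intro image_subsetI sets.Int X) simp
    show "incseq (\<lambda>R. ?X \<inter> ball 0 (real R))"
      unfolding incseq_def by (intro allI impI Int_mono order_refl subset_ball) simp
  qed
  also have "(\<Union>R::nat. ball 0 (real R)) = (UNIV :: (real ^ 'n) set)"
    using reals_Archimedean2 by auto
  then have "(\<Union>R::nat. ?X \<inter> ball 0 (real R)) = ?X"
    unfolding Int_UN_distrib[symmetric] by simp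
  finally have e: "(SUP R::nat. emeasure \<mu> (?X \<inter> ball 0 (real R))) = emeasure \<mu> ?X" .
  show ?thesis unfolding e[symmetric] by (intro SUP_least le)
qed


section \<open>Reverse Hoelder weights\<close>

lemma ainfI:
  assumes "sets \<mu> = sets lebesgue" "0 < C" "0 < s" "\<And>z r. emeasure \<mu> (ball z r) < top"
    "\<And>z r E \<epsilon>. 0 < r \<Longrightarrow> 0 < \<epsilon> \<Longrightarrow> E \<in> sets lebesgue \<Longrightarrow> E \<subseteq> ball z r \<Longrightarrow>
      emeasure lebesgue E \<le> ennreal \<epsilon> * emeasure lebesgue (ball z r) \<Longrightarrow>
      emeasure \<mu> E \<le> ennreal (C * \<epsilon> powr (1 / s)) * emeasure \<mu> (ball z r)"
  shows "ainf \<mu> C s"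
  unfolding ainf_def by (intro conjI allI impI assms)

lemma sets_wmeasure [simp]: "sets (wmeasure w) = sets lebesgue"
  by (simp add: wmeasure_def)

lemma emeasure_wmeasure:
  "w \<in> borel_measurable lebesgue \<Longrightarrow> E \<in> sets lebesgue \<Longrightarrow> 
    emeasure (wmeasure w) E = (\<integral>\<^sup>+ x. ennreal (w x) * indicator E x \<partial>lebesgue)"
  by (simp add: wmeasure_def emeasure_density)

lemma emeasure_wmeasure_mono:
  assumes "v \<in> borel_measurable lebesgue" "w \<in> borel_measurable lebesgue" "\<And>x. v x \<le> w x" 
  shows "emeasure (wmeasure v) E \<le> emeasure (wmeasure w) E"
proof (cases "E \<in> sets lebesgue")
  case True
  then show ?thesis using assms 
    by (simp add: emeasure_wmeasure) (intro nn_integral_mono mult_right_mono ennreal_leI; simp)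
qed (simp add: emeasure_notin_sets)

lemma weight_finite_ball:
  assumes "weight w"
  shows "emeasure (wmeasure w) (ball z r) < top"
proof -
  have w: "w \<in> borel_measurable lebesgue" "\<And>x. 0 \<le> w x" using assms by (auto simp: weight_def)
  have "w absolutely_integrable_on cball z r" using assms by (auto simp: weight_def)
  then have "integrable lebesgue (\<lambda>x. indicator (cball z r) x *\<^sub>R w x)" by (simp add: set_integrable_def)
  then have "(\<integral>\<^sup>+ x. ennreal (norm (indicator (cball z r) x *\<^sub>R w x)) \<partial>lebesgue) < top"
    by (simp add: integrable_iff_bounded)
  also have "(\<lambda>x. ennreal (norm (indicator (cball z r) x *\<^sub>R w x))) = (\<lambda>x. ennreal (w x) * indicator (cball z r) x)"
    using w(2) by (auto simp: indicator_def)
  also have "(\<integral>\<^sup>+ x. ennreal (w x) * indicator (cball z r) x \<partial>lebesgue) = emeasure (wmeasure w) (cball z r)"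
    using w by (subst emeasure_wmeasure) auto
  finally have "emeasure (wmeasure w) (cball z r) < top" .
  moreover have "emeasure (wmeasure w) (ball z r) \<le> emeasure (wmeasure w) (cball z r)"
    by (intro emeasure_mono) auto
  ultimately show ?thesis by (rule le_less_trans[rotated])
qed

lemma ball_measures:
  fixes z :: "real ^ 'n"
  assumes "weight w" "0 < r"
  obtains v m where "0 < v" "emeasure lebesgue (ball z r) = ennreal v" "0 \<le> m"
    "emeasure (wmeasure w) (ball z r) = ennreal m" "avg (ball z r) (\<lambda>x. ennreal (w x)) = ennreal (m / v)"
proof -
  define v where "v = unit_ball_vol CARD('n) * r ^ CARD('n)"
  have v: "0 < v" "emeasure lebesgue (ball z r) = ennreal v"
    using assms(2) by (auto simp: v_def emeasure_ball_pow simp del: emeasure_completion)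
  obtain m where m: "0 \<le> m" "emeasure (wmeasure w) (ball z r) = ennreal m"
    using weight_finite_ball[OF assms(1)] by (metis enn2real_nonneg ennreal_enn2real)
  have "avg (ball z r) (\<lambda>x. ennreal (w x)) = ennreal m / ennreal v"
    using assms(1) by (simp add: avg_def weight_def nn_integral_lebesgue_on v(2)[symmetric] m(2)[symmetric] 
      emeasure_wmeasure del: emeasure_completion)
  also have "\<dots> = ennreal (m / v)" using v m by (simp add: divide_ennreal)
  finally show ?thesis using that v m by blast
qed

text \<open>On a ball the weight is bounded by a multiple of its average, so its mass is controlled
  linearly by Lebesgue measure.\<close>

lemma RH_infinity_imp_ainf:
  assumes w: "w \<in> RH \<infinity>"
  shows "\<exists>C. ainf (wmeasure w) C 1"
proof -
  have wt: "weight w" and wm: "w \<in> borel_measurable lebesgue" using w by (auto simp: RH_def weight_def)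
  obtain C where C: "\<And>z r. 0 < r \<Longrightarrow> AE x in lebesgue_on (ball z r).
             ennreal (w x) \<le> ennreal C * avg (ball z r) (\<lambda>y. ennreal (w y))"
    using w by (auto simp: RH_def)
  \<comment> \<open>\<open>max C 1\<close> because \<open>ainf\<close> asks for a positive constant
    and the given \<open>C\<close> may be negative or 0.\<close>
  have "emeasure (wmeasure w) E \<le> ennreal (max C 1 * \<epsilon> powr (1 / 1)) * emeasure (wmeasure w) (ball z r)"
    if r: "0 < r" and e: "0 < \<epsilon>" and E: "E \<in> sets lebesgue" "E \<subseteq> ball z r" 
      "emeasure lebesgue E \<le> ennreal \<epsilon> * emeasure lebesgue (ball z r)" for z r E \<epsilon>
  proof -
    obtain v m where vm: "0 < v" "emeasure lebesgue (ball z r) = ennreal v" "0 \<le> m"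
      "emeasure (wmeasure w) (ball z r) = ennreal m" "avg (ball z r) (\<lambda>x. ennreal (w x)) = ennreal (m / v)"
      using ball_measures[OF wt r] by blast
    have AE: "AE x in lebesgue. x \<in> ball z r \<longrightarrow> ennreal (w x) \<le> ennreal (max C 1 * (m / v))"
    proof -
      have "AE x in lebesgue. x \<in> ball z r \<longrightarrow> ennreal (w x) \<le> ennreal C * ennreal (m / v)"
        using C[OF r, of z] unfolding vm(5) by (subst (asm) AE_restrict_space_iff) auto
      then show ?thesis
      proof eventually_elim
        case (elim x)
        have "ennreal C * ennreal (m / v) \<le> ennreal (max C 1) * ennreal (m / v)"
          by (intro mult_right_mono ennreal_leI) auto
        also have "\<dots> = ennreal (max C 1 * (m / v))" using vm by (intro ennreal_mult[symmetric]) auto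
        finally show ?case using elim by (auto intro: order_trans)
      qed
    qed
    have "emeasure (wmeasure w) E = (\<integral>\<^sup>+ x. ennreal (w x) * indicator E x \<partial>lebesgue)"
      using wm E by (simp add: emeasure_wmeasure)
    also have "\<dots> \<le> (\<integral>\<^sup>+ x. ennreal (max C 1 * (m / v)) * indicator E x \<partial>lebesgue)"
      using AE by (intro nn_integral_mono_AE, eventually_elim) (use E(2) in \<open>auto simp: indicator_def\<close>)
    also have "\<dots> = ennreal (max C 1 * (m / v)) * emeasure lebesgue E"
      using E by (intro nn_integral_cmult_indicator)
    also have "\<dots> \<le> ennreal (max C 1 * (m / v)) * (ennreal \<epsilon> * ennreal v)"
      using E vm by (intro mult_left_mono) auto
    also have "\<dots> = ennreal (max C 1 * (m / v) * (\<epsilon> * v))"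
    proof -
      have "0 \<le> max C 1 * (m / v)" using vm by auto
      then show ?thesis using vm(1) e by (simp only: ennreal_mult less_imp_le mult_nonneg_nonneg)
    qed
    also have "max C 1 * (m / v) * (\<epsilon> * v) = (max C 1 * \<epsilon> powr (1 / 1)) * m" using vm e by simp
    also have "ennreal \<dots> = ennreal (max C 1 * \<epsilon> powr (1 / 1)) * emeasure (wmeasure w) (ball z r)"
      unfolding vm(4) using vm e by (intro ennreal_mult) auto
    finally show ?thesis .
  qed
  then have "ainf (wmeasure w) (max C 1) 1"
    unfolding ainf_def using weight_finite_ball[OF wt] by auto
  then show ?thesis ..
qed

text \<open>Cut the weight at a height \<open>T\<close>: the low part contributes at most
  \<open>T\<close> times the measure of \<open>E\<close>, the high part at most
  \<open>T powr (1 - t)\<close> times the integral of the t-th power over the ball, which the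
  reverse Hoelder inequality bounds.\<close>

lemma RH_imp_ainf_gt1:
  assumes s: "1 < s" and w: "w \<in> RH (ennreal (s / (s - 1)))"
  shows "\<exists>C. ainf (wmeasure w) C s"
proof -
  define t where "t = s / (s - 1)"
  have t: "1 < t" "1 - 1 / t = 1 / s" "0 < t" using s by (auto simp: t_def field_simps)
  have wt: "weight w" and wm [measurable]: "w \<in> borel_measurable lebesgue" using w by (auto simp: RH_def weight_def)
  have tt: "enn2real (ennreal (s / (s - 1))) = t" using s by (simp add: t_def)
  obtain C where C: "\<And>z r. 0 < r \<Longrightarrow> (avg (ball z r) (\<lambda>y. ennreal (w y) epowr t)) epowr (1 / t)
             \<le> ennreal C * avg (ball z r) (\<lambda>y. ennreal (w y))"
    using w unfolding RH_def tt by auto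
  \<comment> \<open>\<open>ennreal\<close> sends negative reals to 0, so this changes nothing in the
    hypothesis and gives a sign.\<close>
  define C' where "C' = max C 0"
  have C': "0 \<le> C'" "ennreal C = ennreal C'" by (auto simp: C'_def max_def ennreal_neg)
  have "emeasure (wmeasure w) E \<le> ennreal ((1 + C' powr t) * \<epsilon> powr (1 / s)) * emeasure (wmeasure w) (ball z r)"
    if r: "0 < r" and e: "0 < \<epsilon>" and E: "E \<in> sets lebesgue" "E \<subseteq> ball z r" 
      "emeasure lebesgue E \<le> ennreal \<epsilon> * emeasure lebesgue (ball z r)" for z r E \<epsilon>
  proof -
    obtain v m where vm: "0 < v" "emeasure lebesgue (ball z r) = ennreal v" "0 \<le> m"
      "emeasure (wmeasure w) (ball z r) = ennreal m" "avg (ball z r) (\<lambda>x. ennreal (w x)) = ennreal (m / v)"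
      using ball_measures[OF wt r] by blast
    show ?thesis
    proof (cases "m = 0")
      case True
      have "emeasure (wmeasure w) E \<le> emeasure (wmeasure w) (ball z r)" using E by (intro emeasure_mono) auto
      then show ?thesis using True vm by simp
    next
      case False
      define A where "A = m / v"
      have A: "0 < A" "m = A * v" using False vm by (auto simp: A_def)
      \<comment> \<open>This height balances the two parts: both become multiples of A v
        \<epsilon>^(1/s), by 1 - 1/t = 1/s.\<close>
      define T where "T = A * \<epsilon> powr (- (1 / t))"
      have T: "0 < T" using A e by (simp add: T_def)
      have "avg (ball z r) (\<lambda>y. ennreal (w y) epowr t) epowr (1 / t) \<le> ennreal (C' * A)"
        using C[OF r, of z] unfolding vm(5) C'(2) A_def[symmetric] using C'(1) A by (simp add: ennreal_mult)
      then have "avg (ball z r) (\<lambda>y. ennreal (w y) epowr t) \<le> ennreal ((C' * A) powr t)"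
        using t C' A by (simp add: epowr_inverse_le_iff epowr_ennreal)
      then have "(\<integral>\<^sup>+ x. ennreal (w x) epowr t \<partial>lebesgue_on (ball z r)) \<le> ennreal ((C' * A) powr t) * ennreal v"
        unfolding avg_def vm(2) ennreal_divide_le_iff[OF vm(1)] .
      then have int: "(\<integral>\<^sup>+ x. ennreal (w x) epowr t * indicator (ball z r) x \<partial>lebesgue) \<le> ennreal ((C' * A) powr t) * ennreal v"
        by (simp add: nn_integral_lebesgue_on)
      have "emeasure (wmeasure w) E = (\<integral>\<^sup>+ x. ennreal (w x) * indicator E x \<partial>lebesgue)"
        using wm E by (simp add: emeasure_wmeasure)
      also have "\<dots> \<le> (\<integral>\<^sup>+ x. ennreal T * indicator E x + ennreal (T powr (1 - t)) * (ennreal (w x) epowr t * indicator (ball z r) x) \<partial>lebesgue)"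
        using E(2) ennreal_le_add_epowr[OF T t(1)] by (intro nn_integral_mono) (auto simp: indicator_def)
      also have "\<dots> = ennreal T * emeasure lebesgue E + 
          ennreal (T powr (1 - t)) * (\<integral>\<^sup>+ x. ennreal (w x) epowr t * indicator (ball z r) x \<partial>lebesgue)"
      proof -
        have [measurable]: "E \<in> sets lebesgue" "ball z r \<in> sets lebesgue" using E(1) by auto
        have "(\<lambda>x. ennreal (w x) epowr t * indicator (ball z r) x) \<in> borel_measurable lebesgue" by measurable
        moreover have "(\<lambda>x. ennreal T * indicator E x :: ennreal) \<in> borel_measurable lebesgue" by measurable
        ultimately show ?thesis
          by (simp only: nn_integral_add nn_integral_cmult nn_integral_cmult_indicator[OF E(1)] borel_measurable_times_ennreal borel_measurable_const)
      qed
      also have "\<dots> \<le> ennreal T * (ennreal \<epsilon> * ennreal v) + ennreal (T powr (1 - t)) * (ennreal ((C' * A) powr t) * ennreal v)"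
        using E(3) unfolding vm(2) by (intro add_mono mult_left_mono int) auto
      also have "\<dots> = ennreal ((T * \<epsilon> + T powr (1 - t) * (C' * A) powr t) * v)"
      proof -
        have "ennreal x * (ennreal y * ennreal v) + ennreal p * (ennreal q * ennreal v) = ennreal ((x * y + p * q) * v)"
          if "0 \<le> x" "0 \<le> y" "0 \<le> p" "0 \<le> q" for x y p q
        proof -
          have "ennreal ((x * y + p * q) * v) = ennreal (x * (y * v) + p * (q * v))"
            by (simp add: distrib_right mult.assoc)
          also have "\<dots> = ennreal (x * (y * v)) + ennreal (p * (q * v))" using that vm by simp
          finally show ?thesis using that vm by (simp add: ennreal_mult)
        qed
        from this[of T \<epsilon> "T powr (1 - t)" "(C' * A) powr t"] show ?thesis using T e by simp
      qed
      also have "(T * \<epsilon> + T powr (1 - t) * (C' * A) powr t) * v = (1 + C' powr t) * \<epsilon> powr (1 / s) * m"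
      proof -
        have 1: "T * \<epsilon> = A * \<epsilon> powr (1 / s)"
        proof -
          have "\<epsilon> powr (- (1 / t)) * \<epsilon> = \<epsilon> powr (- (1 / t) + 1)" using e by (subst powr_add) simp
          then show ?thesis by (simp add: T_def t(2)[symmetric] mult.assoc)
        qed
        have "- (1 / t) * (1 - t) = 1 - 1 / t" using t by (simp add: field_simps)
        then have "T powr (1 - t) = A powr (1 - t) * \<epsilon> powr (1 / s)"
          unfolding t(2)[symmetric] T_def using e A by (simp add: powr_mult powr_powr)
        then have "T powr (1 - t) * (C' * A) powr t = C' powr t * \<epsilon> powr (1 / s) * (A powr (1 - t) * A powr t)"
          using A C' by (simp add: powr_mult)
        also have "A powr (1 - t) * A powr t = A" using A by (simp flip: powr_add)
        finally show ?thesis using 1 A(2) by (simp add: algebra_simps)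
      qed
      also have "ennreal \<dots> = ennreal ((1 + C' powr t) * \<epsilon> powr (1 / s)) * emeasure (wmeasure w) (ball z r)"
        unfolding vm(4) using vm e by (intro ennreal_mult) auto
      finally show ?thesis .
    qed
  qed
  moreover have "0 < 1 + C' powr t" by (simp add: add_pos_nonneg)
  ultimately have "ainf (wmeasure w) (1 + C' powr t) s"
    unfolding ainf_def using weight_finite_ball[OF wt] s by auto
  then show ?thesis ..
qed

lemma RH_imp_ainf:
  assumes "1 \<le> s" "w \<in> RH (conj_exponent s)"
  shows "\<exists>C. ainf (wmeasure w) C s"
  using assms RH_infinity_imp_ainf[of w] RH_imp_ainf_gt1[of s w] by (cases "s = 1") (auto simp: conj_exponent_def)


section \<open>Truncated weights\<close>

lemma emeasure_truncation_le:
  assumes "w \<in> borel_measurable lebesgue" "0 \<le> N" "E \<in> sets lebesgue"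
  shows "emeasure (wmeasure (\<lambda>x. min (w x) N)) E \<le> ennreal N * emeasure lebesgue E"
proof -
  have "emeasure (wmeasure (\<lambda>x. min (w x) N)) E = (\<integral>\<^sup>+ x. ennreal (min (w x) N) * indicator E x \<partial>lebesgue)"
    using assms by (intro emeasure_wmeasure) auto
  also have "\<dots> \<le> (\<integral>\<^sup>+ x. ennreal N * indicator E x \<partial>lebesgue)"
    by (intro nn_integral_mono mult_right_mono ennreal_leI) auto
  also have "\<dots> = ennreal N * emeasure lebesgue E"
    by (rule nn_integral_cmult_indicator[OF assms(3)])
  finally show ?thesis .
qed

text \<open>By Chebyshev the set where \<open>w\<close> exceeds L = m/(v \<epsilon>) has relative
  measure at most \<epsilon>, and \<epsilon> is chosen with C \<epsilon>^(1/s) = 1/2, so this set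
  carries at most half of the mass. On the rest, truncation at N keeps at least the fraction min(1,
  N/L) of the weight.\<close>

lemma truncation_ball_ge:
  assumes wt: "weight w" and A: "ainf (wmeasure w) C s" and r: "0 < r" and N: "0 < N"
    and v: "0 < v" "emeasure lebesgue (ball z r) = ennreal v"
    and m: "0 < m" "emeasure (wmeasure w) (ball z r) = ennreal m"
  defines "\<epsilon> \<equiv> (1 / (2 * C)) powr s"
  shows "ennreal (min 1 (N * \<epsilon> * v / m) * m / 2) \<le> emeasure (wmeasure (\<lambda>x. min (w x) N)) (ball z r)"
proof -
  have C: "0 < C" "0 < s" using A by (auto simp: ainf_def)
  have e: "0 < \<epsilon>" "C * \<epsilon> powr (1 / s) = 1 / 2" using C by (auto simp: \<epsilon>_def powr_powr)
  have wm [measurable]: "w \<in> borel_measurable lebesgue" and w0: "\<And>x. 0 \<le> w x" using wt by (auto simp: weight_def)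
  let ?L = "m / (v * \<epsilon>)" and ?B = "ball z r" and ?k = "min 1 (N * \<epsilon> * v / m)"
  have L: "0 < ?L" using m v e by simp
  define F where "F = {x \<in> space lebesgue. ?L < w x} \<inter> ?B"
  have "{x \<in> space lebesgue. ?L < w x} \<in> sets lebesgue" by measurable
  then have F: "F \<in> sets lebesgue" "F \<subseteq> ?B" by (auto simp: F_def)
  have D: "?B - F \<in> sets lebesgue" using F by auto
  have "ennreal ?L * emeasure lebesgue F = (\<integral>\<^sup>+ x. ennreal ?L * indicator F x \<partial>lebesgue)"
    by (rule nn_integral_cmult_indicator[OF F(1), symmetric])
  also have "\<dots> \<le> (\<integral>\<^sup>+ x. ennreal (w x) * indicator ?B x \<partial>lebesgue)"
    by (intro nn_integral_mono) (auto simp: F_def indicator_def intro: ennreal_leI)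
  also have "\<dots> = ennreal m" using m(2) wm by (simp add: emeasure_wmeasure)
  also have "ennreal m = ennreal ?L * (ennreal \<epsilon> * ennreal v)"
    using v e m by (simp add: ennreal_mult[symmetric])
  finally have "emeasure lebesgue F \<le> ennreal \<epsilon> * ennreal v"
    using L by (subst (asm) ennreal_mult_le_mult_iff) (auto simp del: emeasure_completion)
  then have "emeasure (wmeasure w) F \<le> ennreal (1 / 2) * ennreal m"
    using ainfD[OF A r e(1) F] unfolding v(2) m(2) e(2) by blast
  also have "\<dots> = ennreal (m / 2)" using m by (subst ennreal_mult[symmetric]) auto
  finally have Fle: "emeasure (wmeasure w) F \<le> ennreal (m / 2)" .
  have "ennreal (m / 2) + ennreal (m / 2) = emeasure (wmeasure w) ?B"
    unfolding m(2) using m(1) by (subst ennreal_plus[symmetric]) auto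
  also have "\<dots> = emeasure (wmeasure w) F + emeasure (wmeasure w) (?B - F)"
    using F D by (subst plus_emeasure) (auto intro!: arg_cong[where f = "emeasure _"])
  also have "\<dots> \<le> ennreal (m / 2) + emeasure (wmeasure w) (?B - F)" by (intro add_right_mono Fle)
  finally have half: "ennreal (m / 2) \<le> emeasure (wmeasure w) (?B - F)"
    by (simp add: ennreal_add_left_cancel_le)
  have k: "0 \<le> ?k" using N e v m by simp
  have "ennreal (?k * m / 2) = ennreal ?k * ennreal (m / 2)"
    using k m by (subst ennreal_mult[symmetric]) auto
  also have "\<dots> \<le> ennreal ?k * emeasure (wmeasure w) (?B - F)"
    by (intro mult_left_mono half) simp
  also have "\<dots> = (\<integral>\<^sup>+ x. ennreal ?k * (ennreal (w x) * indicator (?B - F) x) \<partial>lebesgue)"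
    using D wm by (subst emeasure_wmeasure) (auto simp: nn_integral_cmult)
  also have "\<dots> \<le> (\<integral>\<^sup>+ x. ennreal (min (w x) N) * indicator ?B x \<partial>lebesgue)"
  proof (rule nn_integral_mono)
    fix x
    have "ennreal ?k * ennreal (w x) \<le> ennreal (min (w x) N)" if "w x \<le> ?L"
    proof -
      have "?k * w x \<le> 1 * w x" using w0 by (intro mult_right_mono) auto
      moreover have "?k * w x \<le> (N * \<epsilon> * v / m) * ?L" using w0 that k N e v m by (intro mult_mono) auto
      moreover have "(N * \<epsilon> * v / m) * ?L = N" using m v e by simp
      ultimately have "?k * w x \<le> min (w x) N" by simp
      then show ?thesis using k w0 by (simp add: ennreal_mult[symmetric] ennreal_leI del: min_less_iff_conj)
    qed
    then show "ennreal ?k * (ennreal (w x) * indicator (?B - F) x) \<le> ennreal (min (w x) N) * indicator ?B x"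
      by (auto simp: indicator_def F_def not_less)
  qed
  also have "\<dots> = emeasure (wmeasure (\<lambda>x. min (w x) N)) ?B"
    by (intro emeasure_wmeasure[symmetric]) auto
  finally show ?thesis .
qed

text \<open>The constant of the truncated weight does not depend on \<open>N\<close>.\<close>

lemma ainf_truncation:
  assumes wt: "weight w" and A: "ainf (wmeasure w) C s" and s: "1 \<le> s"
  defines "C' \<equiv> 1 + 2 * C + 2 / (1 / (2 * C)) powr s"
  assumes N: "0 < N"
  shows "ainf (wmeasure (\<lambda>x. min (w x) N)) C' s"
proof -
  let ?\<mu> = "wmeasure w" and ?\<nu> = "wmeasure (\<lambda>x. min (w x) N)"
  define e where "e = (1 / (2 * C)) powr s"
  have C: "0 < C" using A by (auto simp: ainf_def)
  have e: "0 < e" using C by (auto simp: e_def)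
  \<comment> \<open>One summand for each case below: 1 for \<epsilon> \<ge> 1, \<open>2 * C\<close>
    when at least half of the mass is retained, \<open>2 / e\<close> when \<open>N\<close> is small
    compared with the average.\<close>
  have C': "C' = 1 + 2 * C + 2 / e" by (simp add: C'_def e_def)
  then have C'0: "0 < C'" using C e by (auto intro!: add_pos_pos)
  have wm [measurable]: "w \<in> borel_measurable lebesgue" and w0: "\<And>x. 0 \<le> w x" using wt by (auto simp: weight_def)
  have le\<mu>: "emeasure ?\<nu> E \<le> emeasure ?\<mu> E" for E
    by (intro emeasure_wmeasure_mono) auto
  have "emeasure ?\<nu> E \<le> ennreal (C' * \<epsilon> powr (1 / s)) * emeasure ?\<nu> (ball z r)"
    if r: "0 < r" and ep: "0 < \<epsilon>" and E: "E \<in> sets lebesgue" "E \<subseteq> ball z r" 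
      "emeasure lebesgue E \<le> ennreal \<epsilon> * emeasure lebesgue (ball z r)" for z r E \<epsilon>
  proof -
    have triv: "emeasure ?\<nu> E \<le> emeasure ?\<nu> (ball z r)" using E by (intro emeasure_mono) auto
    obtain v m where vm: "0 < v" "emeasure lebesgue (ball z r) = ennreal v" "0 \<le> m"
      "emeasure ?\<mu> (ball z r) = ennreal m"
      using ball_measures[OF wt r] by metis
    consider "m = 0" | "1 \<le> \<epsilon>" | "0 < m" "\<epsilon> < 1" using vm by linarith
    then show ?thesis
    proof cases
      case 1
      then have "emeasure ?\<nu> (ball z r) = 0" using le\<mu>[of "ball z r"] vm by simp
      then show ?thesis using triv by simp
    next
      case 2
      have "1 * 1 \<le> C' * \<epsilon> powr (1 / s)" using 2 s C e C' C'0 by (intro mult_mono ge_one_powr_ge_zero) auto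
      then have "ennreal 1 \<le> ennreal (C' * \<epsilon> powr (1 / s))" by (intro ennreal_leI) simp
      from mult_right_mono[OF this, of "emeasure ?\<nu> (ball z r)"] show ?thesis using triv by simp
    next
      case 3
      let ?k = "min 1 (N * e * v / m)"
      have ge: "ennreal (?k * m / 2) \<le> emeasure ?\<nu> (ball z r)"
        using truncation_ball_ge[OF wt A r N vm(1,2) 3(1) vm(4)] unfolding e_def .
      have k: "0 < ?k" using N e vm 3 by simp
      have pw: "\<epsilon> \<le> \<epsilon> powr (1 / s)"
        using powr_mono'[of "1 / s" 1 \<epsilon>] 3 ep s by simp
      have real: "emeasure ?\<nu> E \<le> ennreal (C' * \<epsilon> powr (1 / s) * (?k * m / 2))"
      \<comment> \<open>The numerator has two bounds, by the untruncated weight and by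
        \<open>N\<close> times Lebesgue measure. The case decides which one matches the lower bound
        \<open>ge\<close>; the second gives only \<open>\<epsilon>\<close>, which \<open>pw\<close>
        replaces by the larger power.\<close>
      proof (cases "1 \<le> N * e * v / m")
        case True
        have "emeasure ?\<nu> E \<le> emeasure ?\<mu> E" by (rule le\<mu>)
        also have "\<dots> \<le> ennreal (C * \<epsilon> powr (1 / s)) * ennreal m"
          using ainfD[OF A r ep E] unfolding vm(4) .
        also have "\<dots> = ennreal (2 * C * \<epsilon> powr (1 / s) * (m / 2))"
          using C vm by (simp add: ennreal_mult[symmetric])
        also have "\<dots> \<le> ennreal (C' * \<epsilon> powr (1 / s) * (m / 2))"
          using C e C' vm by (intro ennreal_leI mult_right_mono) auto
        also have "m / 2 = ?k * m / 2" using True by simp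
        finally show ?thesis .
      next
        case False
        have "emeasure ?\<nu> E \<le> ennreal N * emeasure lebesgue E"
          using N E by (intro emeasure_truncation_le) auto
        also have "\<dots> \<le> ennreal N * (ennreal \<epsilon> * ennreal v)"
          using E(3) unfolding vm(2) by (intro mult_left_mono) auto
        also have "\<dots> = ennreal (2 / e * \<epsilon> * (N * e * v / m * m / 2))"
          using N ep vm e 3 by (simp add: ennreal_mult[symmetric])
        also have "\<dots> \<le> ennreal (C' * \<epsilon> powr (1 / s) * (N * e * v / m * m / 2))"
          using C e C' vm N ep pw by (intro ennreal_leI mult_right_mono mult_mono) auto
        also have "N * e * v / m = ?k" using False by simp
        finally show ?thesis .
      qed
      also have "\<dots> = ennreal (C' * \<epsilon> powr (1 / s)) * ennreal (?k * m / 2)"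
        using C'0 k vm by (intro ennreal_mult) auto
      also have "\<dots> \<le> ennreal (C' * \<epsilon> powr (1 / s)) * emeasure ?\<nu> (ball z r)"
        by (intro mult_left_mono ge) simp
      finally show ?thesis .
    qed
  qed
  then show ?thesis
    using le_less_trans[OF le\<mu> weight_finite_ball[OF wt]] s by (intro ainfI C'0) simp_all
qed

text \<open>The shell between the two balls has relative Lebesgue measure \<delta>, chosen so small
  that it carries at most half of the mass.\<close>

lemma ainf_shrink_ball:
  assumes A: "ainf \<mu> C s" and r: "0 < r"
  defines "\<delta> \<equiv> min (1 / 2) ((1 / (2 * C)) powr s)"
  defines "\<rho> \<equiv> root CARD('n) (1 - \<delta>)"
  shows "emeasure \<mu> (ball z r) \<le> 2 * emeasure \<mu> (ball (z :: real ^ 'n) (\<rho> * r))"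
proof -
  have C: "0 < C" "0 < s" and sets\<mu>: "sets \<mu> = sets lebesgue" and fin: "emeasure \<mu> (ball z r) < top"
    using A by (auto simp: ainf_def)
  have \<delta>: "0 < \<delta>" "\<delta> \<le> 1 / 2" using C by (auto simp: \<delta>_def)
  have "\<delta> powr (1 / s) \<le> ((1 / (2 * C)) powr s) powr (1 / s)" using C \<delta> by (intro powr_mono2) (auto simp: \<delta>_def)
  also have "\<dots> = 1 / (2 * C)" using C by (simp add: powr_powr)
  finally have half: "C * \<delta> powr (1 / s) \<le> 1 / 2" using C by (simp add: field_simps)
  have \<rho>: "0 < \<rho>" "\<rho> < 1" "\<rho> ^ CARD('n) = 1 - \<delta>" using \<delta> by (auto simp: \<rho>_def real_root_pow_pos2)
  let ?B = "ball z r" and ?B' = "ball z (\<rho> * r)"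
  have sub: "?B' \<subseteq> ?B" using \<rho> r by (intro subset_ball) simp
  define v where "v = unit_ball_vol CARD('n) * r ^ CARD('n)"
  have v: "0 < v" using r by (simp add: v_def)
  have B: "emeasure lebesgue ?B = ennreal v" using r by (simp add: v_def emeasure_ball_pow del: emeasure_completion)
  have B': "emeasure lebesgue ?B' = ennreal ((1 - \<delta>) * v)" 
    using r \<rho> by (subst emeasure_ball_pow) (auto simp: v_def power_mult_distrib mult_ac)
  have D: "?B - ?B' \<in> sets lebesgue" by auto
  have "emeasure lebesgue (?B - ?B') = ennreal v - ennreal ((1 - \<delta>) * v)"
    unfolding B[symmetric] B'[symmetric] using sub B' by (intro emeasure_Diff) (auto simp del: emeasure_completion)
  also have "\<dots> = ennreal \<delta> * emeasure lebesgue ?B"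
    unfolding B using v \<delta> by (subst ennreal_minus) (auto simp: ennreal_mult[symmetric] algebra_simps)
  finally have "emeasure lebesgue (?B - ?B') \<le> ennreal \<delta> * emeasure lebesgue ?B" by simp
  then have "emeasure \<mu> (?B - ?B') \<le> ennreal (C * \<delta> powr (1 / s)) * emeasure \<mu> ?B"
    by (intro ainfD[OF A r \<delta>(1) D]) auto
  also have "\<dots> \<le> ennreal (1 / 2) * emeasure \<mu> ?B" by (intro mult_right_mono ennreal_leI half) simp
  finally have le: "emeasure \<mu> (?B - ?B') \<le> ennreal (1 / 2) * emeasure \<mu> ?B" .
  obtain m where m: "emeasure \<mu> ?B = ennreal m" "0 \<le> m"
    using fin by (metis enn2real_nonneg ennreal_enn2real)
  have "ennreal (m / 2) + ennreal (m / 2) = emeasure \<mu> ?B" using m by (subst ennreal_plus[symmetric]) auto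
  also have "\<dots> = emeasure \<mu> (?B - ?B') + emeasure \<mu> ?B'"
    using sub sets\<mu> by (subst plus_emeasure) (auto intro!: arg_cong[where f = "emeasure _"])
  also have "\<dots> \<le> ennreal (m / 2) + emeasure \<mu> ?B'"
    using le m by (intro add_right_mono order_trans[OF le]) (subst m(1), subst ennreal_mult[symmetric], auto)
  finally have "ennreal (m / 2) \<le> emeasure \<mu> ?B'" by (simp add: ennreal_add_left_cancel_le)
  then have "2 * ennreal (m / 2) \<le> 2 * emeasure \<mu> ?B'" by (intro mult_left_mono) auto
  also have "2 * ennreal (m / 2) = emeasure \<mu> ?B"
    unfolding m(1) using m(2) ennreal_mult[of 2 "m / 2"] by simp
  finally show ?thesis .
qed

text \<open>Shrink by the factor \<rho> until \<rho>^k < 1/5, losing a factor 2 each time. The order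
  of quantifiers matters: one \<open>D\<close> serves all measures with the same parameters, in
  particular all truncations of a weight.\<close>

lemma ainf_doubling:
  assumes C: "0 < C" "0 < s"
  shows "\<exists>D. \<forall>\<mu> :: (real ^ 'n) measure. ainf \<mu> C s \<longrightarrow> doubling \<mu> D"
proof -
  define \<delta> where "\<delta> = min (1 / 2) ((1 / (2 * C)) powr s)"
  define \<rho> where "\<rho> = root CARD('n) (1 - \<delta>)"
  have \<delta>: "0 < \<delta>" "\<delta> \<le> 1 / 2" using C by (auto simp: \<delta>_def)
  have \<rho>: "0 < \<rho>" "\<rho> < 1" using \<delta> by (auto simp: \<rho>_def)
  obtain k where k: "\<rho> ^ k < 1 / 5" using \<rho> real_arch_pow_inv[of "1 / 5" \<rho>] by auto
  have "doubling \<mu> (2 ^ k)" if A: "ainf \<mu> C s" for \<mu> :: "(real ^ 'n) measure"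
  proof -
    have it: "emeasure \<mu> (ball z r) \<le> 2 ^ j * emeasure \<mu> (ball z (\<rho> ^ j * r))" if r: "0 < r" for z r j
    proof (induction j)
      case (Suc j)
      have "emeasure \<mu> (ball z (\<rho> ^ j * r)) \<le> 2 * emeasure \<mu> (ball z (\<rho> * (\<rho> ^ j * r)))"
        unfolding \<rho>_def \<delta>_def using r \<rho> by (intro ainf_shrink_ball[OF A]) (simp add: \<rho>_def \<delta>_def)
      then have "2 ^ j * emeasure \<mu> (ball z (\<rho> ^ j * r)) \<le> 2 ^ j * (2 * emeasure \<mu> (ball z (\<rho> * (\<rho> ^ j * r))))"
        by (intro mult_left_mono) auto
      with Suc show ?case by (simp add: mult_ac)
    qed simp
    have "emeasure \<mu> (ball z (5 * r)) \<le> ennreal (2 ^ k) * emeasure \<mu> (ball z r)" if r: "0 < r" for z r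
    proof -
      have "emeasure \<mu> (ball z (5 * r)) \<le> 2 ^ k * emeasure \<mu> (ball z (\<rho> ^ k * (5 * r)))"
        using it[of "5 * r" z k] r by simp
      also have "\<dots> \<le> 2 ^ k * emeasure \<mu> (ball z r)"
        using k r A by (intro mult_left_mono emeasure_mono subset_ball) (auto simp: ainf_def field_simps)
      also have "(2 ^ k :: ennreal) = ennreal (2 ^ k)" by (simp add: ennreal_power[symmetric])
      finally show ?thesis .
    qed
    then show ?thesis by (simp add: doubling_def)
  qed
  then show ?thesis by blast
qed

section \<open>Infinite total mass\<close>

lemma UN_ball_nat: "(\<Union>R::nat. ball 0 (real R)) = (UNIV :: 'a :: real_normed_vector set)"
  using reals_Archimedean2 by auto

lemma ainf_finite_ball: "ainf \<mu> C s \<Longrightarrow> emeasure \<mu> (ball z r) < top"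
  by (simp add: ainf_def)

text \<open>A fixed ball of positive mass occupies an arbitrarily small fraction of a large
  concentric ball; with finite total mass, absolute continuity would make its mass arbitrarily
  small.\<close>

lemma ainf_infinite_mass:
  fixes \<mu> :: "(real ^ 'n) measure"
  assumes A: "ainf \<mu> C s" and pos: "0 < emeasure \<mu> UNIV"
  shows "emeasure \<mu> UNIV = top"
proof (rule ccontr)
  assume "emeasure \<mu> UNIV \<noteq> top"
  then obtain M where M: "emeasure \<mu> UNIV = ennreal M" "0 \<le> M"
    by (metis ennreal_enn2real enn2real_nonneg top.not_eq_extremum)
  have C: "0 < C" "0 < s" and sets\<mu>: "sets \<mu> = sets lebesgue" using A by (auto simp: ainf_def)
  have "(SUP R::nat. emeasure \<mu> (ball 0 (real R))) = emeasure \<mu> (\<Union>R::nat. ball 0 (real R))"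
  proof (rule SUP_emeasure_incseq)
    show "range (\<lambda>R. ball 0 (real R)) \<subseteq> sets \<mu>" unfolding sets\<mu> by (intro image_subsetI) simp
    show "incseq (\<lambda>R. ball (0 :: real ^ 'n) (real R))"
      unfolding incseq_def by (intro allI impI subset_ball) simp
  qed
  also have "(\<Union>R::nat. ball 0 (real R)) = (UNIV :: (real ^ 'n) set)"
    by (rule UN_ball_nat)
  finally have "0 < (SUP R::nat. emeasure \<mu> (ball 0 (real R)))" using pos by simp
  then obtain R :: nat where R: "0 < emeasure \<mu> (ball 0 (real R))"
    unfolding less_SUP_iff by blast
  have R0: "0 < real R" using R by (cases "R = 0") auto
  obtain b where b: "emeasure \<mu> (ball 0 (real R)) = ennreal b" "0 < b"
    using R ainf_finite_ball[OF A] by (metis enn2real_positive_iff ennreal_enn2real)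
  \<comment> \<open>Chosen so that C \<epsilon>^(1/s) M \<le> b/2; \<open>M + 1\<close> keeps the
    denominator positive.\<close>
  define \<epsilon> where "\<epsilon> = min 1 ((b / (2 * C * (M + 1))) powr s)"
  have e: "0 < \<epsilon>" "\<epsilon> \<le> 1" using b C M by (auto simp: \<epsilon>_def)
  have "\<epsilon> powr (1 / s) \<le> ((b / (2 * C * (M + 1))) powr s) powr (1 / s)" using C e by (intro powr_mono2) (auto simp: \<epsilon>_def)
  also have "\<dots> = b / (2 * C * (M + 1))" using C b M by (simp add: powr_powr)
  finally have ep: "C * \<epsilon> powr (1 / s) * M \<le> C * (b / (2 * C * (M + 1))) * M" using C M by (intro mult_right_mono mult_left_mono) auto
  have "C * (b / (2 * C * (M + 1))) * M = (M / (M + 1)) * (b / 2)"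
  proof -
    have "C * (b / (2 * C * c)) * M = (M / c) * (b / 2)" if "c \<noteq> 0" for c
      using C that by (simp add: field_simps)
    then show ?thesis using M by simp
  qed
  also have "\<dots> \<le> 1 * (b / 2)" using M b by (intro mult_right_mono) auto
  also have "\<dots> < b" using b by simp
  finally have less: "C * \<epsilon> powr (1 / s) * M < b" using ep by linarith
  \<comment> \<open>The volume ratio is then \<epsilon>^n, at most \<epsilon> because \<epsilon>
    \<le> 1.\<close>
  define T where "T = real R / \<epsilon>"
  have T: "0 < T" "real R \<le> T" using R0 e by (auto simp: T_def field_simps)
  have "real R ^ CARD('n) = \<epsilon> ^ CARD('n) * T ^ CARD('n)"
    using e by (simp add: T_def power_mult_distrib[symmetric])
  also have "\<dots> \<le> \<epsilon> ^ 1 * T ^ CARD('n)"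
    using e T by (intro mult_right_mono power_decreasing) (auto simp: Suc_le_eq)
  finally have "unit_ball_vol CARD('n) * real R ^ CARD('n) \<le> \<epsilon> * (unit_ball_vol CARD('n) * T ^ CARD('n))"
    by (simp add: mult.left_commute mult_left_mono)
  then have "emeasure lebesgue (ball (0 :: real ^ 'n) (real R)) \<le> ennreal \<epsilon> * emeasure lebesgue (ball (0 :: real ^ 'n) T)"
    using T e R0 by (subst (1 2) emeasure_ball_pow) (auto simp: ennreal_mult[symmetric] intro!: ennreal_leI)
  then have "emeasure \<mu> (ball 0 (real R)) \<le> ennreal (C * \<epsilon> powr (1 / s)) * emeasure \<mu> (ball 0 T)"
    using T by (intro ainfD[OF A T(1) e(1)] subset_ball) auto
  also have "\<dots> \<le> ennreal (C * \<epsilon> powr (1 / s)) * emeasure \<mu> UNIV"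
    using sets\<mu> by (intro mult_left_mono emeasure_mono) auto
  also have "\<dots> = ennreal (C * \<epsilon> powr (1 / s) * M)" unfolding M(1) using C M by (simp add: ennreal_mult)
  finally have "ennreal b \<le> ennreal (C * \<epsilon> powr (1 / s) * M)" unfolding b(1) .
  then show False using less b C M by (simp add: ennreal_le_iff)
qed


section \<open>Distribution functions\<close>

definition tail :: "'a measure \<Rightarrow> ('a \<Rightarrow> ennreal) \<Rightarrow> real \<Rightarrow> ennreal" where
  "tail \<mu> h t = emeasure \<mu> {x \<in> space \<mu>. ennreal t < h x}"

lemma tail_antimono:
  assumes "h \<in> borel_measurable \<mu>" "t \<le> u"
  shows "tail \<mu> h u \<le> tail \<mu> h t"
proof -
  have [measurable]: "h \<in> borel_measurable \<mu>" by fact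
  have "ennreal t \<le> ennreal u" using assms by (simp add: ennreal_leI)
  then show ?thesis unfolding tail_def
    by (intro emeasure_mono) (auto intro: le_less_trans)
qed

text \<open>The superlevel sets of a decreasing function are intervals.\<close>

lemma borel_measurable_antimono:
  fixes f :: "real \<Rightarrow> ennreal"
  assumes "\<And>t u. t \<le> u \<Longrightarrow> f u \<le> f t"
  shows "f \<in> borel_measurable borel"
proof (rule borel_measurableI_greater)
  fix c
  have "is_interval {t. c < f t}"
    unfolding is_interval_1 using assms by (auto intro: less_le_trans)
  then show "{t \<in> space borel. c < f t} \<in> sets borel"
    using real_interval_borel_measurable[of "{t. c < f t}"] by simp
qed

lemma borel_measurable_tail [measurable (raw)]: 
  "h \<in> borel_measurable \<mu> \<Longrightarrow> tail \<mu> h \<in> borel_measurable borel"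
  by (rule borel_measurable_antimono) (rule tail_antimono)

text \<open>Common properties of \<open>f \<mapsto> \<integral>\<^sub>0\<^sup>\<infinity> f\<close> and \<open>f \<mapsto> sup\<^sub>t\<^sub>>\<^sub>0 t f(t)\<close>,
  which yield the \<open>p\<close>-th powers of the strong and of the weak norm of \<open>h\<close> when
  applied to the distribution function of \<open>h\<^sup>p\<close>.\<close>

locale tail_functional =
  fixes \<Phi> :: "(real \<Rightarrow> ennreal) \<Rightarrow> ennreal"
  assumes mono: "(\<And>t. 0 < t \<Longrightarrow> f t \<le> g t) \<Longrightarrow> \<Phi> f \<le> \<Phi> g"
    and add: "f \<in> borel_measurable borel \<Longrightarrow> g \<in> borel_measurable borel \<Longrightarrow> \<Phi> (\<lambda>t. f t + g t) \<le> \<Phi> f + \<Phi> g"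
    and cmult: "f \<in> borel_measurable borel \<Longrightarrow> \<Phi> (\<lambda>t. c * f t) = c * \<Phi> f"
    and scale: "f \<in> borel_measurable borel \<Longrightarrow> 0 < \<sigma> \<Longrightarrow> ennreal \<sigma> * \<Phi> (\<lambda>t. f (\<sigma> * t)) = \<Phi> f"
    and interval: "0 < e \<Longrightarrow> \<Phi> (indicator {0<..e}) = ennreal e"
    and SUP: "(\<And>k. F k \<in> borel_measurable borel) \<Longrightarrow> (\<And>k t. F k t \<le> F (Suc k) t) \<Longrightarrow> 
      \<Phi> (\<lambda>t. SUP k::nat. F k t) \<le> (SUP k. \<Phi> (F k))"
begin

text \<open>Absorption: rescaling by \<theta> turns the hypothesis into \<Phi> f \<le> c \<theta>
  \<Phi> f + \<theta> \<Phi> d, and half of the finite \<Phi> f can be subtracted.\<close>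

lemma bound_finite:
  assumes f: "f \<in> borel_measurable borel" and d: "d \<in> borel_measurable borel"
    and \<theta>: "0 < \<theta>" and c: "0 \<le> c" "c * \<theta> \<le> 1 / 2"
    and le: "\<And>t. 0 < t \<Longrightarrow> f (\<theta> * t) \<le> ennreal c * f t + d t"
    and fin: "\<Phi> f < top"
  shows "\<Phi> f \<le> ennreal (2 * \<theta>) * \<Phi> d"
proof -
  have "\<Phi> f = ennreal \<theta> * \<Phi> (\<lambda>t. f (\<theta> * t))" using scale[OF f \<theta>] by simp
  also have "\<dots> \<le> ennreal \<theta> * \<Phi> (\<lambda>t. ennreal c * f t + d t)" by (intro mult_left_mono mono le) auto
  also have "\<dots> \<le> ennreal \<theta> * (ennreal c * \<Phi> f + \<Phi> d)"
    using add[of "\<lambda>t. ennreal c * f t" d] f d by (intro mult_left_mono) (auto simp: cmult)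
  also have "\<dots> = ennreal (c * \<theta>) * \<Phi> f + ennreal \<theta> * \<Phi> d"
    using c \<theta> by (simp add: distrib_left ennreal_mult mult_ac)
  also have "\<dots> \<le> ennreal (1 / 2) * \<Phi> f + ennreal \<theta> * \<Phi> d"
    by (intro add_right_mono mult_right_mono ennreal_leI c) simp
  finally have 1: "\<Phi> f \<le> ennreal (1 / 2) * \<Phi> f + ennreal \<theta> * \<Phi> d" .
  obtain m where m: "\<Phi> f = ennreal m" "0 \<le> m" using fin by (metis enn2real_nonneg ennreal_enn2real)
  have "ennreal (m / 2) + ennreal (m / 2) = \<Phi> f" using m by (subst ennreal_plus[symmetric]) auto
  also note 1
  also have "ennreal (1 / 2) * \<Phi> f = ennreal (m / 2)" unfolding m(1) using m(2) by (subst ennreal_mult[symmetric]) auto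
  finally have "ennreal (m / 2) \<le> ennreal \<theta> * \<Phi> d" by (simp add: ennreal_add_left_cancel_le)
  then have "ennreal 2 * ennreal (m / 2) \<le> ennreal 2 * (ennreal \<theta> * \<Phi> d)" by (intro mult_left_mono) auto
  also have "ennreal 2 * ennreal (m / 2) = \<Phi> f" unfolding m(1) using m(2) by (subst ennreal_mult[symmetric]) auto
  also have "ennreal 2 * (ennreal \<theta> * \<Phi> d) = ennreal (2 * \<theta>) * \<Phi> d"
    unfolding mult.assoc[symmetric] using \<theta> by (subst ennreal_mult[symmetric]) auto
  finally show ?thesis .
qed

text \<open>If \<Phi> f is not known to be finite, absorption is applied to cut-offs of f. This
  yields a bound with an additional M, which serves only to show that \<Phi> f is finite whenever
  \<Phi> d is.\<close>

lemma bound: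
  assumes f: "\<And>t u. t \<le> u \<Longrightarrow> f u \<le> f t" and d: "d \<in> borel_measurable borel"
    and \<theta>: "1 \<le> \<theta>" and c: "0 \<le> c" "c * \<theta> \<le> 1 / 2"
    and le: "\<And>t. 0 < t \<Longrightarrow> f (\<theta> * t) \<le> ennreal c * f t + d t"
    and fin: "\<Phi> f < top \<or> (\<exists>M. \<forall>t. 0 < t \<longrightarrow> t \<le> 1 \<longrightarrow> ennreal t * f t \<le> ennreal M)"
  shows "\<Phi> f \<le> ennreal (2 * \<theta>) * \<Phi> d"
proof -
  have fm [measurable]: "f \<in> borel_measurable borel" using f by (rule borel_measurable_antimono)
  have \<theta>0: "0 < \<theta>" using \<theta> by simp
  show ?thesis
  proof (cases "\<Phi> f < top")
    case True
    then show ?thesis using bound_finite[OF fm d \<theta>0 c le] by blast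
  next
    case False
    then obtain M where M: "\<And>t. 0 < t \<Longrightarrow> t \<le> 1 \<Longrightarrow> ennreal t * f t \<le> ennreal M" using fin by blast
    have bd: "\<Phi> f \<le> ennreal (2 * \<theta>) * (\<Phi> d + ennreal M)"
    proof -
      \<comment> \<open>The upper cut makes the functional finite, the lower one because
        \<open>f\<close> may be unbounded near 0; the cut-offs increase to \<open>f\<close> on the
        positive axis.\<close>
      define F where "F k t = f t * indicator {1 / Suc k<..<Suc k} t" for k :: nat and t :: real
      have Fm: "F k \<in> borel_measurable borel" for k unfolding F_def by measurable
      have "F k t \<le> F (Suc k) t" for k t
      proof -
        have "1 / real (Suc (Suc k)) \<le> 1 / real (Suc k)" by (intro divide_left_mono) auto
        then show ?thesis by (auto simp: F_def indicator_def)
      qed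
      have "\<Phi> f \<le> \<Phi> (\<lambda>t. SUP k. F k t)"
      proof (rule mono)
        fix t :: real assume t: "0 < t"
        obtain k1 where k1: "inverse (real (Suc k1)) < t" using reals_Archimedean[OF t] by auto
        obtain k2 where k2: "t < real k2" using reals_Archimedean2 by blast
        define k where "k = max k1 k2"
        have "1 / real (Suc k) \<le> inverse (real (Suc k1))" unfolding inverse_eq_divide
          by (intro divide_left_mono) (auto simp: k_def)
        then have "f t = F k t" using k1 k2 by (auto simp: F_def k_def)
        then show "f t \<le> (SUP k. F k t)" by (metis SUP_upper UNIV_I)
      qed
      also have "\<dots> \<le> (SUP k. \<Phi> (F k))" by (intro SUP Fm) fact
      also have "\<dots> \<le> ennreal (2 * \<theta>) * (\<Phi> d + ennreal M)"
      proof (rule SUP_least)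
        fix k :: nat
        define e where "e = 1 / real (Suc k)"
        have e: "0 < e" "e \<le> 1" by (auto simp: e_def)
        have fe: "f e < top"
        proof -
          have "ennreal e * f e < top" using M[OF e] by (rule le_less_trans) simp
          then show ?thesis using e by (auto simp: ennreal_mult_less_top)
        qed
        \<comment> \<open>For \<open>t \<le> e\<close> the cut-off may vanish at \<open>t\<close>
          but not at \<open>\<theta> * t\<close>. There monotonicity gives the bound
          \<open>f e\<close>, and the functional of this correction is
          \<open>e * f e \<le> M\<close>.\<close>
        let ?d = "\<lambda>t. d t + f e * indicator {0<..e} t"
        have dm: "?d \<in> borel_measurable borel" using d by measurable
        have "\<Phi> (F k) \<le> \<Phi> (\<lambda>t. f e * indicator {0<..real (Suc k)} t)"
          by (intro mono) (auto simp: F_def indicator_def e_def intro!: f)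
        also have "\<dots> = f e * ennreal (real (Suc k))" by (subst cmult) (auto simp: interval simp del: of_nat_Suc)
        also have "\<dots> < top" using fe by (simp add: ennreal_mult_less_top)
        finally have finF: "\<Phi> (F k) < top" .
        have leF: "F k (\<theta> * t) \<le> ennreal c * F k t + ?d t" if t: "0 < t" for t
        proof (cases "\<theta> * t \<in> {e<..<real (Suc k)}")
          case True
          have "1 * t \<le> \<theta> * t" using t \<theta> by (intro mult_right_mono) auto
          show ?thesis
          proof (cases "t \<le> e")
            case le_e: True
            have "F k (\<theta> * t) \<le> f (\<theta> * t)" by (auto simp: F_def indicator_def)
            also have "\<dots> \<le> f e" using True by (intro f) auto
            also have "\<dots> \<le> ennreal c * F k t + ?d t" using le_e t by simp
            finally show ?thesis .
          next
            case False
            then have "F k t = f t" using True \<open>1 * t \<le> \<theta> * t\<close> by (auto simp: F_def e_def indicator_def)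
            moreover have "F k (\<theta> * t) \<le> f (\<theta> * t)" by (auto simp: F_def indicator_def)
            ultimately show ?thesis using le[OF t] False by (auto intro: order_trans)
          qed
        next
          case False
          then have "F k (\<theta> * t) = 0" by (simp add: F_def e_def)
          then show ?thesis by simp
        qed
        have "\<Phi> (F k) \<le> ennreal (2 * \<theta>) * \<Phi> ?d"
          by (rule bound_finite[OF Fm dm \<theta>0 c leF finF])
        also have "\<dots> \<le> ennreal (2 * \<theta>) * (\<Phi> d + \<Phi> (\<lambda>t. f e * indicator {0<..e} t))"
          by (intro mult_left_mono add d) auto
        also have "\<Phi> (\<lambda>t. f e * indicator {0<..e} t) = ennreal e * f e"
          using e by (subst cmult) (auto simp: interval mult.commute)
        also have "ennreal (2 * \<theta>) * (\<Phi> d + ennreal e * f e) \<le> ennreal (2 * \<theta>) * (\<Phi> d + ennreal M)"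
          by (intro mult_left_mono add_left_mono M e) auto
        finally show "\<Phi> (F k) \<le> ennreal (2 * \<theta>) * (\<Phi> d + ennreal M)" .
      qed
      finally show ?thesis .
    qed
    \<comment> \<open>For finite \<open>\<Phi> d\<close> the crude bound \<open>bd\<close>
      contradicts the assumption of this case.\<close>
    show ?thesis
    proof (cases "\<Phi> d = top")
      case True
      then show ?thesis using \<theta> by (simp add: ennreal_mult_top)
    next
      case False
      then have "\<Phi> f < top" using bd by (auto intro: le_less_trans simp: ennreal_mult_less_top less_top)
      with \<open>\<not> \<Phi> f < top\<close> show ?thesis by simp
    qed
  qed
qed

end

interpretation tail_integral: tail_functional "\<lambda>f. \<integral>\<^sup>+ t. f t * indicator {0<..} t \<partial>lborel"
proof
  show "(\<integral>\<^sup>+ t. f t * indicator {0<..} t \<partial>lborel) \<le> (\<integral>\<^sup>+ t. g t * indicator {0<..} t \<partial>lborel)"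
    if "\<And>t. 0 < t \<Longrightarrow> f t \<le> g t" for f g :: "real \<Rightarrow> ennreal"
    using that by (intro nn_integral_mono) (auto simp: indicator_def)
  show "(\<integral>\<^sup>+ t. (f t + g t) * indicator {0<..} t \<partial>lborel) \<le> 
      (\<integral>\<^sup>+ t. f t * indicator {0<..} t \<partial>lborel) + (\<integral>\<^sup>+ t. g t * indicator {0<..} t \<partial>lborel)"
    if [measurable]: "f \<in> borel_measurable borel" "g \<in> borel_measurable borel" for f g :: "real \<Rightarrow> ennreal"
    by (simp add: distrib_right nn_integral_add)
  show "(\<integral>\<^sup>+ t. (c * f t) * indicator {0<..} t \<partial>lborel) = c * (\<integral>\<^sup>+ t. f t * indicator {0<..} t \<partial>lborel)"
    if [measurable]: "f \<in> borel_measurable borel" for f :: "real \<Rightarrow> ennreal" and c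
    by (simp add: mult.assoc nn_integral_cmult)
  show "ennreal \<sigma> * (\<integral>\<^sup>+ t. f (\<sigma> * t) * indicator {0<..} t \<partial>lborel) = (\<integral>\<^sup>+ t. f t * indicator {0<..} t \<partial>lborel)"
    if [measurable]: "f \<in> borel_measurable borel" and \<sigma>: "0 < \<sigma>" for f :: "real \<Rightarrow> ennreal" and \<sigma>
  proof -
    have "(\<integral>\<^sup>+ t. f t * indicator {0<..} t \<partial>lborel) = ennreal \<bar>\<sigma>\<bar> * (\<integral>\<^sup>+ t. f (0 + \<sigma> * t) * indicator {0<..} (0 + \<sigma> * t) \<partial>lborel)"
      using \<sigma> by (intro nn_integral_real_affine) auto
    also have "(\<lambda>t. f (0 + \<sigma> * t) * indicator {0<..} (0 + \<sigma> * t)) = (\<lambda>t. f (\<sigma> * t) * indicator {0<..} t :: ennreal)"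
      using \<sigma> by (auto simp: indicator_def zero_less_mult_iff fun_eq_iff)
    finally show ?thesis using \<sigma> by simp
  qed
  show "(\<integral>\<^sup>+ t. indicator {0<..e} t * indicator {0<..} t \<partial>lborel) = ennreal e" if "0 < e" for e :: real
  proof -
    have "(\<lambda>t. indicator {0<..e} t * indicator {0<..} t) = (indicator {0<..e} :: real \<Rightarrow> ennreal)"
      by (auto simp: indicator_def)
    then show ?thesis using that by simp
  qed
  show "(\<integral>\<^sup>+ t. (SUP k::nat. F k t) * indicator {0<..} t \<partial>lborel) \<le> (SUP k. (\<integral>\<^sup>+ t. F k t * indicator {0<..} t \<partial>lborel))"
    if [measurable]: "\<And>k. F k \<in> borel_measurable borel" and inc: "\<And>k t. F k t \<le> F (Suc k) t" for F :: "nat \<Rightarrow> real \<Rightarrow> ennreal"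
  proof -
    have "(\<integral>\<^sup>+ t. (SUP k. F k t * indicator {0<..} t) \<partial>lborel) = (SUP k. (\<integral>\<^sup>+ t. F k t * indicator {0<..} t \<partial>lborel))"
      using inc by (intro nn_integral_monotone_convergence_SUP incseq_SucI le_funI mult_right_mono) auto
    then show ?thesis by (simp add: SUP_mult_right_ennreal)
  qed
qed

interpretation tail_supremum: tail_functional "\<lambda>f. SUP t\<in>{0<..}. ennreal t * f t"
proof
  show "(SUP t\<in>{0<..}. ennreal t * f t) \<le> (SUP t\<in>{0<..}. ennreal t * g t)"
    if "\<And>t. 0 < t \<Longrightarrow> f t \<le> g t" for f g :: "real \<Rightarrow> ennreal"
    using that by (intro SUP_mono) (force intro: mult_left_mono)
  show "(SUP t\<in>{0<..}. ennreal t * (f t + g t)) \<le> (SUP t\<in>{0<..}. ennreal t * f t) + (SUP t\<in>{0<..}. ennreal t * g t)"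
    for f g :: "real \<Rightarrow> ennreal"
    unfolding distrib_left by (intro SUP_least add_mono SUP_upper) auto
  show "(SUP t\<in>{0<..}. ennreal t * (c * f t)) = c * (SUP t\<in>{0<..}. ennreal t * f t)"
    for f :: "real \<Rightarrow> ennreal" and c
    by (simp add: SUP_mult_left_ennreal mult.left_commute)
  show "ennreal \<sigma> * (SUP t\<in>{0<..}. ennreal t * f (\<sigma> * t)) = (SUP t\<in>{0<..}. ennreal t * f t)"
    if \<sigma>: "0 < \<sigma>" for f :: "real \<Rightarrow> ennreal" and \<sigma>
  proof -
    have im: "{0::real<..} = (\<lambda>t. \<sigma> * t) ` {0<..}"
    proof (intro equalityI subsetI)
      fix u :: real assume "u \<in> {0<..}"
      then show "u \<in> (\<lambda>t. \<sigma> * t) ` {0<..}" using \<sigma> by (intro image_eqI[of _ _ "u / \<sigma>"]) auto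
    qed (use \<sigma> in auto)
    have "(SUP t\<in>{0<..}. ennreal t * f t) = (SUP t\<in>{0<..}. ennreal (\<sigma> * t) * f (\<sigma> * t))"
      by (subst im) (simp add: image_image)
    also have "\<dots> = (SUP t\<in>{0<..}. ennreal \<sigma> * (ennreal t * f (\<sigma> * t)))"
      using \<sigma> by (intro SUP_cong) (auto simp: ennreal_mult mult.assoc)
    also have "\<dots> = ennreal \<sigma> * (SUP t\<in>{0<..}. ennreal t * f (\<sigma> * t))"
      by (simp add: SUP_mult_left_ennreal)
    finally show ?thesis ..
  qed
  show "(SUP t\<in>{0<..}. ennreal t * indicator {0<..e} t) = ennreal e" if "0 < e" for e :: real
  proof (rule antisym)
    show "(SUP t\<in>{0<..}. ennreal t * indicator {0<..e} t) \<le> ennreal e"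
      by (intro SUP_least) (auto simp: indicator_def ennreal_leI)
    show "ennreal e \<le> (SUP t\<in>{0<..}. ennreal t * indicator {0<..e} t)"
      using that by (intro SUP_upper2[of e]) auto
  qed
  show "(SUP t\<in>{0<..}. ennreal t * (SUP k::nat. F k t)) \<le> (SUP k. (SUP t\<in>{0<..}. ennreal t * F k t))"
    for F :: "nat \<Rightarrow> real \<Rightarrow> ennreal"
  proof -
    have "(SUP t\<in>{0<..}. ennreal t * (SUP k::nat. F k t)) = (SUP t\<in>{0<..}. (SUP k. ennreal t * F k t))"
      by (simp add: SUP_mult_left_ennreal)
    then show ?thesis by (subst SUP_commute) simp
  qed
qed

section \<open>Powers and the layer cake formula\<close>

lemma epowr_SUP:
  assumes "0 < r"
  shows "(SUP i\<in>I. f i) epowr r = (SUP i\<in>I. f i epowr r)"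
proof (rule antisym)
  have "(SUP i\<in>I. f i) \<le> (SUP i\<in>I. f i epowr r) epowr (1 / r)"
  proof (rule SUP_least)
    fix i assume "i \<in> I"
    then have "f i epowr r \<le> (SUP i\<in>I. f i epowr r)" by (rule SUP_upper)
    then have "(f i epowr r) epowr (1 / r) \<le> (SUP i\<in>I. f i epowr r) epowr (1 / r)"
      using assms by (intro epowr_mono) auto
    then show "f i \<le> (SUP i\<in>I. f i epowr r) epowr (1 / r)" using assms by (simp add: epowr_epowr)
  qed
  then have "(SUP i\<in>I. f i) epowr r \<le> ((SUP i\<in>I. f i epowr r) epowr (1 / r)) epowr r"
    using assms by (intro epowr_mono) auto
  then show "(SUP i\<in>I. f i) epowr r \<le> (SUP i\<in>I. f i epowr r)" using assms by (simp add: epowr_epowr)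
  show "(SUP i\<in>I. f i epowr r) \<le> (SUP i\<in>I. f i) epowr r"
    using assms by (intro SUP_least epowr_mono SUP_upper) auto
qed

lemma less_epowr_iff:
  assumes "0 < p" "0 \<le> t"
  shows "ennreal t < y epowr p \<longleftrightarrow> ennreal (t powr (1 / p)) < y"
proof -
  have "y epowr p \<le> ennreal t \<longleftrightarrow> y \<le> ennreal t epowr (1 / p)"
    using epowr_le_iff[of p y "ennreal t epowr (1 / p)"] assms by (simp add: epowr_epowr)
  then show ?thesis using assms by (simp add: epowr_ennreal not_le[symmetric])
qed

text \<open>Tonelli for the region 0 < t < g(x), whose section at x has length g(x).\<close>

lemma layer_cake:
  assumes "sigma_finite_measure \<mu>" and g [measurable]: "g \<in> borel_measurable \<mu>"
  shows "(\<integral>\<^sup>+ x. g x \<partial>\<mu>) = (\<integral>\<^sup>+ t. tail \<mu> g t * indicator {0<..} t \<partial>lborel)"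
proof -
  interpret \<mu>: sigma_finite_measure \<mu> by fact
  interpret P: pair_sigma_finite lborel \<mu> by unfold_locales
  let ?f = "\<lambda>t x. (if ennreal t < g x \<and> 0 < t then 1 else 0) :: ennreal"
  have "(\<integral>\<^sup>+ x. g x \<partial>\<mu>) = (\<integral>\<^sup>+ x. (\<integral>\<^sup>+ t. ?f t x \<partial>lborel) \<partial>\<mu>)"
  proof (rule nn_integral_cong)
    fix x
    have "(\<integral>\<^sup>+ t. ?f t x \<partial>lborel) = (\<integral>\<^sup>+ t. indicator {t. ennreal t < g x \<and> 0 < t} t \<partial>lborel)"
      by (intro nn_integral_cong) (auto simp: indicator_def)
    also have "\<dots> = emeasure lborel {t. ennreal t < g x \<and> 0 < t}" 
    proof -
      have "{t. ennreal t < g x \<and> 0 < t} \<in> sets borel" by measurable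
      then show ?thesis by simp
    qed
    also have "\<dots> = g x"
    proof (cases "g x")
      case (real u)
      then have "{t. ennreal t < g x \<and> 0 < t} = {0<..<u}" by (auto simp: ennreal_less_iff)
      then show ?thesis using real by simp
    next
      case top
      have "ennreal (real n) \<le> emeasure lborel {0::real<..}" for n
      proof -
        have "ennreal (real n) = emeasure lborel {0<..<real n}" by simp
        also have "\<dots> \<le> emeasure lborel {0::real<..}" by (intro emeasure_mono) auto
        finally show ?thesis .
      qed
      then have "emeasure lborel {0::real<..} = top"
        by (metis ennreal_of_nat_eq_real_of_nat ennreal_Ex_less_of_nat not_le top.not_eq_extremum)
      moreover have "{t. ennreal t < g x \<and> 0 < t} = {0<..}" using top by auto
      ultimately show ?thesis using top by simp
    qed
    finally show "g x = (\<integral>\<^sup>+ t. ?f t x \<partial>lborel)" ..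
  qed
  also have "\<dots> = (\<integral>\<^sup>+ t. (\<integral>\<^sup>+ x. ?f t x \<partial>\<mu>) \<partial>lborel)"
    by (rule P.Fubini') measurable
  also have "\<dots> = (\<integral>\<^sup>+ t. tail \<mu> g t * indicator {0<..} t \<partial>lborel)"
  proof (rule nn_integral_cong)
    fix t
    have "(\<integral>\<^sup>+ x. ?f t x \<partial>\<mu>) = (\<integral>\<^sup>+ x. indicator {0<..} t * indicator {x \<in> space \<mu>. ennreal t < g x} x \<partial>\<mu>)"
      by (intro nn_integral_cong) (auto simp: indicator_def)
    also have "\<dots> = indicator {0<..} t * tail \<mu> g t"
      unfolding tail_def by (rule nn_integral_cmult_indicator) measurable
    finally show "(\<integral>\<^sup>+ x. ?f t x \<partial>\<mu>) = tail \<mu> g t * indicator {0<..} t" by (simp add: mult.commute)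
  qed
  finally show ?thesis .
qed


section \<open>Choice of parameters and the dilation inequality\<close>

lemma ratio_pow_add_pos: "1 \<le> a \<Longrightarrow> 0 < K \<Longrightarrow> 0 < \<gamma> \<Longrightarrow> 0 < ratio_pow q a K + \<gamma> / K"
  by (auto simp: ratio_pow_def intro!: add_nonneg_pos)

lemma good_lambda_const_pos:
  assumes "0 < C" "0 < D"
  shows "0 < good_lambda_const TYPE('n) q C D s"
proof -
  have "unit_ball_vol (real CARD('n)) \<noteq> 0" by (metis less_irrefl unit_ball_vol_pos of_nat_0_le_iff)
  then show ?thesis unfolding good_lambda_const_def using assms by (intro mult_pos_pos powr_gt_zero[THEN iffD2]) auto
qed

text \<open>If the level set is the whole space, its mass is 0 or infinite; since the constant is
  positive, the claim is trivial in both cases.\<close>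

lemma good_lambda_inequality:
  fixes F :: "real ^ 'n \<Rightarrow> ennreal"
  assumes dec: "cube_decomposition q a F G H1 H2" and a: "1 \<le> a" and q: "1 < q"
    and meas: "G \<in> borel_measurable lebesgue" "H2 \<in> borel_measurable lebesgue"
    and lam: "0 < lam" and \<gamma>: "0 < \<gamma>" "\<gamma> < 1" and K: "4 * a \<le> K" "16 ^ CARD('n) \<le> K"
    and \<mu>: "ainf \<mu> C s" "doubling \<mu> D"
  shows "emeasure \<mu> {x. ennreal (K * lam) < maximal F x \<and> G x + H2 x \<le> ennreal (\<gamma> * lam)}
    \<le> ennreal (good_lambda_const TYPE('n) q C D s * (ratio_pow q a K + \<gamma> / K) powr (1 / s)) 
      * emeasure \<mu> {x. ennreal lam < maximal F x + maximal H1 x}"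
    (is "emeasure \<mu> ?X \<le> ennreal ?c * emeasure \<mu> ?E")
proof (cases "?E = UNIV")
  case True
  have sets\<mu>: "sets \<mu> = sets lebesgue" using \<mu> by (simp add: ainf_def)
  have "emeasure \<mu> ?X \<le> emeasure \<mu> UNIV" using sets\<mu> by (intro emeasure_mono) auto
  moreover have "0 < ratio_pow q a K + \<gamma> / K" using a K \<gamma> by (intro ratio_pow_add_pos) auto
  then have "0 < ?c" using \<mu> by (intro mult_pos_pos good_lambda_const_pos) (auto simp: ainf_def doubling_def)
  ultimately show ?thesis unfolding True
    using ainf_infinite_mass[OF \<mu>(1)] by (cases "emeasure \<mu> UNIV = 0") 
      (auto simp: zero_less_iff_neq_zero ennreal_mult_top)
next
  case False
  then show ?thesis using assms by (intro good_lambda) auto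
qed

text \<open>It suffices that both summands are at most (\<kappa>/2) K^(-ps). For the first one K is
  taken large, which works because ps < q; the second is then made small by \<gamma>, chosen after
  K.\<close>

lemma exists_dilation_parameters:
  assumes L: "0 < L" and p: "0 < p" and s: "0 < s" and q: "1 < q" and pq: "ennreal p < q / ennreal s" and a: "1 \<le> a"
  shows "\<exists>K \<gamma>. K0 \<le> K \<and> 1 \<le> K \<and> 0 < \<gamma> \<and> \<gamma> < 1 \<and> 
    L * (ratio_pow q a K + \<gamma> / K) powr (1 / s) * (2 * K) powr p \<le> 1 / 2"
proof -
  \<comment> \<open>Makes L (\<kappa> K^(-ps))^(1/s) (2K)^p equal to 1/2.\<close>
  define \<kappa> where "\<kappa> = (1 / (2 * L * 2 powr p)) powr s"
  have \<kappa>: "0 < \<kappa>" using L by (simp add: \<kappa>_def)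
  have "\<exists>K. K0 \<le> K \<and> 1 \<le> K \<and> ratio_pow q a K \<le> \<kappa> / 2 * K powr (- (p * s))"
  proof (cases "q = top")
    case True
    then show ?thesis using \<kappa> by (intro exI[of _ "max K0 1"]) (auto simp: ratio_pow_def)
  next
    case False
    define t where "t = enn2real q"
    have qt: "q = ennreal t" "0 \<le> t" using False by (auto simp: t_def less_top)
    then have "ennreal p < ennreal (t / s)" using pq s by (simp add: divide_ennreal)
    then have "p < t / s" using p by (simp add: ennreal_less_iff)
    then have ps: "p * s < t" using s by (simp add: field_simps)
    \<comment> \<open>The last term solves 2 a^t / \<kappa> = K^(t - ps), whose exponent is
      positive.\<close>
    define K where "K = max (max K0 1) ((2 * a powr t / \<kappa>) powr (1 / (t - p * s)))"
    have K: "K0 \<le> K" "1 \<le> K" by (auto simp: K_def)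
    have "2 * a powr t / \<kappa> = ((2 * a powr t / \<kappa>) powr (1 / (t - p * s))) powr (t - p * s)"
      using ps \<kappa> a by (simp add: powr_powr)
    also have "\<dots> \<le> K powr (t - p * s)" using ps by (intro powr_mono2) (auto simp: K_def)
    finally have "a powr t \<le> \<kappa> / 2 * K powr (t - p * s)" using \<kappa> by (simp add: field_simps)
    then have "a powr t / K powr t \<le> (\<kappa> / 2 * K powr (t - p * s)) / K powr t"
      using K by (intro divide_right_mono) auto
    also have "\<dots> = \<kappa> / 2 * K powr (- (p * s))" using K by (simp add: powr_diff powr_minus divide_simps)
    finally show ?thesis using K False by (intro exI[of _ K]) (auto simp: ratio_pow_def t_def)
  qed
  then obtain K where K: "K0 \<le> K" "1 \<le> K" "ratio_pow q a K \<le> \<kappa> / 2 * K powr (- (p * s))" by blast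
  define \<gamma> where "\<gamma> = min (1 / 2) (\<kappa> / 2 * K powr (- (p * s)) * K)"
  have \<gamma>: "0 < \<gamma>" "\<gamma> < 1" using \<kappa> K by (auto simp: \<gamma>_def)
  have "\<gamma> / K \<le> (\<kappa> / 2 * K powr (- (p * s)) * K) / K" 
    using K by (intro divide_right_mono) (auto simp: \<gamma>_def)
  then have "\<gamma> / K \<le> \<kappa> / 2 * K powr (- (p * s))" using K by simp
  with K(3) have "ratio_pow q a K + \<gamma> / K \<le> \<kappa> / 2 * K powr (- (p * s)) + \<kappa> / 2 * K powr (- (p * s))"
    by (rule add_mono)
  also have "\<dots> = \<kappa> * K powr (- (p * s))" by simp
  finally have "ratio_pow q a K + \<gamma> / K \<le> \<kappa> * K powr (- (p * s))" .
  then have "(ratio_pow q a K + \<gamma> / K) powr (1 / s) \<le> (\<kappa> * K powr (- (p * s))) powr (1 / s)"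
    using s ratio_pow_add_pos[OF a _ \<gamma>(1), of K q] K by (intro powr_mono2) auto
  also have "\<dots> = 1 / (2 * L * 2 powr p) * K powr (- p)"
    using s L K by (simp add: powr_mult \<kappa>_def powr_powr)
  finally have "L * (ratio_pow q a K + \<gamma> / K) powr (1 / s) * (2 * K) powr p \<le> 
      L * (1 / (2 * L * 2 powr p) * K powr (- p)) * (2 * K) powr p"
    using L by (intro mult_right_mono mult_left_mono) auto
  also have "\<dots> = 1 / 2" using L K by (simp add: powr_mult powr_minus field_simps)
  finally show ?thesis using K \<gamma> by blast
qed

lemma tail_epowr:
  assumes "0 < p" "0 < t"
  shows "tail \<mu> (\<lambda>x. h x epowr p) t = emeasure \<mu> {x \<in> space \<mu>. ennreal (t powr (1 / p)) < h x}"
  using assms by (simp add: tail_def less_epowr_iff)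

text \<open>The good-\<lambda> inequality at level 2u with u = t^(1/p). The factor 2 splits sums: if
  a sum of two terms exceeds 2u, one of them exceeds u, and likewise with \<gamma>u for G + H2. In
  terms of p-th powers the level K(2u) becomes (2K)^p t.\<close>

lemma tail_dilation:
  fixes F :: "real ^ 'n \<Rightarrow> ennreal"
  assumes dec: "cube_decomposition q a F G H1 H2" and a: "1 \<le> a" and q: "1 < q"
    and meas [measurable]: "G \<in> borel_measurable lebesgue" "H2 \<in> borel_measurable lebesgue"
    and \<gamma>: "0 < \<gamma>" "\<gamma> < 1" and K: "4 * a \<le> K" "16 ^ CARD('n) \<le> K"
    and \<mu>: "ainf \<mu> C s" "doubling \<mu> D" and p: "0 < p" and t: "0 < t"
  defines "c \<equiv> ennreal (good_lambda_const TYPE('n) q C D s * (ratio_pow q a K + \<gamma> / K) powr (1 / s))"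
  shows "tail \<mu> (\<lambda>x. maximal F x epowr p) ((2 * K) powr p * t) \<le> 
    c * tail \<mu> (\<lambda>x. maximal F x epowr p) t + (c * tail \<mu> (\<lambda>x. maximal H1 x epowr p) t 
     + (tail \<mu> (\<lambda>x. G x epowr p) (\<gamma> powr p * t) + tail \<mu> (\<lambda>x. H2 x epowr p) (\<gamma> powr p * t)))"
proof -
  have sets\<mu> [measurable_cong]: "sets \<mu> = sets lebesgue" using \<mu> by (simp add: ainf_def)
  have space\<mu>: "space \<mu> = UNIV" using sets_eq_imp_space_eq[OF sets\<mu>] by simp
  define u where "u = t powr (1 / p)"
  have u: "0 < u" using t by (simp add: u_def)
  have K0: "0 < K" using a K by simp
  let ?L = "\<lambda>r h. {x \<in> space \<mu>. ennreal r < h x}"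
  have r: "((2 * K) powr p * t) powr (1 / p) = K * (2 * u)" "(\<gamma> powr p * t) powr (1 / p) = \<gamma> * u"
    using K0 t p \<gamma> by (auto simp: powr_mult powr_powr u_def)
  have L: "?L r h \<in> sets \<mu>" if [measurable]: "h \<in> borel_measurable lebesgue" for r and h :: "real ^ 'n \<Rightarrow> ennreal"
    by measurable
  let ?X = "{x. ennreal (K * (2 * u)) < maximal F x \<and> G x + H2 x \<le> ennreal (\<gamma> * (2 * u))}"
  have "{x \<in> space \<mu>. ennreal (K * (2 * u)) < maximal F x \<and> G x + H2 x \<le> ennreal (\<gamma> * (2 * u))} \<in> sets \<mu>" by measurable
  then have X: "?X \<in> sets \<mu>" by (simp add: space\<mu>)
  have sum: "r < y \<or> r < z" if "r + r < y + z" for r y z :: ennreal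
    using that by (metis add_mono not_le)
  have dbl: "ennreal (2 * v) = ennreal v + ennreal v" if "0 \<le> v" for v
    using that by (simp flip: ennreal_plus)
  have "emeasure \<mu> (?L (K * (2 * u)) (maximal F)) \<le> emeasure \<mu> (?X \<union> (?L (\<gamma> * u) G \<union> ?L (\<gamma> * u) H2))"
  proof (rule emeasure_mono)
    show "?L (K * (2 * u)) (maximal F) \<subseteq> ?X \<union> (?L (\<gamma> * u) G \<union> ?L (\<gamma> * u) H2)"
    proof
      fix x assume x: "x \<in> ?L (K * (2 * u)) (maximal F)"
      show "x \<in> ?X \<union> (?L (\<gamma> * u) G \<union> ?L (\<gamma> * u) H2)"
      proof (cases "G x + H2 x \<le> ennreal (\<gamma> * (2 * u))")
        case False
        then have "ennreal (\<gamma> * u) + ennreal (\<gamma> * u) < G x + H2 x"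
          using dbl[of "\<gamma> * u"] \<gamma> u by (simp add: not_le mult.left_commute)
        from sum[OF this] show ?thesis by (auto simp: space\<mu>)
      qed (use x in auto)
    qed
    show "?X \<union> (?L (\<gamma> * u) G \<union> ?L (\<gamma> * u) H2) \<in> sets \<mu>"
      by (intro sets.Un X L meas)
  qed
  also have "\<dots> \<le> emeasure \<mu> ?X + emeasure \<mu> (?L (\<gamma> * u) G \<union> ?L (\<gamma> * u) H2)"
    by (intro emeasure_subadditive sets.Un X L meas)
  also have "\<dots> \<le> emeasure \<mu> ?X + (emeasure \<mu> (?L (\<gamma> * u) G) + emeasure \<mu> (?L (\<gamma> * u) H2))"
    by (intro add_left_mono emeasure_subadditive L meas)
  finally have 1: "emeasure \<mu> (?L (K * (2 * u)) (maximal F)) \<le> 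
    emeasure \<mu> ?X + (emeasure \<mu> (?L (\<gamma> * u) G) + emeasure \<mu> (?L (\<gamma> * u) H2))" .
  have 2: "emeasure \<mu> ?X \<le> c * emeasure \<mu> {x. ennreal (2 * u) < maximal F x + maximal H1 x}"
    unfolding c_def using u by (intro good_lambda_inequality[OF dec a q meas _ \<gamma> K \<mu>]) simp
  have "emeasure \<mu> {x. ennreal (2 * u) < maximal F x + maximal H1 x} \<le> 
      emeasure \<mu> (?L u (maximal F) \<union> ?L u (maximal H1))"
  proof (rule emeasure_mono)
    show "{x. ennreal (2 * u) < maximal F x + maximal H1 x} \<subseteq> ?L u (maximal F) \<union> ?L u (maximal H1)"
    proof
      fix x assume "x \<in> {x. ennreal (2 * u) < maximal F x + maximal H1 x}"
      then have "ennreal u + ennreal u < maximal F x + maximal H1 x" using dbl[of u] u by simp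
      from sum[OF this] show "x \<in> ?L u (maximal F) \<union> ?L u (maximal H1)" by (auto simp: space\<mu>)
    qed
    show "?L u (maximal F) \<union> ?L u (maximal H1) \<in> sets \<mu>" by (intro sets.Un L borel_measurable_lebesgue_maximal)
  qed
  also have "\<dots> \<le> emeasure \<mu> (?L u (maximal F)) + emeasure \<mu> (?L u (maximal H1))"
    by (intro emeasure_subadditive L borel_measurable_lebesgue_maximal)
  finally have 3: "emeasure \<mu> {x. ennreal (2 * u) < maximal F x + maximal H1 x} \<le>
    emeasure \<mu> (?L u (maximal F)) + emeasure \<mu> (?L u (maximal H1))" .
  have 4: "emeasure \<mu> (?L (K * (2 * u)) (maximal F)) \<le> 
      c * (emeasure \<mu> (?L u (maximal F)) + emeasure \<mu> (?L u (maximal H1))) 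
       + (emeasure \<mu> (?L (\<gamma> * u) G) + emeasure \<mu> (?L (\<gamma> * u) H2))"
    by (rule order_trans[OF 1 add_right_mono[OF order_trans[OF 2 mult_left_mono[OF 3 zero_le]]]])
  have pos: "0 < (2 * K) powr p * t" "0 < \<gamma> powr p * t" using t K0 \<gamma> by simp_all
  show ?thesis
    using 4 unfolding tail_epowr[OF p t] tail_epowr[OF p pos(1)] tail_epowr[OF p pos(2)] r u_def[symmetric] distrib_left add.assoc .
qed


text \<open>\<open>B\<close> is fixed before the measure, so that it can be used along a sequence of
  truncated weights.\<close>

lemma (in tail_functional) maximal_estimate:
  assumes a: "1 \<le> a" and q: "1 < q" and p: "0 < p" and pq: "ennreal p < q / ennreal s"
    and CD: "0 < C" "0 < D" "0 < s"
  shows "\<exists>B>0. \<forall>(\<mu> :: (real ^ 'n) measure) F G H1 H2. ainf \<mu> C s \<longrightarrow> doubling \<mu> D \<longrightarrow> 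
    G \<in> borel_measurable lebesgue \<longrightarrow> H2 \<in> borel_measurable lebesgue \<longrightarrow> cube_decomposition q a F G H1 H2 \<longrightarrow>
    (let f = tail \<mu> (\<lambda>x. maximal F x epowr p) in
      \<Phi> f < top \<or> (\<exists>M. \<forall>t. 0 < t \<longrightarrow> t \<le> 1 \<longrightarrow> ennreal t * f t \<le> ennreal M) \<longrightarrow>
      \<Phi> f \<le> ennreal B * (\<Phi> (tail \<mu> (\<lambda>x. G x epowr p)) + \<Phi> (tail \<mu> (\<lambda>x. maximal H1 x epowr p)) + 
        \<Phi> (tail \<mu> (\<lambda>x. H2 x epowr p))))"
proof -
  define L where "L = good_lambda_const TYPE('n) q C D s"
  have L: "0 < L" unfolding L_def by (intro good_lambda_const_pos CD)
  obtain K \<gamma> where K: "max (4 * a) (16 ^ CARD('n)) \<le> K" "1 \<le> K" and \<gamma>: "0 < \<gamma>" "\<gamma> < 1"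
    and small: "L * (ratio_pow q a K + \<gamma> / K) powr (1 / s) * (2 * K) powr p \<le> 1 / 2"
    using exists_dilation_parameters[OF L p CD(3) q pq a] by blast
  define c where "c = L * (ratio_pow q a K + \<gamma> / K) powr (1 / s)"
  define \<theta> \<sigma> where "\<theta> = (2 * K) powr p" and "\<sigma> = \<gamma> powr p"
  have c: "0 \<le> c" "c * \<theta> \<le> 1 / 2" using L small by (auto simp: c_def \<theta>_def)
  have \<theta>: "1 \<le> \<theta>" unfolding \<theta>_def using K p by (intro ge_one_powr_ge_zero) auto
  have \<sigma>: "0 < \<sigma>" using \<gamma> by (simp add: \<sigma>_def)
  \<comment> \<open>\<open>2 * \<theta>\<close> comes from absorption, \<open>c\<close> from the
    term with \<open>H1\<close>, and \<open>1 / \<sigma>\<close> from undoing the dilation by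
    \<open>\<sigma>\<close> in the terms with \<open>G\<close> and \<open>H2\<close>.\<close>
  define B where "B = 2 * \<theta> * (c + 1 / \<sigma>)"
  have B: "0 < B" using c \<theta> \<sigma> by (auto simp: B_def intro!: mult_pos_pos add_nonneg_pos)
  have "\<Phi> f \<le> ennreal B * (\<Phi> g + \<Phi> h1 + \<Phi> h2)"
    if \<mu>: "ainf \<mu> C s" "doubling \<mu> D" and meas: "G \<in> borel_measurable lebesgue" "H2 \<in> borel_measurable lebesgue"
      and dec: "cube_decomposition q a F G H1 H2"
      and f: "f = tail \<mu> (\<lambda>x. maximal F x epowr p)" and g: "g = tail \<mu> (\<lambda>x. G x epowr p)" 
      and h1: "h1 = tail \<mu> (\<lambda>x. maximal H1 x epowr p)" and h2: "h2 = tail \<mu> (\<lambda>x. H2 x epowr p)"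
      and fin: "\<Phi> f < top \<or> (\<exists>M. \<forall>t. 0 < t \<longrightarrow> t \<le> 1 \<longrightarrow> ennreal t * f t \<le> ennreal M)"
    for \<mu> :: "(real ^ 'n) measure" and F G H1 H2 f g h1 h2
  proof -
    have [measurable_cong]: "sets \<mu> = sets lebesgue" using \<mu> by (simp add: ainf_def)
    have [measurable]: "G \<in> borel_measurable lebesgue" "H2 \<in> borel_measurable lebesgue" by fact+
    have mf: "(\<lambda>x. maximal F x epowr p) \<in> borel_measurable \<mu>" "(\<lambda>x. G x epowr p) \<in> borel_measurable \<mu>" 
      "(\<lambda>x. maximal H1 x epowr p) \<in> borel_measurable \<mu>" "(\<lambda>x. H2 x epowr p) \<in> borel_measurable \<mu>" by measurable
    have m [measurable]: "g \<in> borel_measurable borel" "h1 \<in> borel_measurable borel" "h2 \<in> borel_measurable borel"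
      using mf unfolding g h1 h2 by (auto intro: borel_measurable_tail)
    define d where "d t = ennreal c * h1 t + (g (\<sigma> * t) + h2 (\<sigma> * t))" for t
    have dm: "d \<in> borel_measurable borel" unfolding d_def by measurable
    have "\<Phi> f \<le> ennreal (2 * \<theta>) * \<Phi> d"
    proof (rule bound[OF _ dm \<theta> c _ fin])
      show "f u \<le> f t" if "t \<le> u" for t u
        unfolding f by (rule tail_antimono[OF mf(1) that])
      show "f (\<theta> * t) \<le> ennreal c * f t + d t" if "0 < t" for t
        unfolding d_def f g h1 h2 \<theta>_def \<sigma>_def c_def L_def
        using K(1) by (intro tail_dilation[OF dec a q meas \<gamma> _ _ \<mu> p that]) auto
    qed
    also have "\<Phi> d \<le> ennreal c * \<Phi> h1 + (ennreal (1 / \<sigma>) * \<Phi> g + ennreal (1 / \<sigma>) * \<Phi> h2)"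
    proof -
      have sc: "\<Phi> (\<lambda>t. k (\<sigma> * t)) = ennreal (1 / \<sigma>) * \<Phi> k" if "k \<in> borel_measurable borel" for k
      proof -
        have "ennreal (1 / \<sigma>) * \<Phi> k = ennreal (1 / \<sigma>) * (ennreal \<sigma> * \<Phi> (\<lambda>t. k (\<sigma> * t)))"
          using scale[OF that \<sigma>] by simp
        also have "\<dots> = \<Phi> (\<lambda>t. k (\<sigma> * t))"
          unfolding mult.assoc[symmetric] using \<sigma> by (subst ennreal_mult[symmetric]) auto
        finally show ?thesis ..
      qed
      have "\<Phi> d \<le> \<Phi> (\<lambda>t. ennreal c * h1 t) + \<Phi> (\<lambda>t. g (\<sigma> * t) + h2 (\<sigma> * t))"
        unfolding d_def by (rule add) measurable
      also have "\<Phi> (\<lambda>t. g (\<sigma> * t) + h2 (\<sigma> * t)) \<le> \<Phi> (\<lambda>t. g (\<sigma> * t)) + \<Phi> (\<lambda>t. h2 (\<sigma> * t))"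
        by (rule add) measurable
      finally show ?thesis unfolding cmult[OF m(2)] sc[OF m(1)] sc[OF m(3)] by (simp add: add_left_mono)
    qed
    also have "ennreal c * \<Phi> h1 + (ennreal (1 / \<sigma>) * \<Phi> g + ennreal (1 / \<sigma>) * \<Phi> h2) \<le> 
        ennreal (c + 1 / \<sigma>) * \<Phi> h1 + (ennreal (c + 1 / \<sigma>) * \<Phi> g + ennreal (c + 1 / \<sigma>) * \<Phi> h2)"
      using c \<sigma> by (intro add_mono mult_right_mono ennreal_leI) auto
    also have "\<dots> = ennreal (c + 1 / \<sigma>) * (\<Phi> g + \<Phi> h1 + \<Phi> h2)"
      by (simp only: distrib_left add_ac)
    also have "ennreal (2 * \<theta>) * \<dots> = ennreal B * (\<Phi> g + \<Phi> h1 + \<Phi> h2)"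
      unfolding mult.assoc[symmetric] B_def using \<theta> c \<sigma> by (subst ennreal_mult[symmetric]) auto
    finally show ?thesis by (simp add: mult_left_mono)
  qed
  then show ?thesis using B unfolding Let_def by blast
qed


section \<open>Norm inequalities\<close>

lemma emeasure_truncation_SUP:
  assumes wm [measurable]: "w \<in> borel_measurable lebesgue" and E: "E \<in> sets lebesgue"
  shows "(SUP k::nat. emeasure (wmeasure (\<lambda>x. min (w x) (real (Suc k)))) E) = emeasure (wmeasure w) E"
proof -
  let ?f = "\<lambda>k x. ennreal (min (w x) (real (Suc k))) * indicator E x :: ennreal"
  have SUP: "(SUP k. ?f k x) = ennreal (w x) * indicator E x" for x
  proof (rule antisym)
    show "(SUP k. ?f k x) \<le> ennreal (w x) * indicator E x"
      by (intro SUP_least mult_right_mono ennreal_leI) auto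
    obtain k :: nat where "w x < real k" using reals_Archimedean2 by blast
    then have "ennreal (w x) * indicator E x = ?f k x" by simp
    also have "\<dots> \<le> (SUP k. ?f k x)" by (rule SUP_upper) simp
    finally show "ennreal (w x) * indicator E x \<le> (SUP k. ?f k x)" .
  qed
  have "(SUP k::nat. emeasure (wmeasure (\<lambda>x. min (w x) (real (Suc k)))) E) = (SUP k. \<integral>\<^sup>+ x. ?f k x \<partial>lebesgue)"
    using E by (intro SUP_cong emeasure_wmeasure) auto
  also have "\<dots> = (\<integral>\<^sup>+ x. (SUP k. ?f k x) \<partial>lebesgue)"
    using E by (intro nn_integral_monotone_convergence_SUP[symmetric] incseq_SucI le_funI mult_right_mono ennreal_leI) auto
  also have "\<dots> = emeasure (wmeasure w) E"
    unfolding SUP by (rule emeasure_wmeasure[OF wm E, symmetric])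
  finally show ?thesis .
qed

lemma space_wmeasure [simp]: "space (wmeasure w) = UNIV"
  by (simp add: wmeasure_def)

lemma measurable_wmeasure: "h \<in> borel_measurable lebesgue \<Longrightarrow> h \<in> borel_measurable (wmeasure w)"
  by (simp add: wmeasure_def)

lemma ennreal_mult3: 
  "0 \<le> x \<Longrightarrow> 0 \<le> y \<Longrightarrow> 0 \<le> z \<Longrightarrow> ennreal x * (ennreal y * ennreal z) = ennreal (x * (y * z))"
  by (simp add: ennreal_mult)

text \<open>For a weight bounded by \<open>N\<close> the weak type (1,1) bound gives a multiple of N
  J / u with u = t^(1/p). This is where \<open>1 \<le> p\<close> enters: for t \<le> 1 it implies t
  \<le> u, so the product with \<open>t\<close> stays bounded.\<close>

lemma tail_truncation_bound:
  fixes F :: "real ^ 'n \<Rightarrow> ennreal"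
  assumes w: "w \<in> borel_measurable lebesgue" and N: "0 \<le> N" and p: "1 \<le> p" 
    and F: "F \<in> borel_measurable lebesgue" "(\<integral>\<^sup>+ x. F x \<partial>lebesgue) = ennreal J"
    and t: "0 < t" "t \<le> 1"
  shows "ennreal t * tail (wmeasure (\<lambda>x. min (w x) N)) (\<lambda>x. maximal F x epowr p) t
    \<le> ennreal (N * ((10 * real CARD('n)) ^ CARD('n) * J))"
proof (cases "J \<le> 0")
  case True
  \<comment> \<open>The sign of \<open>J\<close> is left open; a negative \<open>J\<close> also
    means that the integral is 0.\<close>
  then have J: "(\<integral>\<^sup>+ x. F x \<partial>lebesgue) = 0" using F by (simp add: ennreal_neg)
  let ?A = "{x. ennreal (t powr (1 / p)) < maximal F x}"
  have A: "?A \<in> sets lebesgue" using open_maximal_greater by auto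
  have "emeasure (wmeasure (\<lambda>x. min (w x) N)) ?A \<le> ennreal N * emeasure lebesgue ?A"
    by (intro emeasure_truncation_le w N A)
  also have "emeasure lebesgue ?A = 0" using weak_type_maximal[OF _ F(1), of "t powr (1 / p)"] t unfolding J by auto
  finally show ?thesis using p t by (simp add: tail_epowr)
next
  case False
  let ?c = "(10 * real CARD('n)) ^ CARD('n)" and ?u = "t powr (1 / p)"
  let ?A = "{x. ennreal ?u < maximal F x}"
  have u: "0 < ?u" using t by simp
  have A: "?A \<in> sets lebesgue" using open_maximal_greater by auto
  have "t powr 1 \<le> ?u" using t p by (intro powr_mono') auto
  then have tu: "t \<le> ?u" using t by simp
  have "tail (wmeasure (\<lambda>x. min (w x) N)) (\<lambda>x. maximal F x epowr p) t = emeasure (wmeasure (\<lambda>x. min (w x) N)) ?A"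
    using p t by (simp add: tail_epowr)
  also have "\<dots> \<le> ennreal N * emeasure lebesgue ?A"
    by (intro emeasure_truncation_le w N A)
  also have "\<dots> \<le> ennreal N * (ennreal (?c / ?u) * ennreal J)"
    using weak_type_maximal[OF u F(1)] unfolding F(2) by (intro mult_left_mono) auto
  also have "\<dots> = ennreal (N * (?c / ?u * J))"
    using ennreal_mult3[of N "?c / ?u" J] N False by simp
  finally have "ennreal t * tail (wmeasure (\<lambda>x. min (w x) N)) (\<lambda>x. maximal F x epowr p) t \<le> ennreal t * ennreal (N * (?c / ?u * J))"
    by (intro mult_left_mono) auto
  also have "\<dots> = ennreal (t * (N * (?c / ?u * J)))" using t by (intro ennreal_mult'[symmetric]) simp
  also have "\<dots> \<le> ennreal (N * (?c * J))"
  proof (rule ennreal_leI)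
    have "t * (N * (?c / ?u * J)) = (t / ?u) * (N * (?c * J))" by simp
    also have "\<dots> \<le> 1 * (N * (?c * J))" using tu u t N False by (intro mult_right_mono) auto
    finally show "t * (N * (?c / ?u * J)) \<le> N * (?c * J)" by simp
  qed
  finally show ?thesis .
qed

text \<open>The finite case uses the weight itself. In the integrable case the truncated weights
  satisfy the estimate with common constants, and monotone convergence in the truncation level gives
  the left-hand side for \<open>w\<close>.\<close>

lemma (in tail_functional) weighted_estimate:
  assumes a: "1 \<le> a" and q: "1 < q" and s: "1 \<le> s" and w: "w \<in> RH (conj_exponent s)"
    and p: "0 < p" and pq: "ennreal p < q / ennreal s"
  shows "\<exists>B>0. \<forall>F G H1 H2. F \<in> borel_measurable lebesgue \<longrightarrow> G \<in> borel_measurable lebesgue \<longrightarrow>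
    H2 \<in> borel_measurable lebesgue \<longrightarrow> cube_decomposition q a F G H1 H2 \<longrightarrow>
    \<Phi> (tail (wmeasure w) (\<lambda>x. maximal F x epowr p)) < top \<or> 1 \<le> p \<and> (\<integral>\<^sup>+ x. F x \<partial>lebesgue) < top \<longrightarrow>
    \<Phi> (tail (wmeasure w) (\<lambda>x. maximal F x epowr p)) \<le> ennreal B * (\<Phi> (tail (wmeasure w) (\<lambda>x. G x epowr p)) 
      + \<Phi> (tail (wmeasure w) (\<lambda>x. maximal H1 x epowr p)) + \<Phi> (tail (wmeasure (w :: real ^ 'n \<Rightarrow> real)) (\<lambda>x. H2 x epowr p)))"
proof -
  have wt: "weight w" using w by (simp add: RH_def)
  have wm [measurable]: "w \<in> borel_measurable lebesgue" using wt by (simp add: weight_def)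
  obtain C where A: "ainf (wmeasure w) C s" using RH_imp_ainf[OF s w] by blast
  define C' where "C' = 1 + 2 * C + 2 / (1 / (2 * C)) powr s"
  define wN where "wN k = wmeasure (\<lambda>x. min (w x) (real (Suc k)))" for k :: nat
  have A': "ainf (wN k) C' s" for k
    unfolding wN_def C'_def by (intro ainf_truncation[OF wt A s]) simp
  have C: "0 < C" "0 < C'" "0 < s" using A A'[of 0] by (auto simp: ainf_def)
  obtain D D' where D: "\<And>\<mu> :: (real ^ 'n) measure. ainf \<mu> C s \<Longrightarrow> doubling \<mu> D" 
    and D': "\<And>\<mu> :: (real ^ 'n) measure. ainf \<mu> C' s \<Longrightarrow> doubling \<mu> D'"
    using ainf_doubling[OF C(1,3)] ainf_doubling[OF C(2,3)] by metis
  have Dpos: "0 < D" "0 < D'" using D[OF A] D'[OF A'[of 0]] by (auto simp: doubling_def)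
  obtain B where B: "0 < B" "\<And>(\<mu> :: (real ^ 'n) measure) F G H1 H2. ainf \<mu> C s \<Longrightarrow> doubling \<mu> D \<Longrightarrow> 
    G \<in> borel_measurable lebesgue \<Longrightarrow> H2 \<in> borel_measurable lebesgue \<Longrightarrow> cube_decomposition q a F G H1 H2 \<Longrightarrow>
      \<Phi> (tail \<mu> (\<lambda>x. maximal F x epowr p)) < top \<Longrightarrow>
      \<Phi> (tail \<mu> (\<lambda>x. maximal F x epowr p)) \<le> ennreal B * (\<Phi> (tail \<mu> (\<lambda>x. G x epowr p)) + \<Phi> (tail \<mu> (\<lambda>x. maximal H1 x epowr p)) + 
        \<Phi> (tail \<mu> (\<lambda>x. H2 x epowr p)))"
    using maximal_estimate[OF a q p pq C(1) Dpos(1) C(3), where 'n = 'n] unfolding Let_def by blast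
  obtain B' where B': "0 < B'" "\<And>(\<mu> :: (real ^ 'n) measure) F G H1 H2 M. ainf \<mu> C' s \<Longrightarrow> doubling \<mu> D' \<Longrightarrow> 
    G \<in> borel_measurable lebesgue \<Longrightarrow> H2 \<in> borel_measurable lebesgue \<Longrightarrow> cube_decomposition q a F G H1 H2 \<Longrightarrow>
      (\<forall>t. 0 < t \<longrightarrow> t \<le> 1 \<longrightarrow> ennreal t * tail \<mu> (\<lambda>x. maximal F x epowr p) t \<le> ennreal M) \<Longrightarrow>
      \<Phi> (tail \<mu> (\<lambda>x. maximal F x epowr p)) \<le> ennreal B' * (\<Phi> (tail \<mu> (\<lambda>x. G x epowr p)) + \<Phi> (tail \<mu> (\<lambda>x. maximal H1 x epowr p)) + 
        \<Phi> (tail \<mu> (\<lambda>x. H2 x epowr p)))"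
    using maximal_estimate[OF a q p pq C(2) Dpos(2) C(3), where 'n = 'n] unfolding Let_def by blast
  define T where "T h = tail (wmeasure w) (\<lambda>x. h x epowr p)" for h :: "real ^ 'n \<Rightarrow> ennreal"
  define TN where "TN k h = tail (wN k) (\<lambda>x. h x epowr p)" for k and h :: "real ^ 'n \<Rightarrow> ennreal"
  have "\<Phi> (T (maximal F)) \<le> ennreal (B + B') * (\<Phi> (T G) + \<Phi> (T (maximal H1)) + \<Phi> (T H2))"
    if F: "F \<in> borel_measurable lebesgue" and G: "G \<in> borel_measurable lebesgue" 
      and H2: "H2 \<in> borel_measurable lebesgue" and dec: "cube_decomposition q a F G H1 H2"
      and fin: "\<Phi> (T (maximal F)) < top \<or> 1 \<le> p \<and> (\<integral>\<^sup>+ x. F x \<partial>lebesgue) < top"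
    for F G H1 H2
  proof (cases "\<Phi> (T (maximal F)) < top")
    case True
    then have "\<Phi> (T (maximal F)) \<le> ennreal B * (\<Phi> (T G) + \<Phi> (T (maximal H1)) + \<Phi> (T H2))"
      unfolding T_def by (rule B(2)[OF A D[OF A] G H2 dec])
    also have "\<dots> \<le> ennreal (B + B') * (\<Phi> (T G) + \<Phi> (T (maximal H1)) + \<Phi> (T H2))"
      using B'(1) by (intro mult_right_mono ennreal_leI) auto
    finally show ?thesis .
  next
    case False
    then have p1: "1 \<le> p" and "(\<integral>\<^sup>+ x. F x \<partial>lebesgue) < top" using fin by auto
    then obtain J where J: "(\<integral>\<^sup>+ x. F x \<partial>lebesgue) = ennreal J" by (metis ennreal_enn2real)
    have set: "{x. ennreal t < h x epowr p} \<in> sets lebesgue" if [measurable]: "h \<in> borel_measurable lebesgue" 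
      for t and h :: "real ^ 'n \<Rightarrow> ennreal"
    proof -
      have "{x \<in> space lebesgue. ennreal t < h x epowr p} \<in> sets lebesgue" by measurable
      then show ?thesis by simp
    qed
    have spN: "space (wN k) = UNIV" for k by (simp add: wN_def)
    \<comment> \<open>The right-hand terms only decrease under truncation, so a limit has to be
      taken on the left alone.\<close>
    have le: "\<Phi> (TN k h) \<le> \<Phi> (T h)" for k h
      unfolding TN_def T_def wN_def by (intro mono) (auto simp: tail_def intro!: emeasure_wmeasure_mono)
    have "\<Phi> (T (maximal F)) \<le> \<Phi> (\<lambda>t. SUP k. TN k (maximal F) t)"
      unfolding T_def TN_def tail_def spN
      using emeasure_truncation_SUP[OF wm set[OF borel_measurable_lebesgue_maximal]]
      by (intro mono) (simp add: wN_def)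
    also have "\<dots> \<le> (SUP k. \<Phi> (TN k (maximal F)))"
    proof (rule SUP)
      show "TN k (maximal F) \<in> borel_measurable borel" for k
        unfolding TN_def wN_def by (intro borel_measurable_tail measurable_wmeasure) measurable
      show "TN k (maximal F) t \<le> TN (Suc k) (maximal F) t" for k t
        unfolding TN_def tail_def spN unfolding wN_def by (intro emeasure_wmeasure_mono) auto
    qed
    also have "\<dots> \<le> ennreal B' * (\<Phi> (T G) + \<Phi> (T (maximal H1)) + \<Phi> (T H2))"
    proof (rule SUP_least)
      fix k
      have "\<Phi> (TN k (maximal F)) \<le> ennreal B' * (\<Phi> (TN k G) + \<Phi> (TN k (maximal H1)) + \<Phi> (TN k H2))"
        unfolding TN_def
      proof (rule B'(2)[OF A' D'[OF A'] G H2 dec], intro allI impI)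
        fix t :: real assume t: "0 < t" "t \<le> 1"
        show "ennreal t * tail (wN k) (\<lambda>x. maximal F x epowr p) t \<le> ennreal (real (Suc k) * ((10 * real CARD('n)) ^ CARD('n) * J))"
          unfolding wN_def by (intro tail_truncation_bound wm p1 F J t) simp
      qed
      also have "\<dots> \<le> ennreal B' * (\<Phi> (T G) + \<Phi> (T (maximal H1)) + \<Phi> (T H2))"
        by (intro mult_left_mono add_mono le) simp
      finally show "\<Phi> (TN k (maximal F)) \<le> ennreal B' * (\<Phi> (T G) + \<Phi> (T (maximal H1)) + \<Phi> (T H2))" .
    qed
    also have "\<dots> \<le> ennreal (B + B') * (\<Phi> (T G) + \<Phi> (T (maximal H1)) + \<Phi> (T H2))"
      using B(1) by (intro mult_right_mono ennreal_leI) auto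
    finally show ?thesis .
  qed
  moreover have "0 < B + B'" using B(1) B'(1) by simp
  ultimately show ?thesis unfolding T_def by blast
qed

section \<open>Norms in terms of the distribution function\<close>

lemma sigma_finite_wmeasure:
  assumes "weight w"
  shows "sigma_finite_measure (wmeasure w)"
proof
  show "\<exists>A. countable A \<and> A \<subseteq> sets (wmeasure w) \<and> \<Union> A = space (wmeasure w) \<and> (\<forall>a\<in>A. emeasure (wmeasure w) a \<noteq> \<infinity>)"
  proof (intro exI[of _ "range (\<lambda>R::nat. ball 0 (real R))"] conjI ballI)
    show "\<Union> (range (\<lambda>R::nat. ball 0 (real R))) = space (wmeasure w)" using UN_ball_nat by simp
    show "emeasure (wmeasure w) A \<noteq> \<infinity>" if A: "A \<in> range (\<lambda>R::nat. ball 0 (real R))" for A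
      using A weight_finite_ball[OF assms] by (auto simp: less_top)
  qed auto
qed

lemma Lp_norm_eq_tail:
  assumes "weight w" "h \<in> borel_measurable lebesgue"
  shows "Lp_norm p w h = (\<integral>\<^sup>+ t. tail (wmeasure w) (\<lambda>x. h x epowr p) t * indicator {0<..} t \<partial>lborel) epowr (1 / p)"
proof -
  have [measurable]: "h \<in> borel_measurable lebesgue" by fact
  show ?thesis
    unfolding Lp_norm_def
    by (subst layer_cake[OF sigma_finite_wmeasure[OF assms(1)]]) (auto intro!: measurable_wmeasure)
qed

text \<open>The substitution of t^p for the level turns the supremum for the p-th power of
  \<open>h\<close> into the p-th power of the weak norm.\<close>

lemma weak_Lp_norm_eq_tail:
  assumes p: "0 < p"
  shows "weak_Lp_norm p w h = (SUP t\<in>{0<..}. ennreal t * tail (wmeasure w) (\<lambda>x. h x epowr p) t) epowr (1 / p)"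
proof -
  have im: "{0::real<..} = (\<lambda>t. t powr p) ` {0<..}"
  proof (intro equalityI subsetI)
    fix u :: real assume "u \<in> {0<..}"
    then show "u \<in> (\<lambda>t. t powr p) ` {0<..}" using p by (intro image_eqI[of _ _ "u powr (1 / p)"]) (auto simp: powr_powr)
  qed auto
  have "(SUP t\<in>{0<..}. ennreal t * tail (wmeasure w) (\<lambda>x. h x epowr p) t) epowr (1 / p) = 
      (SUP t\<in>{0<..}. (ennreal t * tail (wmeasure w) (\<lambda>x. h x epowr p) t) epowr (1 / p))"
    using p by (intro epowr_SUP) simp
  also have "\<dots> = (SUP t\<in>{0<..}. (ennreal (t powr p) * tail (wmeasure w) (\<lambda>x. h x epowr p) (t powr p)) epowr (1 / p))"
    by (subst im) (simp add: image_image)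
  also have "\<dots> = weak_Lp_norm p w h"
    unfolding weak_Lp_norm_def
  proof (rule SUP_cong)
    fix t :: real assume "t \<in> {0<..}"
    then have t: "0 < t" by simp
    have "(ennreal (t powr p) * tail (wmeasure w) (\<lambda>x. h x epowr p) (t powr p)) epowr (1 / p) = 
       ennreal (t powr p) epowr (1 / p) * tail (wmeasure w) (\<lambda>x. h x epowr p) (t powr p) epowr (1 / p)"
      using p by (intro epowr_mult) simp
    also have "\<dots> = ennreal t * emeasure (wmeasure w) {x. ennreal t < h x} epowr (1 / p)"
      using p t by (simp add: epowr_ennreal powr_powr tail_epowr)
    finally show "(ennreal (t powr p) * tail (wmeasure w) (\<lambda>x. h x epowr p) (t powr p)) epowr (1 / p) = 
      ennreal t * emeasure (wmeasure w) {x. ennreal t < h x} epowr (1 / p)" .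
  qed simp
  finally show ?thesis ..
qed

text \<open>For \<open>r > 1\<close> the power is not subadditive; comparison with the largest
  summand costs only the factor \<open>3 powr r\<close>.\<close>

lemma epowr_add3_le:
  assumes r: "0 < r" and B: "0 < B"
  shows "(ennreal B * (x + y + z)) epowr r \<le> ennreal ((B * 3) powr r) * (x epowr r + y epowr r + z epowr r)"
proof -
  define m where "m = max x (max y z)"
  have "x + y + z \<le> m + m + m" by (intro add_mono) (auto simp: m_def le_max_iff_disj)
  also have "\<dots> = ennreal 3 * m"
    by (metis (no_types, opaque_lifting) add.assoc distrib_right ennreal_1 ennreal_numeral mult_1 numeral_Bit1 numeral_One numeral_plus_one one_add_one zero_le_numeral)
  finally have "ennreal B * (x + y + z) \<le> ennreal B * (ennreal 3 * m)" by (intro mult_left_mono) auto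
  also have "\<dots> = ennreal (B * 3) * m"
    unfolding mult.assoc[symmetric] using B by (subst ennreal_mult[symmetric]) auto
  finally have "(ennreal B * (x + y + z)) epowr r \<le> (ennreal (B * 3) * m) epowr r"
    using r by (intro epowr_mono) auto
  also have "\<dots> = ennreal ((B * 3) powr r) * m epowr r"
    using r B by (simp add: epowr_mult epowr_ennreal)
  also have "m epowr r \<le> x epowr r + y epowr r + z epowr r"
  proof -
    consider "m = x" | "m = y" | "m = z" unfolding m_def max_def by metis
    then show ?thesis by cases (simp_all add: add.assoc add_increasing add_increasing2)
  qed
  finally show ?thesis by (simp add: mult_left_mono)
qed

theorem theorem3p1:
  fixes a :: real
  assumes "1 \<le> a"
  shows "\<exists>K0::real. 1 \<le> K0 \<and>
    (\<forall>(q::ennreal) (s::real) (w :: real ^ 'n \<Rightarrow> real).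
      1 < q \<and> 1 \<le> s \<and> w \<in> RH (conj_exponent s) \<longrightarrow>
      (\<exists>C::real. 0 < C \<and>
        (\<forall>F\<in>borel_measurable lebesgue. \<forall>G\<in>borel_measurable lebesgue.
         \<forall>H1\<in>borel_measurable lebesgue. \<forall>H2\<in>borel_measurable lebesgue.
          cube_decomposition q a F G H1 H2 \<longrightarrow>
          (\<forall>(lam::real) (K::real) (\<gamma>::real). 0 < lam \<and> K0 \<le> K \<and> 0 < \<gamma> \<and> \<gamma> < 1 \<longrightarrow>
            emeasure (wmeasure w)
              {x. ennreal (K * lam) < maximal F x \<and> G x + H2 x \<le> ennreal (\<gamma> * lam)}
            \<le> ennreal (C * (ratio_pow q a K + \<gamma> / K) powr (1 / s)) *
              emeasure (wmeasure w) {x. ennreal lam < maximal F x + maximal H1 x}))) \<and>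
      (\<forall>p::real. 0 < p \<and> ennreal p < q / ennreal s \<longrightarrow>
        (\<exists>C::real. 0 < C \<and>
          (\<forall>F\<in>borel_measurable lebesgue. \<forall>G\<in>borel_measurable lebesgue.
           \<forall>H1\<in>borel_measurable lebesgue. \<forall>H2\<in>borel_measurable lebesgue.
            cube_decomposition q a F G H1 H2 \<longrightarrow>
            (Lp_norm p w (maximal F) < \<infinity> \<or> 1 \<le> p \<and> (\<integral>\<^sup>+ x. F x \<partial>lebesgue) < \<infinity> \<longrightarrow>
              Lp_norm p w (maximal F) \<le> ennreal C *
                (Lp_norm p w G + Lp_norm p w (maximal H1) + Lp_norm p w H2)) \<and>
            (weak_Lp_norm p w (maximal F) < \<infinity> \<or> 1 \<le> p \<and> (\<integral>\<^sup>+ x. F x \<partial>lebesgue) < \<infinity> \<longrightarrow>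
              weak_Lp_norm p w (maximal F) \<le> ennreal C *
                (weak_Lp_norm p w G + weak_Lp_norm p w (maximal H1) + weak_Lp_norm p w H2))))))"
proof (rule exI[of _ "max (4 * a) (16 ^ CARD('n))"], intro conjI allI impI)
  \<comment> \<open>\<open>4 * a\<close> is what \<open>cube_estimate\<close> needs for infinite
    \<open>q\<close>, \<open>16 ^ n\<close> is what \<open>small_cube\<close> needs; neither
    involves the weight or the exponents.\<close>
  show "1 \<le> max (4 * a) (16 ^ CARD('n))" using assms by simp
next
  fix q :: ennreal and s :: real and w :: "real ^ 'n \<Rightarrow> real"
  assume *: "1 < q \<and> 1 \<le> s \<and> w \<in> RH (conj_exponent s)"
  obtain C where A: "ainf (wmeasure w) C s" using RH_imp_ainf[of s w] * by blast
  then have C: "0 < C" "0 < s" by (auto simp: ainf_def)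
  obtain D where D: "doubling (wmeasure w) D" using ainf_doubling[OF C, where 'n = 'n] A by blast
  then have "0 < D" by (simp add: doubling_def)
  show "\<exists>C>0. \<forall>F\<in>borel_measurable lebesgue. \<forall>G\<in>borel_measurable lebesgue.
         \<forall>H1\<in>borel_measurable lebesgue. \<forall>H2\<in>borel_measurable lebesgue.
          cube_decomposition q a F G H1 H2 \<longrightarrow>
          (\<forall>(lam::real) (K::real) (\<gamma>::real). 0 < lam \<and> max (4 * a) (16 ^ CARD('n)) \<le> K \<and> 0 < \<gamma> \<and> \<gamma> < 1 \<longrightarrow>
            emeasure (wmeasure w)
              {x. ennreal (K * lam) < maximal F x \<and> G x + H2 x \<le> ennreal (\<gamma> * lam)}
            \<le> ennreal (C * (ratio_pow q a K + \<gamma> / K) powr (1 / s)) *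
              emeasure (wmeasure w) {x. ennreal lam < maximal F x + maximal H1 x})"
  proof (intro exI[of _ "good_lambda_const TYPE('n) q C D s"] conjI ballI allI impI)
    show "0 < good_lambda_const TYPE('n) q C D s" using C \<open>0 < D\<close> by (intro good_lambda_const_pos)
  next
    fix F G H1 H2 :: "real ^ 'n \<Rightarrow> ennreal" and lam K \<gamma> :: real
    assume meas: "G \<in> borel_measurable lebesgue" "H2 \<in> borel_measurable lebesgue"
      and dec: "cube_decomposition q a F G H1 H2"
      and **: "0 < lam \<and> max (4 * a) (16 ^ CARD('n)) \<le> K \<and> 0 < \<gamma> \<and> \<gamma> < 1"
    show "emeasure (wmeasure w)
              {x. ennreal (K * lam) < maximal F x \<and> G x + H2 x \<le> ennreal (\<gamma> * lam)}
            \<le> ennreal (good_lambda_const TYPE('n) q C D s * (ratio_pow q a K + \<gamma> / K) powr (1 / s)) *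
              emeasure (wmeasure w) {x. ennreal lam < maximal F x + maximal H1 x}"
      using * ** by (intro good_lambda_inequality[OF dec assms _ meas _ _ _ _ _ A D]) auto
  qed
next
  fix q :: ennreal and s p :: real and w :: "real ^ 'n \<Rightarrow> real"
  assume *: "1 < q \<and> 1 \<le> s \<and> w \<in> RH (conj_exponent s)" and **: "0 < p \<and> ennreal p < q / ennreal s"
  have wt: "weight w" using * by (simp add: RH_def)
  have p: "0 < p" "0 < 1 / p" using ** by auto
  note params = assms conjunct1[OF *] conjunct1[OF conjunct2[OF *]] conjunct2[OF conjunct2[OF *]] conjunct1[OF **] conjunct2[OF **]
  obtain B where B: "0 < B" and strong: "\<And>F G H1 H2. F \<in> borel_measurable lebesgue \<Longrightarrow> G \<in> borel_measurable lebesgue \<Longrightarrow>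
    H2 \<in> borel_measurable lebesgue \<Longrightarrow> cube_decomposition q a F G H1 H2 \<Longrightarrow>
    (\<integral>\<^sup>+ t. tail (wmeasure w) (\<lambda>x. maximal F x epowr p) t * indicator {0<..} t \<partial>lborel) < top 
      \<or> 1 \<le> p \<and> (\<integral>\<^sup>+ x. F x \<partial>lebesgue) < top \<Longrightarrow>
    (\<integral>\<^sup>+ t. tail (wmeasure w) (\<lambda>x. maximal F x epowr p) t * indicator {0<..} t \<partial>lborel) \<le> ennreal B * 
      ((\<integral>\<^sup>+ t. tail (wmeasure w) (\<lambda>x. G x epowr p) t * indicator {0<..} t \<partial>lborel)
      + (\<integral>\<^sup>+ t. tail (wmeasure w) (\<lambda>x. maximal H1 x epowr p) t * indicator {0<..} t \<partial>lborel)
      + (\<integral>\<^sup>+ t. tail (wmeasure w) (\<lambda>x. H2 x epowr p) t * indicator {0<..} t \<partial>lborel))"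
    using tail_integral.weighted_estimate[OF params] by blast
  obtain B' where B': "0 < B'" and weak: "\<And>F G H1 H2. F \<in> borel_measurable lebesgue \<Longrightarrow> G \<in> borel_measurable lebesgue \<Longrightarrow>
    H2 \<in> borel_measurable lebesgue \<Longrightarrow> cube_decomposition q a F G H1 H2 \<Longrightarrow>
    (SUP t\<in>{0<..}. ennreal t * tail (wmeasure w) (\<lambda>x. maximal F x epowr p) t) < top 
      \<or> 1 \<le> p \<and> (\<integral>\<^sup>+ x. F x \<partial>lebesgue) < top \<Longrightarrow>
    (SUP t\<in>{0<..}. ennreal t * tail (wmeasure w) (\<lambda>x. maximal F x epowr p) t) \<le> ennreal B' * 
      ((SUP t\<in>{0<..}. ennreal t * tail (wmeasure w) (\<lambda>x. G x epowr p) t)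
      + (SUP t\<in>{0<..}. ennreal t * tail (wmeasure w) (\<lambda>x. maximal H1 x epowr p) t)
      + (SUP t\<in>{0<..}. ennreal t * tail (wmeasure w) (\<lambda>x. H2 x epowr p) t))"
    using tail_supremum.weighted_estimate[OF params] by blast
  \<comment> \<open>The sum dominates both constants, so that one \<open>E\<close> serves the strong
    and the weak inequality.\<close>
  define E where "E = (B * 3) powr (1 / p) + (B' * 3) powr (1 / p)"
  have E: "0 < E" "(B * 3) powr (1 / p) \<le> E" "(B' * 3) powr (1 / p) \<le> E" using B B' by (auto simp: E_def add_pos_pos)
  have root: "x epowr (1 / p) \<le> ennreal E * (y epowr (1 / p) + y' epowr (1 / p) + z epowr (1 / p))"
    if "x \<le> ennreal b * (y + y' + z)" "0 < b" "(b * 3) powr (1 / p) \<le> E" for x y y' z b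
  proof -
    have "x epowr (1 / p) \<le> (ennreal b * (y + y' + z)) epowr (1 / p)" using that(1) p by (intro epowr_mono) auto
    also have "\<dots> \<le> ennreal ((b * 3) powr (1 / p)) * (y epowr (1 / p) + y' epowr (1 / p) + z epowr (1 / p))"
      by (rule epowr_add3_le[OF p(2) that(2)])
    also have "\<dots> \<le> ennreal E * (y epowr (1 / p) + y' epowr (1 / p) + z epowr (1 / p))"
      by (intro mult_right_mono ennreal_leI that(3)) simp
    finally show ?thesis .
  qed
  have fin: "x < top" if "x epowr (1 / p) < top" for x using that by (cases x) auto
  show "\<exists>C>0. \<forall>F\<in>borel_measurable lebesgue. \<forall>G\<in>borel_measurable lebesgue.
           \<forall>H1\<in>borel_measurable lebesgue. \<forall>H2\<in>borel_measurable lebesgue.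
            cube_decomposition q a F G H1 H2 \<longrightarrow>
            (Lp_norm p w (maximal F) < \<infinity> \<or> 1 \<le> p \<and> (\<integral>\<^sup>+ x. F x \<partial>lebesgue) < \<infinity> \<longrightarrow>
              Lp_norm p w (maximal F) \<le> ennreal C *
                (Lp_norm p w G + Lp_norm p w (maximal H1) + Lp_norm p w H2)) \<and>
            (weak_Lp_norm p w (maximal F) < \<infinity> \<or> 1 \<le> p \<and> (\<integral>\<^sup>+ x. F x \<partial>lebesgue) < \<infinity> \<longrightarrow>
              weak_Lp_norm p w (maximal F) \<le> ennreal C *
                (weak_Lp_norm p w G + weak_Lp_norm p w (maximal H1) + weak_Lp_norm p w H2))"
  proof (intro exI[of _ E] conjI ballI impI E(1))
    fix F G H1 H2 :: "real ^ 'n \<Rightarrow> ennreal"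
    assume meas: "F \<in> borel_measurable lebesgue" "G \<in> borel_measurable lebesgue" "H2 \<in> borel_measurable lebesgue"
      and dec: "cube_decomposition q a F G H1 H2"
      and or: "Lp_norm p w (maximal F) < \<infinity> \<or> 1 \<le> p \<and> (\<integral>\<^sup>+ x. F x \<partial>lebesgue) < \<infinity>"
    show "Lp_norm p w (maximal F) \<le> ennreal E * (Lp_norm p w G + Lp_norm p w (maximal H1) + Lp_norm p w H2)"
      using or unfolding Lp_norm_eq_tail[OF wt borel_measurable_lebesgue_maximal] Lp_norm_eq_tail[OF wt meas(2)] Lp_norm_eq_tail[OF wt meas(3)]
      by (intro root[OF strong[OF meas dec] B E(2)]) (auto dest: fin)
  next
    fix F G H1 H2 :: "real ^ 'n \<Rightarrow> ennreal"
    assume meas: "F \<in> borel_measurable lebesgue" "G \<in> borel_measurable lebesgue" "H2 \<in> borel_measurable lebesgue"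
      and dec: "cube_decomposition q a F G H1 H2"
      and or: "weak_Lp_norm p w (maximal F) < \<infinity> \<or> 1 \<le> p \<and> (\<integral>\<^sup>+ x. F x \<partial>lebesgue) < \<infinity>"
    show "weak_Lp_norm p w (maximal F) \<le> ennreal E * (weak_Lp_norm p w G + weak_Lp_norm p w (maximal H1) + weak_Lp_norm p w H2)"
      using or unfolding weak_Lp_norm_eq_tail[OF p(1)]
      by (intro root[OF weak[OF meas dec] B' E(3)]) (auto dest: fin)
  qed
qed

end
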